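(* In the setting described in the context (in particular under all the assumptions listed there, with exponent $\alpha=1$ in the coercivity condition, i.e. $C_{coe}\|{}_\theta\mathbf F(u)-{}_\theta\mathbf F(u_* )\|_{\mathcal U^*\times H}\ge\|u-u_*\|_{\mathcal V}$ with $u_*=S(\theta)$ for all $\theta\in B_R^X(\theta^\dagger)$, $u\in B_r^{\mathcal V}(u^\dagger)$, and with exact data $y=G(\theta^\dagger)$), let the bi-level algorithm and the sequential bi-level algorithm be run with noise-free data $y$ and initial guess $\widetilde\theta^0\in B_R^X(\theta^\dagger)$, and let the lower-level iterations be terminated according to one of the following two rules on the state errors $\epsilon_j$ (the $\mathcal U$-norm distance between the lower-level output at the stopping index and $S(\widetilde\theta^j)$): (a) (a priori) $C_{\mathrm{pri}}\sum_{j=0}^\infty\epsilon_j^2\le R^2-R_0^2$, where $\|\widetilde\theta^0-\theta^\dagger\|_X\le R_0<R$; or (b) (posterior) $C_{\mathrm{pos}}\,\epsilon_j\le\|G(\widetilde\theta^j)-y\|_{\mathcal Y}$ for all $j$. Denote by $K(j)$ the stopping index of the $j$-th lower-level in the (non-sequential) bi-level algorithm and by $\kappa(j)$ that of the sequential bi-level algorithm. Then the sequential bi-level algorithm requires fewer lower-level iterations than the bi-level algorithm, in the sense that, as $j\to\infty$, $$\kappa(j)=o\big(1/\epsilon_j^2\big),\qquad K(j)=\mathcal O\big(1/\epsilon_j^2\big).$$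
   Context: Spaces and operators. $U\hookrightarrow H\hookrightarrow U^*$ is a Gelfand triple with $U$ a Hilbert space, $T>0$, $\mathcal U=L^2(0,T;U)$, $\mathcal U^*=L^2(0,T;U^* )$, $\mathcal V=\{u\in\mathcal U:\dot u\in\mathcal U^*\}$ (so $\mathcal V\hookrightarrow C(0,T;H)$). $X$ (parameter space) and $\mathcal Y$ (observation space) are Hilbert spaces, $A:X\to H$ and $L:\mathcal U\to\mathcal Y$ are bounded linear. $f:(0,T)\times X\times U\to U^*$ is a nonlinear Carathéodory map inducing $f:X\times\mathcal V\to\mathcal U^*$, $[f(\theta,u)](t)=f(t,\theta,u(t))$, with partial derivatives $f'_\theta,f'_u$. $S:X\to\mathcal V$ is the parameter-to-state map: $u=S(\theta)$ solves $\dot u+f(\theta,u)=0$ on $(0,T)$, $u(0)=A\theta$ (assumed solvable); $S$ is Fréchet differentiable. $G=L\circ S$. Set $F(\theta,u)={}_\theta\mathbf F(u)=(\dot u+f(\theta,u),\,u|_{t=0}-A\theta)\in\mathcal U^*\times H$, so that $u=S(\theta)$ solves $F(\theta,u)=\varphi$ (with $\varphi=0$). $D_U:U\to U^*$ and $I_X:X^*\to X$ are (Riesz) isomorphisms; $^\star$ is the Banach space adjoint, $^*$ on operators between Hilbert spaces is the Hilbert space adjoint. $\theta^\dagger$ is the exact parameter, $u^\dagger=S(\theta^\dagger)$, $y=G(\theta^\dagger)$; $B_R^X(\theta^\dagger)$, $B_r^{\mathcal V}(u^\dagger)$ are closed balls. Algorithms (noise-free data $y$; $\kappa(j)$ is replaced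 by $K(j)$ for the non-sequential algorithm). Upper level: $\widetilde\theta^{j+1}=\widetilde\theta^j-\widetilde{S'}(\widetilde\theta^j)^*L^*\big(L\widetilde S_{\kappa(j)}(\widetilde\theta^j)-y\big)$, $j=0,1,\dots$. Lower level: for each $j$, starting from $u^j_0$, $u^j_{k+1}=u^j_k-F'_u(\widetilde\theta^j,u^j_k)^*\big(F(\widetilde\theta^j,u^j_k)-\varphi\big)$ until $k=\kappa(j)$, and $\widetilde S_{\kappa(j)}(\widetilde\theta^j):=u^j_{\kappa(j)}$, $\epsilon_j:=\|u^j_{\kappa(j)}-u^j_*\|_{\mathcal U}$ with $u^j_*:=S(\widetilde\theta^j)$. At least one iteration takes place in each lower-level ($\kappa(j),K(j)\ge1$). In the bi-level algorithm $u^j_0$ is arbitrary in $B^{\mathcal V}_{r/2}(u^j_* )$; in the sequential bi-level algorithm $u^j_0:=u^{j-1}_{\kappa(j-1)}$ for $j\ge1$, and it is assumed that $u^j_0\in B^{\mathcal V}_{r/2}(u^j_* )$ for all $j$. The states $u^j_*$ and the lower-level iterates $u^j_k$ lie in $B_r^{\mathcal V}(u^\dagger)$ as long as $\widetilde\theta^j\in B_R^X(\theta^\dagger)$. The approximate adjoint is, for $v\in\mathcal U$, $$\widetilde{S'}(\widetilde\theta^j)^*v=-\int_0^T I_Xf'_\theta(\widetilde\theta^j,u^j_{\kappa(j)})(t)^\star\tilde z(t)\,dt+I_XA^\star\tilde z(0),$$ where $-\dot{\tilde z}+f'_u(\widetilde\theta^j,u^j_{\kappa(j)})^\star\tilde z=D_Uv$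 on $(0,T)$, $\tilde z(T)=0$ (the exact adjoint $S'(\theta)^*v$ has the same form with $S(\theta)$ in place of $u^j_{\kappa(j)}$). Assumptions: for all $\theta,\hat\theta\in B_R^X(\theta^\dagger)$, $u,\hat u\in B_r^{\mathcal V}(u^\dagger)$, with positive constants $\overline M_S,M_S,C_{f_u},L_{\nabla f},C_{coe},M_r,\mu_r,M_R,\mu_R,K_R$, where $M_r^2+\mu_r<2$, $M_R^2+\mu_R<2$: (A1) $\|S'(\theta)\|_{X\to\mathcal V}\le\overline M_S$, $\|S'(\theta)\|_{X\to\mathcal U}\le M_S$, $\|G'(\theta)\|_{X\to\mathcal Y}\le M_R$. (A2) The adjoint equation $-\dot z+f'_u(\theta,u)^\star z=h$, $z(T)=0$ has a solution with $\|z\|_{\mathcal U}+\|z(0)\|_H\le C_{f_u}\|h\|_{\mathcal U^*}$. (A3) $\|f'_\theta(\theta,u)-f'_\theta(\hat\theta,\hat u)\|_{X\to\mathcal U^*}+\|f'_u(\theta,u)-f'_u(\hat\theta,\hat u)\|_{\mathcal U\to\mathcal U^*}\le L_{\nabla f}(\|\theta-\hat\theta\|_X+\|u-\hat u\|_{\mathcal U})$. (A4) $\|{}_\theta\mathbf F'(u)\|_{\mathcal V\to\mathcal U^*\times H}\le M_r$. (A5) $2\big({}_\theta\mathbf F(u)-{}_\theta\mathbf F(\hat u),{}_\theta\mathbf F'(u)(u-\hat u)\big)_{\mathcal U^*\times H}\ge(M_r^2+\mu_r)\|{}_\theta\mathbf F(u)-{}_\theta\mathbf F(\hat u)\|^2_{\mathcal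 U^*\times H}$. (A6) (coercivity) $C_{coe}\|{}_\theta\mathbf F(u)-{}_\theta\mathbf F(u_* )\|_{\mathcal U^*\times H}\ge\|u-u_*\|_{\mathcal V}^\alpha$, $u_*=S(\theta)$ (here $\alpha=1$). (A7) $2\big(G(\theta)-G(\hat\theta),G'(\theta)(\theta-\hat\theta)\big)_{\mathcal Y}\ge(M_R^2+\mu_R)\|G(\theta)-G(\hat\theta)\|^2_{\mathcal Y}$ and $\|G'(\theta)(\theta-\hat\theta)\|_{\mathcal Y}\le K_R\|G(\theta)-G(\hat\theta)\|_{\mathcal Y}$. Constants. $L_{R,r}:=L_{\nabla f}(R+rC_{\mathcal V\to\mathcal U})+\|f'_\theta(\theta^\dagger,u^\dagger)\|_{X\to\mathcal U^*}+\|f'_u(\theta^\dagger,u^\dagger)\|_{\mathcal U\to\mathcal U^*}$ with $C_{\mathcal V\to\mathcal U}$ the embedding norm; $C_{\nabla f,A}:=L_{\nabla f}C_{f_u}\|I_X\|\|D_U\|\,[L_{R,r}C_{f_u}+1+\|A\|C_{f_u}]$; $\bar\epsilon$ is an upper bound of all $\epsilon_j$; $\widetilde M_R:=(M_S+C_{\nabla f,A}\bar\epsilon)\|L\|$; $\eta>0$ is such that $(1+\eta)\widetilde M_R^2<M_R^2+\mu_R/2$; $0\le\sigma<\mu_R$ in rule (a), $0<\nu<\sigma/2$ and $\sigma<\mu_R$ in rule (b); $$C_{\mathrm{pri}}:=\|L\|^2\left(\frac{2(K_R+C_{\nabla f,A}R)^2}{\mu_R-\sigma}+\Big(1+\frac1\eta\Big)\widetilde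 M_R^2+2C_{\nabla f,A}R\right),\qquad C_{\mathrm{pos}}:=\sqrt{\frac{C_{\mathrm{pri}}}{\sigma/2-\nu}}.$$ *)

theory Defs
  imports "HOL-Analysis.Analysis" "HOL-Library.Landau_Symbols"
begin

section \<open>Bochner spaces\<close>

text \<open>The Bochner integral of the library needs a second countable codomain; no separability is
  assumed here, so strong measurability is stated directly.\<close>

definition strongly_measurable :: "'a measure \<Rightarrow> ('a \<Rightarrow> 'b::topological_space) \<Rightarrow> bool" where
  "strongly_measurable M g \<longleftrightarrow>
     (\<exists>s. (\<forall>n. simple_function M (s n)) \<and> (AE t in M. (\<lambda>n. s n t) \<longlonglongrightarrow> g t))"

abbreviation time_measure :: "real \<Rightarrow> real measure" where
  "time_measure T \<equiv> lebesgue_on {0<..<T}"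

definition square_integrable :: "real \<Rightarrow> (real \<Rightarrow> 'b::real_normed_vector) \<Rightarrow> bool" where
  "square_integrable T g \<longleftrightarrow>
     strongly_measurable (time_measure T) g \<and>
     integrable (time_measure T) (\<lambda>t. (norm (g t))\<^sup>2)"

text \<open>A type cannot depend on the real number \<open>T\<close>. The space \<open>L\<^sup>2(0,T;B)\<close> is therefore a type
  \<open>'l\<close> together with a map \<open>rep\<close> choosing a representative of each equivalence class; the conditions
  say that \<open>x \<mapsto> [rep x]\<close> is an isometric isomorphism from \<open>'l\<close> onto the classes modulo equality
  almost everywhere. The inner product of \<open>'l\<close> is determined by its norm through polarization, so
  \<open>B\<close> may be a dual space \<open>'u \<Rightarrow>\<^sub>L real\<close>, which carries no inner product in the library.\<close>

definition is_L2 :: "real \<Rightarrow> ('l::real_inner \<Rightarrow> real \<Rightarrow> 'b::real_normed_vector) \<Rightarrow> bool" where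
  "is_L2 T rep \<longleftrightarrow>
     (\<forall>x. square_integrable T (rep x)) \<and>
     (\<forall>x y. AE t in time_measure T. rep (x + y) t = rep x t + rep y t) \<and>
     (\<forall>c x. AE t in time_measure T. rep (c *\<^sub>R x) t = c *\<^sub>R rep x t) \<and>
     (\<forall>x. (norm x)\<^sup>2 = (\<integral>t. (norm (rep x t))\<^sup>2 \<partial>time_measure T)) \<and>
     (\<forall>g. square_integrable T g \<longrightarrow> (\<exists>x. AE t in time_measure T. rep x t = g t))"

definition L2_class :: "real \<Rightarrow> ('l \<Rightarrow> real \<Rightarrow> 'b) \<Rightarrow> (real \<Rightarrow> 'b) \<Rightarrow> 'l" where
  "L2_class T rep g = (THE x. AE t in time_measure T. rep x t = g t)"

text \<open>Duality pairing of \<open>L\<^sup>2(0,T;U\<^sup>*)\<close> with \<open>L\<^sup>2(0,T;U)\<close>.\<close>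

definition pairing ::
  "real \<Rightarrow> ('l \<Rightarrow> real \<Rightarrow> 'u::real_normed_vector) \<Rightarrow> ('m \<Rightarrow> real \<Rightarrow> ('u \<Rightarrow>\<^sub>L real)) \<Rightarrow> 'm \<Rightarrow> 'l \<Rightarrow> real"
where
  "pairing T repU repU' w x = (\<integral>t. blinfun_apply (repU' w t) (repU x t) \<partial>time_measure T)"

text \<open>Integral of a Hilbert space valued function in the weak sense; it agrees with the Bochner
  integral whenever the latter exists.\<close>

definition weak_integral :: "'a measure \<Rightarrow> ('a \<Rightarrow> 'x::real_inner) \<Rightarrow> 'x" where
  "weak_integral M g =
     (THE x. \<forall>\<xi>. integrable M (\<lambda>t. inner (g t) \<xi>) \<and> inner x \<xi> = (\<integral>t. inner (g t) \<xi> \<partial>M))"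

section \<open>Dual spaces and adjoints\<close>

definition D_iso :: "'u::real_inner \<Rightarrow> ('u \<Rightarrow>\<^sub>L real)" where
  "D_iso = blinfun_inner_right"

definition I_iso :: "('x::real_inner \<Rightarrow>\<^sub>L real) \<Rightarrow> 'x" where
  "I_iso = inv blinfun_inner_right"

text \<open>The Banach space adjoint of \<open>B : X \<rightarrow> U\<^sup>*\<close>, as a map \<open>U \<rightarrow> X\<^sup>*\<close> through \<open>U = U\<^sup>*\<^sup>*\<close>.\<close>

definition adjoint_to_dual ::
  "('x::real_normed_vector \<Rightarrow>\<^sub>L ('u::real_normed_vector \<Rightarrow>\<^sub>L real)) \<Rightarrow> 'u \<Rightarrow> ('x \<Rightarrow>\<^sub>L real)" where
  "adjoint_to_dual B z = Blinfun (\<lambda>\<xi>. blinfun_apply (blinfun_apply B \<xi>) z)"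

text \<open>The Banach space adjoint of \<open>A : X \<rightarrow> H\<close>, as a map \<open>H \<rightarrow> X\<^sup>*\<close> through \<open>H = H\<^sup>*\<close>
  (\<open>H\<close> is the pivot space).\<close>

definition adjoint_from_pivot ::
  "('x::real_normed_vector \<Rightarrow>\<^sub>L 'h::real_inner) \<Rightarrow> 'h \<Rightarrow> ('x \<Rightarrow>\<^sub>L real)" where
  "adjoint_from_pivot A h = blinfun_inner_right h o\<^sub>L A"

text \<open>The Banach space adjoint of an operator \<open>B\<close> from a space \<open>'l\<close> to its dual, where the dual is
  represented by \<open>'m\<close> with duality pairing \<open>p\<close> and \<open>'l\<close> is reflexive; it maps \<open>'l\<close> to \<open>'m\<close>.\<close>

definition dual_adjoint :: "('m \<Rightarrow> 'l \<Rightarrow> real) \<Rightarrow> ('l \<Rightarrow> 'm) \<Rightarrow> 'l \<Rightarrow> 'm" where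
  "dual_adjoint p B z = (THE w. \<forall>x. p w x = p (B x) z)"

section \<open>Gelfand triples and the solution space\<close>

text \<open>\<open>U \<hookrightarrow> H\<close> is the embedding \<open>\<iota>\<close>, and \<open>H \<hookrightarrow> U\<^sup>*\<close> is \<open>h \<mapsto> (h, \<iota> \<cdot>)\<^sub>H\<close>; density of \<open>U\<close> in \<open>H\<close> makes
  the latter injective.\<close>

definition gelfand_triple :: "('u::real_inner \<Rightarrow>\<^sub>L 'h::real_inner) \<Rightarrow> bool" where
  "gelfand_triple \<iota> \<longleftrightarrow>
     inj (blinfun_apply \<iota>) \<and> closure (range (blinfun_apply \<iota>)) = UNIV"

definition test_function :: "real \<Rightarrow> (real \<Rightarrow> real) \<Rightarrow> (real \<Rightarrow> real) \<Rightarrow> bool" where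
  "test_function T \<phi> \<phi>' \<longleftrightarrow>
     (\<forall>t. (\<phi> has_real_derivative \<phi>' t) (at t)) \<and> continuous_on UNIV \<phi>' \<and>
     (\<exists>a b. 0 < a \<and> b < T \<and> (\<forall>t. t \<notin> {a..b} \<longrightarrow> \<phi> t = 0))"

text \<open>\<open>w\<close> is the weak time derivative of \<open>x\<close>: the identity \<open>\<integral> x \<phi>' dt = - \<integral> w \<phi> dt\<close> in \<open>U\<^sup>*\<close>, applied
  to an arbitrary \<open>v \<in> U\<close>.\<close>

definition weak_time_derivative ::
  "real \<Rightarrow> ('u::real_inner \<Rightarrow>\<^sub>L 'h::real_inner) \<Rightarrow> (real \<Rightarrow> 'u) \<Rightarrow> (real \<Rightarrow> ('u \<Rightarrow>\<^sub>L real)) \<Rightarrow> bool"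
where
  "weak_time_derivative T \<iota> x w \<longleftrightarrow>
     (\<forall>\<phi> \<phi>' v. test_function T \<phi> \<phi>' \<longrightarrow>
        (\<integral>t. inner (\<iota> (x t)) (\<iota> v) * \<phi>' t \<partial>time_measure T) =
        - (\<integral>t. blinfun_apply (w t) v * \<phi> t \<partial>time_measure T))"

text \<open>The space of all \<open>u \<in> L\<^sup>2(0,T;U)\<close> with weak derivative in \<open>L\<^sup>2(0,T;U\<^sup>*)\<close>, represented by a type
  \<open>'v\<close> with its inclusion \<open>emb\<close> into \<open>L\<^sup>2(0,T;U)\<close> and the derivative map \<open>dt\<close>. The norm is the graph
  norm, squared so as to come from an inner product.\<close>

definition is_solution_space ::
  "real \<Rightarrow> ('u::real_inner \<Rightarrow>\<^sub>L 'h::real_inner) \<Rightarrow>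
   ('l::real_inner \<Rightarrow> real \<Rightarrow> 'u) \<Rightarrow> ('m::real_inner \<Rightarrow> real \<Rightarrow> ('u \<Rightarrow>\<^sub>L real)) \<Rightarrow>
   ('v::real_inner \<Rightarrow>\<^sub>L 'l) \<Rightarrow> ('v \<Rightarrow>\<^sub>L 'm) \<Rightarrow> bool"
where
  "is_solution_space T \<iota> repU repU' emb dt \<longleftrightarrow>
     (\<forall>v. weak_time_derivative T \<iota> (repU (emb v)) (repU' (dt v))) \<and>
     (\<forall>x w. weak_time_derivative T \<iota> (repU x) (repU' w) \<longrightarrow> (\<exists>v. emb v = x \<and> dt v = w)) \<and>
     (\<forall>v. (norm v)\<^sup>2 = (norm (emb v))\<^sup>2 + (norm (dt v))\<^sup>2)"

text \<open>The embedding of the solution space into \<open>C([0,T];H)\<close>: \<open>ev v\<close> is the continuous representative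
  of \<open>v\<close>.\<close>

definition is_continuous_embedding ::
  "real \<Rightarrow> ('u::real_inner \<Rightarrow>\<^sub>L 'h::real_inner) \<Rightarrow> ('l::real_inner \<Rightarrow> real \<Rightarrow> 'u) \<Rightarrow>
   ('v::real_inner \<Rightarrow>\<^sub>L 'l) \<Rightarrow> ('v \<Rightarrow> real \<Rightarrow> 'h) \<Rightarrow> bool"
where
  "is_continuous_embedding T \<iota> repU emb ev \<longleftrightarrow>
     (\<forall>v. continuous_on {0..T} (ev v) \<and>
          (AE t in time_measure T. ev v t = \<iota> (repU (emb v) t))) \<and>
     (\<exists>C. \<forall>v. \<forall>t\<in>{0..T}. norm (ev v t) \<le> C * norm v)"

definition caratheodory ::
  "real \<Rightarrow> (real \<Rightarrow> 'x::topological_space \<Rightarrow> 'u::topological_space \<Rightarrow> 'b::topological_space) \<Rightarrow> bool"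
where
  "caratheodory T f \<longleftrightarrow>
     (\<forall>\<theta> u. strongly_measurable (time_measure T) (\<lambda>t. f t \<theta> u)) \<and>
     (AE t in time_measure T. continuous_on UNIV (\<lambda>(\<theta>, u). f t \<theta> u))"

section \<open>The algorithms\<close>

definition landweber :: "('v::real_inner \<Rightarrow> 'w::real_inner) \<Rightarrow> (nat \<Rightarrow> 'v) \<Rightarrow> nat \<Rightarrow> bool" where
  "landweber \<Phi> u K \<longleftrightarrow>
     (\<forall>k<K. u (Suc k) = u k - adjoint (frechet_derivative \<Phi> (at (u k))) (\<Phi> (u k)))"

text \<open>\<open>Adj \<theta> u v g\<close> means that \<open>g\<close> is the approximate adjoint at \<open>\<theta>\<close>, computed with the state \<open>u\<close>
  and applied to \<open>v\<close>. The array \<open>u j k\<close> holds the \<open>k\<close>-th lower-level iterate in the \<open>j\<close>-th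
  upper-level step; only the entries with \<open>k \<le> \<kappa> j\<close> matter.\<close>

definition bilevel_run ::
  "('x::real_vector \<Rightarrow> 'v::real_inner \<Rightarrow> 'w::real_inner) \<Rightarrow> ('x \<Rightarrow> 'v) \<Rightarrow>
   ('x \<Rightarrow> 'v \<Rightarrow> 'l::real_inner \<Rightarrow> 'x \<Rightarrow> bool) \<Rightarrow> ('l \<Rightarrow> 'y::real_inner) \<Rightarrow> ('v \<Rightarrow> 'l) \<Rightarrow> 'y \<Rightarrow> real \<Rightarrow>
   (nat \<Rightarrow> 'x) \<Rightarrow> (nat \<Rightarrow> nat \<Rightarrow> 'v) \<Rightarrow> (nat \<Rightarrow> nat) \<Rightarrow> bool"
where
  "bilevel_run F S Adj L emb y r \<theta> u \<kappa> \<longleftrightarrow>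
     (\<forall>j. 1 \<le> \<kappa> j \<and>
          u j 0 \<in> cball (S (\<theta> j)) (r / 2) \<and>
          landweber (F (\<theta> j)) (u j) (\<kappa> j) \<and>
          (\<exists>g. Adj (\<theta> j) (u j (\<kappa> j)) (adjoint L (L (emb (u j (\<kappa> j))) - y)) g \<and>
               \<theta> (Suc j) = \<theta> j - g))"

definition sequential_bilevel_run ::
  "('x::real_vector \<Rightarrow> 'v::real_inner \<Rightarrow> 'w::real_inner) \<Rightarrow> ('x \<Rightarrow> 'v) \<Rightarrow>
   ('x \<Rightarrow> 'v \<Rightarrow> 'l::real_inner \<Rightarrow> 'x \<Rightarrow> bool) \<Rightarrow> ('l \<Rightarrow> 'y::real_inner) \<Rightarrow> ('v \<Rightarrow> 'l) \<Rightarrow> 'y \<Rightarrow> real \<Rightarrow>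
   (nat \<Rightarrow> 'x) \<Rightarrow> (nat \<Rightarrow> nat \<Rightarrow> 'v) \<Rightarrow> (nat \<Rightarrow> nat) \<Rightarrow> bool"
where
  "sequential_bilevel_run F S Adj L emb y r \<theta> u \<kappa> \<longleftrightarrow>
     bilevel_run F S Adj L emb y r \<theta> u \<kappa> \<and> (\<forall>j. u (Suc j) 0 = u j (\<kappa> j))"

definition state_error ::
  "('x \<Rightarrow> 'v) \<Rightarrow> ('v \<Rightarrow> 'l::real_normed_vector) \<Rightarrow>
   (nat \<Rightarrow> 'x) \<Rightarrow> (nat \<Rightarrow> nat \<Rightarrow> 'v) \<Rightarrow> (nat \<Rightarrow> nat) \<Rightarrow> nat \<Rightarrow> real"
where
  "state_error S emb \<theta> u \<kappa> j = norm (emb (u j (\<kappa> j)) - emb (S (\<theta> j)))"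

text \<open>The growth rate \<open>1/\<epsilon>\<^sub>j\<^sup>2\<close> is \<open>\<infinity>\<close> when \<open>\<epsilon>\<^sub>j = 0\<close>, whereas \<open>1/0 = 0\<close> in HOL. Landau symbols for
  this rate are taken along the indices with \<open>\<epsilon>\<^sub>j \<noteq> 0\<close>, as the others impose no condition.\<close>

definition sequentially_nonzero :: "(nat \<Rightarrow> real) \<Rightarrow> nat filter" where
  "sequentially_nonzero \<epsilon> = inf sequentially (principal {j. \<epsilon> j \<noteq> 0})"

end

theory Submission
  imports Defs
begin

text \<open>
  In one lower level each Landweber step reduces the squared state error \<open>\<parallel>u - S \<theta>\<parallel>\<^sup>2\<close>, measured in the
  solution space, by at least the fraction \<open>c = \<mu>r / Ccoe\<^sup>2\<close> of its current value. As the error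
  decreases and dominates the error \<open>\<epsilon>\<close> in \<open>L\<^sup>2(0,T;U)\<close>, \<open>K\<close> steps that end with error \<open>\<epsilon>\<close> have removed at
  least \<open>K c \<epsilon>\<^sup>2\<close> from the initial squared error (\<open>landweber_state_error\<close>). Hence \<open>K(j) \<epsilon>\<^sub>j\<^sup>2\<close> is at most a constant times the squared initial error
  of level \<open>j\<close>. For the non-sequential algorithm that error is bounded by \<open>r / 2\<close>, and this is the
  \<open>O(1 / \<epsilon>\<^sub>j\<^sup>2)\<close> bound. For the sequential algorithm the initial error is at most the final error of level
  \<open>j - 1\<close> plus the distance of two consecutive exact states. If the latter tends to \<open>0\<close>, so does the
  former, because every level contracts by a fixed factor
  (\<open>contraction_with_vanishing_perturbation\<close>); the initial errors tend to \<open>0\<close>, and \<open>O\<close> improves to \<open>o\<close>.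

  It remains to see that the parameters stay in the ball, where the assumptions hold, and that their
  increments tend to \<open>0\<close>; the states then follow, the parameter-to-state map being Lipschitz on the
  ball. The upper level is a Landweber iteration for \<open>G\<close> whose residual and adjoint are both perturbed by an amount
  proportional to \<open>\<epsilon>\<^sub>j\<close>. Its squared error changes by at most
  \<open>- (\<sigma> / 2 + s) \<parallel>G \<theta>\<^sub>j - y\<parallel>\<^sup>2 + Cpri \<epsilon>\<^sub>j\<^sup>2\<close> with some \<open>s > 0\<close> (\<open>inexact_adjoint_step\<close>). Rule (a) makes the
  perturbations summable and small enough, rule (b) absorbs them in the residual; in either case the
  iterates stay in the ball and the residuals are square summable (\<open>perturbed_descent\<close>), so that the
  updates tend to \<open>0\<close>.

  The analytic core is the estimate of the adjoint error (\<open>approximate_adjoint_error\<close>). It compares the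
  derivative of the state, which solves the linearised equation (\<open>linearised_state_equation\<close>), with the
  computed solution of the backward adjoint equation. Both are known only through weak time
  derivatives, and pairing them requires the integration by parts formula of the Gelfand triple
  (\<open>integration_by_parts\<close>). Riesz' theorem (\<open>riesz_representation\<close>) supplies the adjoints, the
  duality between \<open>L\<^sup>2(0,T;U)\<close> and \<open>L\<^sup>2(0,T;U\<^sup>*)\<close>, and the weak integrals.
\<close>

section \<open>Bounded functionals and adjoints on Hilbert spaces\<close>

text \<open>The representing vector minimises \<open>J x = \<parallel>x\<parallel>\<^sup>2 - 2 \<phi> x\<close>: by the parallelogram law a minimising sequence
is Cauchy, and stationarity of \<open>J\<close> at the minimiser is the claim.\<close>

lemma riesz_representation:
  fixes \<phi> :: "'a::{real_inner,complete_space} \<Rightarrow> real"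
  assumes "bounded_linear \<phi>"
  obtains x where "\<And>y. inner x y = \<phi> y"
proof -
  interpret \<phi>: bounded_linear \<phi> by fact
  define J where "J \<equiv> \<lambda>x. (norm x)\<^sup>2 - 2 * \<phi> x"
  define m where "m = (INF x. J x)"
  obtain K where K: "\<And>x. norm (\<phi> x) \<le> norm x * K" using \<phi>.bounded by blast
  have J_ge: "- K\<^sup>2 \<le> J x" for x
  proof -
    have "0 \<le> (norm x - K)\<^sup>2" by simp
    also have "\<dots> = (norm x)\<^sup>2 - 2 * (norm x * K) + K\<^sup>2" by (simp add: power2_diff)
    finally show ?thesis using K[of x] by (simp add: J_def abs_le_iff)
  qed
  then have bdd: "bdd_below (range J)" by (meson bdd_belowI2)
  have m_le: "m \<le> J x" for x unfolding m_def by (rule cINF_lower[OF bdd]) simp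
  have "\<exists>x. J x < m + 1 / real (Suc n)" for n
  proof -
    have "m < m + 1 / real (Suc n)" by simp
    then show ?thesis unfolding m_def using cInf_lessD[of "range J"] by fastforce
  qed
  then obtain X where X: "\<And>n. J (X n) < m + 1 / real (Suc n)" by metis
  \<comment> \<open>Parallelogram law for the quadratic functional.\<close>
  have par: "(norm (x - y))\<^sup>2 = 2 * (J x + J y - 2 * J ((1/2) *\<^sub>R (x + y)))" for x y
    by (simp add: J_def \<phi>.scaleR \<phi>.add power2_norm_eq_inner inner_simps inner_commute algebra_simps)
  have close: "(norm (x - y))\<^sup>2 \<le> 2 * ((J x - m) + (J y - m))" for x y
    using par[of x y] m_le[of "(1/2) *\<^sub>R (x + y)"] by simp
  have "Cauchy X"
  proof (rule CauchyI)
    fix e :: real assume "0 < e"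
    then obtain n0 where n0: "4 / e\<^sup>2 < real n0" using reals_Archimedean2 by blast
    have "0 < 4 / e\<^sup>2" using \<open>0 < e\<close> by simp
    have "norm (X i - X k) < e" if "n0 \<le> i" "n0 \<le> k" for i k
    proof -
      have *: "1 / real (Suc i) < e\<^sup>2 / 4" if "n0 \<le> i" for i
      proof -
        have "4 / e\<^sup>2 < real (Suc i)" using n0 that by simp
        then show ?thesis using \<open>0 < e\<close> \<open>0 < 4 / e\<^sup>2\<close> by (simp add: field_simps)
      qed
      have "(norm (X i - X k))\<^sup>2 < e\<^sup>2"
        using close[of "X i" "X k"] X[of i] X[of k] *[OF that(1)] *[OF that(2)] by argo
      then show ?thesis using \<open>0 < e\<close> by (simp add: power2_less_imp_less)
    qed
    then show "\<exists>M. \<forall>i\<ge>M. \<forall>k\<ge>M. norm (X i - X k) < e" by blast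
  qed
  then obtain x where x: "X \<longlonglongrightarrow> x" using Cauchy_convergent convergent_def by blast
  have "(\<lambda>n. J (X n)) \<longlonglongrightarrow> J x"
    unfolding J_def by (intro tendsto_intros \<phi>.tendsto x)
  moreover have "(\<lambda>n. m + 1 / real (Suc n)) \<longlonglongrightarrow> m + 0"
    using LIMSEQ_inverse_real_of_nat by (intro tendsto_intros) (simp add: inverse_eq_divide)
  ultimately have "J x \<le> m + 0" using X by (intro LIMSEQ_le) (auto intro: less_imp_le)
  have "inner x y = \<phi> y" for y
  proof (cases "y = 0")
    case False
    define c where "c = inner x y - \<phi> y"
    \<comment> \<open>The value of \<open>t\<close> that minimises \<open>J (x + t y)\<close>.\<close>
    define t where "t = - c / (norm y)\<^sup>2"
    have "J x \<le> J (x + t *\<^sub>R y)" using m_le[of "x + t *\<^sub>R y"] \<open>J x \<le> m + 0\<close> by simp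
    also have "J (x + t *\<^sub>R y) = J x + 2 * t * c + t\<^sup>2 * (norm y)\<^sup>2"
      unfolding J_def c_def power2_norm_eq_inner
      by (simp add: \<phi>.scaleR \<phi>.add inner_simps inner_commute algebra_simps power2_eq_square)
    finally have "0 \<le> 2 * t * c + t\<^sup>2 * (norm y)\<^sup>2" by simp
    also have "\<dots> = - (c\<^sup>2 / (norm y)\<^sup>2)"
      using False by (simp add: t_def field_simps power2_eq_square)
    finally have "c\<^sup>2 / (norm y)\<^sup>2 \<le> 0" by simp
    then have "c = 0" using False by (simp add: divide_le_0_iff)
    then show ?thesis by (simp add: c_def)
  qed simp
  then show thesis by (rule that)
qed

lemma adjoint_inner:
  fixes f :: "'a::{real_inner,complete_space} \<Rightarrow> 'b::real_inner"
  assumes "bounded_linear f"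
  shows "inner (f x) y = inner x (adjoint f y)"
proof -
  have "\<exists>z. \<forall>x. inner (f x) y = inner x z" for y
  proof -
    have "bounded_linear (\<lambda>x. inner (f x) y)"
      using assms by (intro bounded_linear_intros)
    then obtain z where "\<And>x. inner z x = inner (f x) y" by (rule riesz_representation) metis
    then show ?thesis by (metis inner_commute)
  qed
  then obtain g where "\<forall>y x. inner (f x) y = inner x (g y)" by metis
  then have "\<forall>x y. inner (f x) y = inner x (adjoint f y)"
    unfolding adjoint_def
    by (intro someI[where P="\<lambda>f'. \<forall>x y. inner (f x) y = inner x (f' y)" and x=g]) blast
  then show ?thesis by blast
qed

lemma norm_le_if_inner_le:
  fixes x :: "'a::real_inner"
  assumes "\<And>y. inner x y \<le> c * norm y" "0 \<le> c"
  shows "norm x \<le> c"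
  using assms(1)[of x] assms(2) by (cases "x = 0") (auto simp: power2_norm_eq_inner[symmetric] power2_eq_square)

lemma norm_adjoint_le:
  fixes f :: "'a::{real_inner,complete_space} \<Rightarrow> 'b::real_inner"
  assumes f: "bounded_linear f" and c: "onorm f \<le> c"
  shows "norm (adjoint f y) \<le> c * norm y"
proof (rule norm_le_if_inner_le)
  have "0 \<le> c" using onorm_pos_le[OF f] c by linarith
  then show "0 \<le> c * norm y" by simp
  fix x
  have "inner (adjoint f y) x = inner (f x) y" by (metis adjoint_inner[OF f] inner_commute)
  also have "\<dots> \<le> norm (f x) * norm y" by (rule norm_cauchy_schwarz)
  also have "\<dots> \<le> (c * norm x) * norm y"
    using onorm[OF f, of x] c by (meson mult_right_mono norm_ge_zero order_trans)
  finally show "inner (adjoint f y) x \<le> c * norm y * norm x" by (simp add: mult_ac)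
qed

lemma adjoint_bounded_linear:
  fixes f :: "'a::{real_inner,complete_space} \<Rightarrow> 'b::real_inner"
  assumes f: "bounded_linear f"
  shows "bounded_linear (adjoint f)"
proof (rule bounded_linear_intro[where K="onorm f"])
  show "adjoint f (x + y) = adjoint f x + adjoint f y" for x y
    by (rule vector_eq_ldot[THEN iffD1]) (simp add: adjoint_inner[OF f, symmetric] inner_simps)
  show "adjoint f (c *\<^sub>R x) = c *\<^sub>R adjoint f x" for c x
    by (rule vector_eq_ldot[THEN iffD1]) (simp add: adjoint_inner[OF f, symmetric] inner_simps)
  show "norm (adjoint f x) \<le> norm x * onorm f" for x
    using norm_adjoint_le[OF f order_refl] by (simp add: mult.commute)
qed

lemma D_iso_apply [simp]: "blinfun_apply (D_iso x) y = inner x y"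
  by (simp add: D_iso_def)

lemma D_iso_bounded_linear: "bounded_linear D_iso"
  unfolding D_iso_def by (rule bounded_linear_blinfun_inner_right)

lemma norm_D_iso [simp]: "norm (D_iso x) = norm x"
proof (rule antisym)
  show "norm (D_iso x) \<le> norm x"
    by (rule norm_blinfun_bound) (simp_all add: Cauchy_Schwarz_ineq2)
  have "norm x * norm x \<le> norm (D_iso x) * norm x"
    using norm_blinfun[of "D_iso x" x] by (simp add: power2_norm_eq_inner[symmetric] power2_eq_square)
  then show "norm x \<le> norm (D_iso x)" by (cases "x = 0") auto
qed

lemma bij_D_iso: "bij (D_iso :: 'a::{real_inner,complete_space} \<Rightarrow> _)"
proof (rule bijI)
  interpret D: bounded_linear D_iso by (rule D_iso_bounded_linear)
  show "inj (D_iso :: 'a \<Rightarrow> _)"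
    by (rule injI) (metis D.diff norm_D_iso norm_eq_zero right_minus_eq)
  have "\<exists>x. \<phi> = D_iso x" for \<phi> :: "'a \<Rightarrow>\<^sub>L real"
    using riesz_representation[OF blinfun.bounded_linear_right[of \<phi>]] 
    by (metis D_iso_apply blinfun_eqI)
  then show "surj (D_iso :: 'a \<Rightarrow> _)" by (simp add: surj_def)
qed

lemma I_iso_eq_inv: "I_iso = inv D_iso"
  by (simp add: I_iso_def D_iso_def)

lemma D_iso_I_iso [simp]: "D_iso (I_iso \<phi>) = \<phi>" for \<phi> :: "'a::{real_inner,complete_space} \<Rightarrow>\<^sub>L real"
  by (simp add: I_iso_eq_inv bij_is_surj[OF bij_D_iso] surj_f_inv_f)

lemma I_iso_D_iso [simp]: "I_iso (D_iso x) = x" for x :: "'a::{real_inner,complete_space}"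
  by (simp add: I_iso_eq_inv bij_is_inj[OF bij_D_iso])

lemma inner_I_iso [simp]: "inner (I_iso \<phi>) x = blinfun_apply \<phi> x"
  for \<phi> :: "'a::{real_inner,complete_space} \<Rightarrow>\<^sub>L real"
  by (metis D_iso_apply D_iso_I_iso)

lemma norm_I_iso [simp]: "norm (I_iso \<phi>) = norm \<phi>"
  for \<phi> :: "'a::{real_inner,complete_space} \<Rightarrow>\<^sub>L real"
  by (metis norm_D_iso D_iso_I_iso)

lemma I_iso_bounded_linear:
  "bounded_linear (I_iso :: ('a::{real_inner,complete_space} \<Rightarrow>\<^sub>L real) \<Rightarrow> 'a)"
proof (rule bounded_linear_intro[where K=1])
  interpret D: bounded_linear D_iso by (rule D_iso_bounded_linear)
  show "I_iso (\<phi> + \<psi>) = I_iso \<phi> + (I_iso \<psi> :: 'a)" for \<phi> \<psi>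
    by (metis D_iso_I_iso I_iso_D_iso D.add)
  show "I_iso (r *\<^sub>R \<phi>) = r *\<^sub>R (I_iso \<phi> :: 'a)" for r \<phi>
    by (metis D_iso_I_iso I_iso_D_iso D.scaleR)
qed simp

section \<open>Strongly measurable and square integrable functions\<close>

lemma complete_measure_lebesgue_on:
  assumes "S \<in> sets lebesgue"
  shows "complete_measure (lebesgue_on S)"
proof
  fix A B assume "B \<subseteq> A" "A \<in> null_sets (lebesgue_on S)"
  then have "B \<in> null_sets (lebesgue_on S)"
    using assms completion.complete2 by (simp add: null_sets_restrict_space) blast
  then show "B \<in> sets (lebesgue_on S)" by blast
qed

text \<open>Representatives of classes are only known almost everywhere; completeness of Lebesgue measure lets
measurability and integrals pass from one representative to another without further conditions.\<close>

lemma (in complete_measure) borel_measurable_cong_AE: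
  fixes f g :: "'a \<Rightarrow> 'b::topological_space"
  assumes f: "f \<in> borel_measurable M" and eq: "AE t in M. f t = g t"
  shows "g \<in> borel_measurable M"
proof (rule measurableI)
  fix A :: "'b set" assume A: "A \<in> sets borel"
  show "g -` A \<inter> space M \<in> sets M"
  proof (rule in_sets_AE)
    show "AE t in M. t \<in> f -` A \<inter> space M \<longleftrightarrow> t \<in> g -` A \<inter> space M"
      using eq by eventually_elim auto
    show "f -` A \<inter> space M \<in> sets M" using f A by (rule measurable_sets)
  qed auto
qed simp

lemma (in complete_measure) strongly_measurable_imp_borel:
  fixes g :: "'a \<Rightarrow> real"
  assumes "strongly_measurable M g"
  shows "g \<in> borel_measurable M"
proof -
  obtain s where s: "\<And>n. simple_function M (s n)" and lim: "AE t in M. (\<lambda>n. s n t) \<longlonglongrightarrow> g t"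
    using assms unfolding strongly_measurable_def by blast
  define E where "E = {t \<in> space M. \<not> (\<lambda>n. s n t) \<longlonglongrightarrow> g t}"
  have E: "E \<in> null_sets M" using lim unfolding E_def AE_iff_null_sets .
  have "(\<lambda>t. indicator (space M - E) t * g t) \<in> borel_measurable M"
  proof (rule borel_measurable_LIMSEQ_real)
    show "(\<lambda>t. indicator (space M - E) t * s n t) \<in> borel_measurable M" for n
      using null_setsD2[OF E] borel_measurable_simple_function[OF s[of n]]
      by (intro borel_measurable_times borel_measurable_indicator sets.Diff sets.top)
    show "(\<lambda>n. indicator (space M - E) t * s n t) \<longlonglongrightarrow> indicator (space M - E) t * g t"
      if "t \<in> space M" for t
      using that by (auto simp: E_def indicator_def intro!: tendsto_intros)
  qed
  moreover have "AE t in M. indicator (space M - E) t * g t = g t"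
    using AE_not_in[OF E] AE_space by eventually_elim (auto simp: indicator_def)
  ultimately show ?thesis by (rule borel_measurable_cong_AE)
qed

lemma strongly_measurable_compose2:
  fixes f :: "'a \<Rightarrow> 'b::t2_space" and g :: "'a \<Rightarrow> 'c::t2_space"
  assumes "strongly_measurable M f" "strongly_measurable M g"
    and h: "continuous_on UNIV (\<lambda>(x, y). h x y)"
  shows "strongly_measurable M (\<lambda>t. h (f t) (g t))"
proof -
  obtain p where p: "\<And>n. simple_function M (p n)" "AE t in M. (\<lambda>n. p n t) \<longlonglongrightarrow> f t"
    using assms(1) unfolding strongly_measurable_def by blast
  obtain q where q: "\<And>n. simple_function M (q n)" "AE t in M. (\<lambda>n. q n t) \<longlonglongrightarrow> g t"
    using assms(2) unfolding strongly_measurable_def by blast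
  have "AE t in M. (\<lambda>n. h (p n t) (q n t)) \<longlonglongrightarrow> h (f t) (g t)"
    using p(2) q(2)
  proof eventually_elim
    case (elim t)
    then have "(\<lambda>n. (p n t, q n t)) \<longlonglongrightarrow> (f t, g t)" by (intro tendsto_Pair)
    from continuous_on_tendsto_compose[OF h this] show ?case by simp
  qed
  moreover have "simple_function M (\<lambda>t. h (p n t) (q n t))" for n
    by (rule simple_function_compose2[OF p(1) q(1)])
  ultimately show ?thesis
    unfolding strongly_measurable_def by (intro exI[of _ "\<lambda>n t. h (p n t) (q n t)"]) simp
qed

lemma strongly_measurable_compose:
  fixes f :: "'a \<Rightarrow> 'b::t2_space"
  assumes "strongly_measurable M f" and h: "continuous_on UNIV h"
  shows "strongly_measurable M (\<lambda>t. h (f t))"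
proof -
  have "continuous_on UNIV (\<lambda>p. h (fst p))"
    by (rule continuous_on_compose2[OF h continuous_on_fst[OF continuous_on_id]]) simp
  then have "continuous_on UNIV (\<lambda>(x, y :: 'b). h x)"
    by (simp add: case_prod_unfold)
  from strongly_measurable_compose2[OF assms(1,1) this] show ?thesis .
qed

lemma strongly_measurable_cong_AE:
  assumes "strongly_measurable M f" "AE t in M. f t = g t"
  shows "strongly_measurable M g"
proof -
  obtain s where s: "\<And>n. simple_function M (s n)" and lim: "AE t in M. (\<lambda>n. s n t) \<longlonglongrightarrow> f t"
    using assms(1) unfolding strongly_measurable_def by blast
  from lim assms(2) have "AE t in M. (\<lambda>n. s n t) \<longlonglongrightarrow> g t" by eventually_elim simp
  with s show ?thesis unfolding strongly_measurable_def by (intro exI[of _ s]) simp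
qed

lemma complete_time_measure: "complete_measure (time_measure T)"
  by (rule complete_measure_lebesgue_on) (intro sets_completionI_sets, simp)

lemmas borel_measurable_time_cong_AE =
  complete_measure.borel_measurable_cong_AE[OF complete_time_measure]

lemmas strongly_measurable_time_imp_borel =
  complete_measure.strongly_measurable_imp_borel[OF complete_time_measure]

lemma integrable_time_cong_AE:
  fixes f g :: "real \<Rightarrow> real"
  assumes "integrable (time_measure T) f" "AE t in time_measure T. f t = g t"
  shows "integrable (time_measure T) g"
  using assms borel_measurable_time_cong_AE[OF borel_measurable_integrable[OF assms(1)] assms(2)]
    integrable_cong_AE by blast

text \<open>If neither side is measurable, both integrals are \<open>0\<close>; completeness excludes the mixed case.\<close>

lemma integral_time_cong_AE:
  fixes f g :: "real \<Rightarrow> real"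
  assumes "AE t in time_measure T. f t = g t"
  shows "(\<integral>t. f t \<partial>time_measure T) = (\<integral>t. g t \<partial>time_measure T)"
proof (cases "f \<in> borel_measurable (time_measure T)")
  case True
  then show ?thesis using assms borel_measurable_time_cong_AE integral_cong_AE by blast
next
  case False
  have "AE t in time_measure T. g t = f t" using assms by eventually_elim simp
  then have "g \<notin> borel_measurable (time_measure T)"
    using False borel_measurable_time_cong_AE by blast
  with False show ?thesis
    using not_integrable_integral_eq[of "time_measure T" f] not_integrable_integral_eq[of "time_measure T" g]
      borel_measurable_integrable[of "time_measure T" f] borel_measurable_integrable[of "time_measure T" g]
    by metis
qed

lemma square_integrable_bounded_linear:
  assumes f: "square_integrable T f" and k: "bounded_linear k"
  shows "square_integrable T (\<lambda>t. k (f t))"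
proof -
  obtain C where C: "\<And>x. norm (k x) \<le> norm x * C" and "0 \<le> C"
    using bounded_linear.nonneg_bounded[OF k] by blast
  have meas: "strongly_measurable (time_measure T) (\<lambda>t. k (f t))"
    using f linear_continuous_on[OF k] unfolding square_integrable_def
    by (blast intro: strongly_measurable_compose)
  have "integrable (time_measure T) (\<lambda>t. (norm (k (f t)))\<^sup>2)"
  proof (rule Bochner_Integration.integrable_bound)
    show "integrable (time_measure T) (\<lambda>t. C\<^sup>2 * (norm (f t))\<^sup>2)"
      using f unfolding square_integrable_def by simp
    show "(\<lambda>t. (norm (k (f t)))\<^sup>2) \<in> borel_measurable (time_measure T)"
      by (intro strongly_measurable_time_imp_borel
          strongly_measurable_compose[OF meas, of "\<lambda>x. (norm x)\<^sup>2"] continuous_intros)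
    show "AE t in time_measure T. norm ((norm (k (f t)))\<^sup>2) \<le> norm (C\<^sup>2 * (norm (f t))\<^sup>2)"
      using power_mono[OF C, of _ 2] by (simp add: power_mult_distrib mult.commute)
  qed
  with meas show ?thesis unfolding square_integrable_def by blast
qed

lemma square_integrable_cong_AE:
  assumes f: "square_integrable T f" and eq: "AE t in time_measure T. f t = g t"
  shows "square_integrable T g"
  unfolding square_integrable_def
proof
  show "strongly_measurable (time_measure T) g"
    using f strongly_measurable_cong_AE[OF _ eq] by (simp add: square_integrable_def)
  have "AE t in time_measure T. (norm (f t))\<^sup>2 = (norm (g t))\<^sup>2"
    using eq by eventually_elim simp
  then show "integrable (time_measure T) (\<lambda>t. (norm (g t))\<^sup>2)"
    using f integrable_time_cong_AE[of T "\<lambda>t. (norm (f t))\<^sup>2" "\<lambda>t. (norm (g t))\<^sup>2"]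
    by (simp add: square_integrable_def)
qed

lemma square_integrable_bilinear:
  fixes h :: "'a::real_normed_vector \<Rightarrow> 'b::real_normed_vector \<Rightarrow> real"
  assumes f: "square_integrable T f" and g: "square_integrable T g" and h: "bounded_bilinear h"
  shows "integrable (time_measure T) (\<lambda>t. h (f t) (g t))"
proof -
  obtain K where K: "\<And>a b. norm (h a b) \<le> norm a * norm b * K" and "0 \<le> K"
    using bounded_bilinear.nonneg_bounded[OF h] by blast
  show ?thesis
  proof (rule Bochner_Integration.integrable_bound)
  show "integrable (time_measure T) (\<lambda>t. K * ((norm (f t))\<^sup>2 + (norm (g t))\<^sup>2))"
    using f g unfolding square_integrable_def by simp
  have "continuous_on UNIV (\<lambda>(x, y). h x y)"
    unfolding case_prod_unfold
    by (intro bounded_bilinear.continuous_on[OF h] continuous_intros)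
  then show "(\<lambda>t. h (f t) (g t)) \<in> borel_measurable (time_measure T)"
    using f g strongly_measurable_time_imp_borel strongly_measurable_compose2
    unfolding square_integrable_def by blast
  have "norm (h a b) \<le> norm (K * ((norm a)\<^sup>2 + (norm b)\<^sup>2))" for a b
  proof -
    have "norm a * norm b \<le> (norm a)\<^sup>2 + (norm b)\<^sup>2"
      using sum_squares_bound[of "norm a" "norm b"] mult_nonneg_nonneg[OF norm_ge_zero norm_ge_zero, of a b]
      by linarith
    then have "norm a * norm b * K \<le> ((norm a)\<^sup>2 + (norm b)\<^sup>2) * K"
      using \<open>0 \<le> K\<close> by (rule mult_right_mono)
    with K[of a b] show ?thesis using \<open>0 \<le> K\<close> by (simp add: mult.commute)
  qed
  then show "AE t in time_measure T. norm (h (f t) (g t)) \<le> norm (K * ((norm (f t))\<^sup>2 + (norm (g t))\<^sup>2))"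
    by simp
  qed
qed

lemma square_integrable_const: "square_integrable T (\<lambda>t. c)"
proof -
  have "simple_function (time_measure T) (\<lambda>t. c)" by simp
  then have "strongly_measurable (time_measure T) (\<lambda>t. c)"
    unfolding strongly_measurable_def by (intro exI[of _ "\<lambda>_ _. c"]) simp
  moreover have "finite_measure (time_measure T)"
    by (rule finite_measure_lebesgue_on) simp
  ultimately show ?thesis
    unfolding square_integrable_def by (simp add: finite_measure.integrable_const)
qed

lemma square_integrable_norm_integrable:
  assumes "square_integrable T f"
  shows "integrable (time_measure T) (\<lambda>t. norm (f t))"
proof -
  have n: "square_integrable T (\<lambda>t. norm (f t))"
    using assms strongly_measurable_compose[of _ f norm, OF _ continuous_on_norm_id]
    unfolding square_integrable_def by simp
  from square_integrable_bilinear[OF n square_integrable_const[of T 1] bounded_bilinear_mult]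
  show ?thesis by simp
qed

lemma is_L2_square_integrable: "is_L2 T rep \<Longrightarrow> square_integrable T (rep x)"
  unfolding is_L2_def by blast

lemma is_L2_add: "is_L2 T rep \<Longrightarrow> AE t in time_measure T. rep (x + y) t = rep x t + rep y t"
  unfolding is_L2_def by blast

lemma is_L2_scaleR: "is_L2 T rep \<Longrightarrow> AE t in time_measure T. rep (c *\<^sub>R x) t = c *\<^sub>R rep x t"
  unfolding is_L2_def by blast

lemma is_L2_norm:
  "is_L2 T rep \<Longrightarrow> (norm x)\<^sup>2 = (\<integral>t. (norm (rep x t))\<^sup>2 \<partial>time_measure T)"
  unfolding is_L2_def by blast

lemma is_L2_diff:
  assumes "is_L2 T rep"
  shows "AE t in time_measure T. rep (x - y) t = rep x t - rep y t"
  using is_L2_add[OF assms, of x "-1 *\<^sub>R y"] is_L2_scaleR[OF assms, of "-1" y]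
  by eventually_elim simp

lemma is_L2_eqI:
  assumes L2: "is_L2 T rep" and eq: "AE t in time_measure T. rep x t = rep y t"
  shows "x = y"
proof -
  have "AE t in time_measure T. (norm (rep (x - y) t))\<^sup>2 = 0"
    using eq is_L2_diff[OF L2, of x y] by eventually_elim simp
  then have "(norm (x - y))\<^sup>2 = 0"
    using is_L2_norm[OF L2, of "x - y"] integral_time_cong_AE[where g="\<lambda>_. 0"] by simp
  then show ?thesis by simp
qed

lemma L2_class_AE:
  assumes L2: "is_L2 T rep" and g: "square_integrable T g"
  shows "AE t in time_measure T. rep (L2_class T rep g) t = g t"
proof -
  obtain x where x: "AE t in time_measure T. rep x t = g t"
    using L2 g unfolding is_L2_def by blast
  show ?thesis unfolding L2_class_def
  proof (rule theI[of _ x])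
    fix z assume "AE t in time_measure T. rep z t = g t"
    with x have "AE t in time_measure T. rep z t = rep x t" by eventually_elim simp
    then show "z = x" by (rule is_L2_eqI[OF L2])
  qed (rule x)
qed

text \<open>Polarization of the norm identity in the definition of the space.\<close>

lemma is_L2_inner:
  fixes rep :: "'l::real_inner \<Rightarrow> real \<Rightarrow> 'b::real_inner"
  assumes L2: "is_L2 T rep"
  shows "inner x y = (\<integral>t. inner (rep x t) (rep y t) \<partial>time_measure T)"
proof -
  have int: "integrable (time_measure T) (\<lambda>t. inner (rep x t) (rep y t))" for x y
    by (intro square_integrable_bilinear is_L2_square_integrable[OF L2] bounded_bilinear_inner)
  have sq: "inner x x = (\<integral>t. inner (rep x t) (rep x t) \<partial>time_measure T)" for x
    using is_L2_norm[OF L2, of x] by (simp add: power2_norm_eq_inner)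
  have "inner (x + y) (x + y) =
      (\<integral>t. inner (rep x t) (rep x t) + 2 * inner (rep x t) (rep y t) + inner (rep y t) (rep y t)
        \<partial>time_measure T)"
    unfolding sq
  proof (rule integral_time_cong_AE)
    show "AE t in time_measure T. inner (rep (x + y) t) (rep (x + y) t) =
        inner (rep x t) (rep x t) + 2 * inner (rep x t) (rep y t) + inner (rep y t) (rep y t)"
      using is_L2_add[OF L2, of x y] by eventually_elim (simp add: inner_simps inner_commute)
  qed
  also have "\<dots> = inner x x + 2 * (\<integral>t. inner (rep x t) (rep y t) \<partial>time_measure T) + inner y y"
    by (simp add: int sq)
  finally show ?thesis by (simp add: inner_simps inner_commute)
qed

section \<open>Increments of a function with an integrable weak derivative\<close>

text \<open>Test functions that approximate the indicator of an interval \<open>(s, t]\<close> are built from one profile: the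
second difference of the \<open>C\<^sup>1\<close> function \<open>(max 0 x)\<^sup>2 / 2\<close>, which rises from \<open>0\<close> to \<open>1\<close> on \<open>[0, 2]\<close>
and has the tent on \<open>[0, 2]\<close> as its derivative.\<close>

definition hat :: "real \<Rightarrow> real" where
  "hat x = max 0 x - 2 * max 0 (x - 1) + max 0 (x - 2)"

definition hat_primitive :: "real \<Rightarrow> real" where
  "hat_primitive x = ((max 0 x)\<^sup>2 - 2 * (max 0 (x - 1))\<^sup>2 + (max 0 (x - 2))\<^sup>2) / 2"

lemma hat_nonneg: "0 \<le> hat x"
  by (auto simp: hat_def max_def)

lemma hat_outside: "x \<le> 0 \<or> 2 \<le> x \<Longrightarrow> hat x = 0"
  by (auto simp: hat_def max_def)

lemma hat_continuous: "continuous_on A f \<Longrightarrow> continuous_on A (\<lambda>x. hat (f x))"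
  unfolding hat_def by (intro continuous_intros)

lemma hat_primitive_left: "x \<le> 0 \<Longrightarrow> hat_primitive x = 0"
  by (auto simp: hat_primitive_def max_def)

lemma hat_primitive_right: "2 \<le> x \<Longrightarrow> hat_primitive x = 1"
  by (auto simp: hat_primitive_def max_def power2_eq_square algebra_simps)

lemma has_real_derivative_square_pos_part:
  "((\<lambda>x. (max 0 x)\<^sup>2) has_real_derivative 2 * max 0 x) (at (x::real))"
proof -
  consider "x < 0" | "x = 0" | "0 < x" by linarith
  then show ?thesis
  proof cases
    case 1
    have "((\<lambda>x. 0 :: real) has_real_derivative 2 * max 0 x) (at x)" using 1 by simp
    then show ?thesis
      by (rule has_field_derivative_transform_within_open[of _ _ _ "{..<0}"]) (use 1 in auto)
  next
    case 3
    have "((\<lambda>x. x\<^sup>2) has_real_derivative 2 * max 0 x) (at x)"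
      using 3 by (auto intro!: derivative_eq_intros)
    then show ?thesis
      by (rule has_field_derivative_transform_within_open[of _ _ _ "{0<..}"]) (use 3 in auto)
  next
    case 2
    have "(\<lambda>h. (max 0 h)\<^sup>2 / h) \<midarrow>0\<rightarrow> (0::real)"
    proof (rule Lim_null_comparison)
      show "\<forall>\<^sub>F h in at 0. norm ((max 0 h)\<^sup>2 / h) \<le> \<bar>h :: real\<bar>"
        by (intro always_eventually allI) (auto simp: max_def power2_eq_square)
      show "((\<lambda>h. \<bar>h :: real\<bar>) \<longlongrightarrow> 0) (at 0)"
        using tendsto_rabs[OF tendsto_ident_at[of "0::real" UNIV]] by simp
    qed
    then show ?thesis using 2 by (simp add: DERIV_def)
  qed
qed

lemma hat_primitive_derivative: "(hat_primitive has_real_derivative hat x) (at x)"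
proof -
  have shift: "((\<lambda>x. (max 0 (x - c))\<^sup>2) has_real_derivative 2 * max 0 (x - c)) (at (x::real))" for c
    using DERIV_chain2[where f="\<lambda>x. (max 0 x)\<^sup>2" and g="\<lambda>x. x - c" and Db=1 and x=x and s=UNIV,
        OF has_real_derivative_square_pos_part[of "x - c"]]
    by (simp add: DERIV_diff[where g="\<lambda>_. c" and E=0, simplified] DERIV_ident)
  show ?thesis
    unfolding hat_primitive_def[abs_def] hat_def
    by (rule DERIV_cong[OF DERIV_cdivide[OF DERIV_add[OF DERIV_diff[OF
              has_real_derivative_square_pos_part DERIV_cmult[OF shift]] shift]]]) simp
qed

lemma hat_primitive_mono: "x \<le> y \<Longrightarrow> hat_primitive x \<le> hat_primitive y"
  using DERIV_nonneg_imp_nondecreasing[of x y hat_primitive] hat_primitive_derivative hat_nonneg by blast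

lemma hat_primitive_bounds: "0 \<le> hat_primitive x" "hat_primitive x \<le> 1"
proof -
  show "0 \<le> hat_primitive x"
    using hat_primitive_mono[of "min x 0" x] hat_primitive_left[of "min x 0"] by simp
  show "hat_primitive x \<le> 1"
    using hat_primitive_mono[of x "max x 2"] hat_primitive_right[of "max x 2"] by simp
qed

text \<open>A probability density on \<open>[s, s + 2\<delta>]\<close>; as \<open>\<delta> \<rightarrow> 0\<close> it concentrates at \<open>s\<close>.\<close>

definition bump :: "real \<Rightarrow> real \<Rightarrow> real \<Rightarrow> real" where
  "bump \<delta> s \<tau> = hat ((\<tau> - s) / \<delta>) / \<delta>"

lemma bump_nonneg: "0 < \<delta> \<Longrightarrow> 0 \<le> bump \<delta> s \<tau>"
  by (simp add: bump_def hat_nonneg)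

lemma bump_outside: "0 < \<delta> \<Longrightarrow> \<tau> \<notin> {s<..<s + 2 * \<delta>} \<Longrightarrow> bump \<delta> s \<tau> = 0"
  using hat_outside[of "(\<tau> - s) / \<delta>"] by (auto simp: bump_def divide_simps not_less)

lemma bump_continuous: "0 < \<delta> \<Longrightarrow> continuous_on A (bump \<delta> s)"
  unfolding bump_def[abs_def] by (intro continuous_intros hat_continuous) auto

lemma bump_primitive:
  assumes "0 < \<delta>"
  shows "((\<lambda>\<tau>. hat_primitive ((\<tau> - s) / \<delta>)) has_real_derivative bump \<delta> s \<tau>) (at \<tau>)"
  unfolding bump_def
  using DERIV_chain2[where f=hat_primitive and g="\<lambda>\<tau>. (\<tau> - s) / \<delta>" and Db="1 / \<delta>" and x=\<tau>
      and s=UNIV, OF hat_primitive_derivative]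
    DERIV_cdivide[OF DERIV_diff[OF DERIV_ident DERIV_const[of s]]]
  by simp

lemma bump_integral:
  assumes "0 < \<delta>" "0 \<le> s" "s + 2 * \<delta> \<le> T"
  shows "integrable (time_measure T) (bump \<delta> s)" "(\<integral>\<tau>. bump \<delta> s \<tau> \<partial>time_measure T) = 1"
proof -
  have eq: "indicator {0<..<T} \<tau> *\<^sub>R bump \<delta> s \<tau> = bump \<delta> s \<tau> * indicator {0..T} \<tau>" for \<tau>
    using bump_outside[OF assms(1), of \<tau> s] assms(2,3)
    by (cases "\<tau> \<in> {s<..<s + 2 * \<delta>}") (auto simp: indicator_def)
  let ?p = "\<lambda>\<tau>. bump \<delta> s \<tau> * indicator {0..T} \<tau> :: real"
  have "has_bochner_integral lborel (\<lambda>\<tau>. bump \<delta> s \<tau> * indicator {0..T} \<tau>)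
      (hat_primitive ((T - s) / \<delta>) - hat_primitive ((0 - s) / \<delta>))"
    using assms continuous_on_eq_continuous_at[of UNIV "bump \<delta> s"] bump_continuous[of \<delta> UNIV s]
    by (intro has_bochner_integral_FTC_Icc_real bump_primitive) auto
  also have "hat_primitive ((T - s) / \<delta>) = 1"
    using assms by (intro hat_primitive_right) (auto simp: field_simps)
  also have "hat_primitive ((0 - s) / \<delta>) = 0"
    using assms by (intro hat_primitive_left) (auto simp: field_simps)
  finally have int: "integrable lborel ?p" "integral\<^sup>L lborel ?p = 1"
    by (simp_all add: has_bochner_integral_iff)
  have *: "has_bochner_integral lebesgue (\<lambda>\<tau>. indicator {0<..<T} \<tau> *\<^sub>R bump \<delta> s \<tau>) 1"
    unfolding eq has_bochner_integral_iff
    using int integrable_completion[OF borel_measurable_integrable[OF int(1)]]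
      integral_completion[OF borel_measurable_integrable[OF int(1)]]
    by simp
  have T: "{0<..<T} \<inter> space lebesgue \<in> sets lebesgue" by simp
  show "integrable (time_measure T) (bump \<delta> s)" "(\<integral>\<tau>. bump \<delta> s \<tau> \<partial>time_measure T) = 1"
    using * unfolding integrable_restrict_space[OF T] integral_restrict_space[OF T]
    by (auto simp: has_bochner_integral_iff)
qed

lemma continuous_on_time_measurable:
  fixes g :: "real \<Rightarrow> real"
  assumes "continuous_on {0..T} g"
  shows "g \<in> borel_measurable (time_measure T)"
proof (rule continuous_imp_measurable_on_sets_lebesgue)
  show "continuous_on {0<..<T} g" by (rule continuous_on_subset[OF assms]) auto
  show "{0<..<T} \<in> sets lebesgue" by (intro sets_completionI_sets) simp
qed

lemma integrable_mult_bump: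
  fixes g :: "real \<Rightarrow> real"
  assumes g: "continuous_on {0..T} g" and \<delta>: "0 < \<delta>" "0 \<le> s" "s + 2 * \<delta> \<le> T"
  shows "integrable (time_measure T) (\<lambda>\<tau>. g \<tau> * bump \<delta> s \<tau>)"
proof -
  have "compact (g ` {0..T})" using compact_continuous_image[OF g] by simp
  then obtain B where B: "\<And>\<tau>. \<tau> \<in> {0..T} \<Longrightarrow> \<bar>g \<tau>\<bar> \<le> B"
    using bounded_pos[of "g ` {0..T}"] compact_imp_bounded by force
  show ?thesis
  proof (rule Bochner_Integration.integrable_bound)
    show "integrable (time_measure T) (\<lambda>\<tau>. B * bump \<delta> s \<tau>)"
      using bump_integral(1)[OF \<delta>] by simp
    show "(\<lambda>\<tau>. g \<tau> * bump \<delta> s \<tau>) \<in> borel_measurable (time_measure T)"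
      by (intro borel_measurable_times continuous_on_time_measurable g bump_continuous \<delta>)
    have "\<bar>g \<tau> * bump \<delta> s \<tau>\<bar> \<le> \<bar>B * bump \<delta> s \<tau>\<bar>" if "\<tau> \<in> {0<..<T}" for \<tau>
      using B[of \<tau>] that by (auto simp: abs_mult intro!: mult_right_mono)
    then show "AE \<tau> in time_measure T. norm (g \<tau> * bump \<delta> s \<tau>) \<le> norm (B * bump \<delta> s \<tau>)"
      by (intro AE_I2) simp
  qed
qed

text \<open>Averages against the bumps converge by continuity of \<open>g\<close> at \<open>s\<close>, because the mass \<open>1\<close> of a bump
sits in \<open>[s, s + 2\<delta>]\<close>.\<close>

lemma bump_concentrates:
  fixes g :: "real \<Rightarrow> real"
  assumes g: "continuous_on {0..T} g" and s: "0 < s" "s < T"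
    and \<delta>: "\<And>n. 0 < \<delta> n" "\<delta> \<longlonglongrightarrow> 0"
  shows "(\<lambda>n. \<integral>\<tau>. g \<tau> * bump (\<delta> n) s \<tau> \<partial>time_measure T) \<longlonglongrightarrow> g s"
proof (rule LIMSEQ_I)
  fix e :: real assume "0 < e"
  have "\<exists>d>0. \<forall>\<tau>\<in>{0..T}. dist \<tau> s < d \<longrightarrow> dist (g \<tau>) (g s) < e / 2"
    using g[unfolded continuous_on_iff, rule_format, of s "e / 2"] s \<open>0 < e\<close> by auto
  then obtain d where d: "0 < d" "\<And>\<tau>. \<tau> \<in> {0..T} \<Longrightarrow> \<bar>\<tau> - s\<bar> < d \<Longrightarrow> \<bar>g \<tau> - g s\<bar> < e / 2"
    unfolding dist_real_def by blast
  have "0 < min d (T - s) / 2" using d s by simp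
  from LIMSEQ_D[OF \<delta>(2) this]
  obtain n0 where n0: "\<And>n. n0 \<le> n \<Longrightarrow> norm (\<delta> n - 0) < min d (T - s) / 2" by blast
  have "norm ((\<integral>\<tau>. g \<tau> * bump (\<delta> n) s \<tau> \<partial>time_measure T) - g s) < e" if "n0 \<le> n" for n
  proof -
    have small: "2 * \<delta> n < d" "s + 2 * \<delta> n \<le> T" using n0[OF that] \<delta>(1)[of n] by auto
    have s0: "0 \<le> s" using s by simp
    note b = bump_integral[OF \<delta>(1) s0 small(2)]
    have "(\<integral>\<tau>. g \<tau> * bump (\<delta> n) s \<tau> \<partial>time_measure T) - g s =
        (\<integral>\<tau>. g \<tau> * bump (\<delta> n) s \<tau> - g s * bump (\<delta> n) s \<tau> \<partial>time_measure T)"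
      using b integrable_mult_bump[OF g \<delta>(1) s0 small(2)] by simp
    also have "norm \<dots> \<le> (\<integral>\<tau>. e / 2 * bump (\<delta> n) s \<tau> \<partial>time_measure T)"
    proof (rule Bochner_Integration.integral_norm_bound_integral)
      show "integrable (time_measure T) (\<lambda>\<tau>. g \<tau> * bump (\<delta> n) s \<tau> - g s * bump (\<delta> n) s \<tau>)"
        using b integrable_mult_bump[OF g \<delta>(1) s0 small(2)] by simp
      show "integrable (time_measure T) (\<lambda>\<tau>. e / 2 * bump (\<delta> n) s \<tau>)" using b by simp
      show "norm (g \<tau> * bump (\<delta> n) s \<tau> - g s * bump (\<delta> n) s \<tau>) \<le> e / 2 * bump (\<delta> n) s \<tau>"
        if "\<tau> \<in> space (time_measure T)" for \<tau>
      proof (cases "\<tau> \<in> {s<..<s + 2 * \<delta> n}")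
        case True
        then have "\<bar>g \<tau> - g s\<bar> < e / 2" using d(2)[of \<tau>] that small by auto
        then show ?thesis
          using mult_right_mono[OF less_imp_le bump_nonneg[OF \<delta>(1)],
              of "\<bar>g \<tau> - g s\<bar>" "e / 2" n s \<tau>]
          by (simp add: left_diff_distrib[symmetric] abs_mult bump_nonneg[OF \<delta>(1)])
      qed (simp add: bump_outside[OF \<delta>(1)])
    qed
    also have "\<dots> = e / 2" using b by simp
    finally show ?thesis using \<open>0 < e\<close> by simp
  qed
  then show "\<exists>n0. \<forall>n\<ge>n0. norm ((\<integral>\<tau>. g \<tau> * bump (\<delta> n) s \<tau> \<partial>time_measure T) - g s) < e" by blast
qed

lemma indicator_integrable:
  fixes h :: "real \<Rightarrow> real"
  assumes "integrable (time_measure T) h"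
  shows "integrable (time_measure T) (\<lambda>\<tau>. indicator {s<..t} \<tau> * h \<tau>)"
proof -
  have "(\<lambda>\<tau>. indicator {s<..t} \<tau>) \<in> borel_measurable (time_measure T)"
    by (intro measurable_restrict_space1 measurable_completion borel_measurable_indicator) simp
  then show ?thesis
    using assms by (intro Bochner_Integration.integrable_bound[OF assms] borel_measurable_times)
      (auto simp: indicator_def)
qed

text \<open>Test the weak derivative with a function that climbs from \<open>0\<close> to \<open>1\<close> just after \<open>s\<close> and descends just
after \<open>t\<close>. Its derivative is a bump at \<open>s\<close> minus a bump at \<open>t\<close>, which evaluates \<open>g\<close> there in the limit,
while the function itself tends to the indicator of \<open>(s, t]\<close>.\<close>

lemma weak_derivative_increment_interior:
  fixes g h :: "real \<Rightarrow> real"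
  assumes g: "continuous_on {0..T} g" and h: "integrable (time_measure T) h"
    and weak: "\<And>\<phi> \<phi>'. test_function T \<phi> \<phi>' \<Longrightarrow>
      (\<integral>\<tau>. g \<tau> * \<phi>' \<tau> \<partial>time_measure T) = - (\<integral>\<tau>. h \<tau> * \<phi> \<tau> \<partial>time_measure T)"
    and st: "0 < s" "s \<le> t" "t < T"
  shows "g t - g s = (\<integral>\<tau>. indicator {s<..t} \<tau> * h \<tau> \<partial>time_measure T)"
proof -
  define \<delta> where "\<delta> n = (T - t) / 4 * inverse (real (Suc n))" for n
  define \<phi> where "\<phi> n \<tau> = hat_primitive ((\<tau> - s) / \<delta> n) - hat_primitive ((\<tau> - t) / \<delta> n)" for n \<tau>
  have \<delta>: "0 < \<delta> n" for n using st by (simp add: \<delta>_def)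
  have \<delta>_lim: "\<delta> \<longlonglongrightarrow> 0"
    unfolding \<delta>_def using tendsto_mult_right_zero[OF LIMSEQ_inverse_real_of_nat] by blast
  have \<delta>_le: "\<delta> n \<le> (T - t) / 4" for n
  proof -
    have "inverse (real (Suc n)) \<le> 1" by (simp add: field_simps)
    then show ?thesis using mult_left_mono[of _ 1 "(T - t) / 4"] st by (simp add: \<delta>_def)
  qed
  have in_T: "t + 2 * \<delta> n < T" for n using \<delta>_le[of n] st by (simp add: field_simps)
  have test: "test_function T (\<phi> n) (\<lambda>\<tau>. bump (\<delta> n) s \<tau> - bump (\<delta> n) t \<tau>)" for n
    unfolding test_function_def
  proof (intro conjI allI)
    show "(\<phi> n has_real_derivative bump (\<delta> n) s \<tau> - bump (\<delta> n) t \<tau>) (at \<tau>)" for \<tau>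
      unfolding \<phi>_def[abs_def] by (intro DERIV_diff bump_primitive \<delta>)
    show "continuous_on UNIV (\<lambda>\<tau>. bump (\<delta> n) s \<tau> - bump (\<delta> n) t \<tau>)"
      by (intro continuous_intros bump_continuous \<delta>)
    have "\<phi> n \<tau> = 0" if "\<tau> \<notin> {s..t + 2 * \<delta> n}" for \<tau>
    proof (cases "\<tau> < s")
      case True
      then have "(\<tau> - s) / \<delta> n \<le> 0" "(\<tau> - t) / \<delta> n \<le> 0"
        using \<delta>[of n] st by (auto simp: divide_simps)
      then show ?thesis by (simp add: \<phi>_def hat_primitive_left)
    next
      case False
      then have "2 \<le> (\<tau> - s) / \<delta> n" "2 \<le> (\<tau> - t) / \<delta> n"
        using \<delta>[of n] st that by (auto simp: pos_le_divide_eq)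
      then show ?thesis by (simp add: \<phi>_def hat_primitive_right)
    qed
    then show "\<exists>a b. 0 < a \<and> b < T \<and> (\<forall>\<tau>. \<tau> \<notin> {a..b} \<longrightarrow> \<phi> n \<tau> = 0)"
      using st in_T[of n] by blast
  qed
  have "(\<lambda>n. \<integral>\<tau>. h \<tau> * \<phi> n \<tau> \<partial>time_measure T) \<longlonglongrightarrow>
      (\<integral>\<tau>. indicator {s<..t} \<tau> * h \<tau> \<partial>time_measure T)"
  proof (rule integral_dominated_convergence[where w="\<lambda>\<tau>. \<bar>h \<tau>\<bar>"])
    show "(\<lambda>\<tau>. indicator {s<..t} \<tau> * h \<tau>) \<in> borel_measurable (time_measure T)"
      using indicator_integrable[OF h] by (rule borel_measurable_integrable)
    have "continuous_on {0..T} (\<phi> n)" for n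
      using test[of n] unfolding test_function_def
      by (meson DERIV_isCont continuous_at_imp_continuous_on)
    then show "(\<lambda>\<tau>. h \<tau> * \<phi> n \<tau>) \<in> borel_measurable (time_measure T)" for n
      by (intro borel_measurable_times borel_measurable_integrable[OF h] continuous_on_time_measurable)
    show "integrable (time_measure T) (\<lambda>\<tau>. \<bar>h \<tau>\<bar>)" using h by simp
    have "\<bar>\<phi> n \<tau>\<bar> \<le> 1" for n \<tau>
      using hat_primitive_bounds[of "(\<tau> - s) / \<delta> n"] hat_primitive_bounds[of "(\<tau> - t) / \<delta> n"]
      unfolding \<phi>_def by linarith
    then show "AE \<tau> in time_measure T. norm (h \<tau> * \<phi> n \<tau>) \<le> \<bar>h \<tau>\<bar>" for n
      using mult_left_mono[of "\<bar>\<phi> n _\<bar>" 1 "\<bar>h _\<bar>"] by (intro AE_I2) (simp add: abs_mult)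
    have step: "(\<lambda>n. hat_primitive ((\<tau> - c) / \<delta> n)) \<longlonglongrightarrow> (if c < \<tau> then 1 else 0)" for \<tau> c
    proof (cases "c < \<tau>")
      case True
      then have "0 < (\<tau> - c) / 2" by simp
      from LIMSEQ_D[OF \<delta>_lim this] obtain n0
        where n0: "\<And>n. n0 \<le> n \<Longrightarrow> norm (\<delta> n - 0) < (\<tau> - c) / 2" by blast
      have "hat_primitive ((\<tau> - c) / \<delta> n) = 1" if "n0 \<le> n" for n
        using n0[OF that] \<delta>[of n] by (intro hat_primitive_right) (auto simp: pos_le_divide_eq)
      then show ?thesis using True by (auto intro!: tendsto_eventually eventually_sequentiallyI[of n0])
    next
      case False
      then have "hat_primitive ((\<tau> - c) / \<delta> n) = 0" for n
        using \<delta>[of n] by (intro hat_primitive_left) (auto simp: divide_simps)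
      then show ?thesis using False by simp
    qed
    have "(\<lambda>n. \<phi> n \<tau>) \<longlonglongrightarrow> indicator {s<..t} \<tau>" for \<tau>
      using tendsto_diff[OF step[of \<tau> s] step[of \<tau> t]] st
      by (auto simp: \<phi>_def[abs_def] indicator_def split: if_splits)
    then show "AE \<tau> in time_measure T. (\<lambda>n. h \<tau> * \<phi> n \<tau>) \<longlonglongrightarrow> indicator {s<..t} \<tau> * h \<tau>"
      by (intro AE_I2) (metis mult.commute tendsto_mult_left)
  qed
  moreover have "(\<integral>\<tau>. h \<tau> * \<phi> n \<tau> \<partial>time_measure T) =
      (\<integral>\<tau>. g \<tau> * bump (\<delta> n) t \<tau> \<partial>time_measure T) - (\<integral>\<tau>. g \<tau> * bump (\<delta> n) s \<tau> \<partial>time_measure T)" for n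
  proof -
    have "integrable (time_measure T) (\<lambda>\<tau>. g \<tau> * bump (\<delta> n) c \<tau>)" if "c \<in> {s, t}" for c
      using that st in_T[of n] by (intro integrable_mult_bump g \<delta>) auto
    then show ?thesis
      using weak[OF test[of n]] by (simp add: right_diff_distrib)
  qed
  moreover have "(\<lambda>n. (\<integral>\<tau>. g \<tau> * bump (\<delta> n) t \<tau> \<partial>time_measure T) -
      (\<integral>\<tau>. g \<tau> * bump (\<delta> n) s \<tau> \<partial>time_measure T)) \<longlonglongrightarrow> g t - g s"
    using st by (intro tendsto_diff bump_concentrates g \<delta> \<delta>_lim) auto
  ultimately show ?thesis using LIMSEQ_unique by fastforce
qed

text \<open>The end points of the time interval are reached by continuity of \<open>g\<close> and of the integral; test
functions have to vanish near them.\<close>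

lemma weak_derivative_increment:
  fixes g h :: "real \<Rightarrow> real"
  assumes g: "continuous_on {0..T} g" and h: "integrable (time_measure T) h"
    and weak: "\<And>\<phi> \<phi>'. test_function T \<phi> \<phi>' \<Longrightarrow>
      (\<integral>\<tau>. g \<tau> * \<phi>' \<tau> \<partial>time_measure T) = - (\<integral>\<tau>. h \<tau> * \<phi> \<tau> \<partial>time_measure T)"
    and st: "0 \<le> s" "s \<le> t" "t \<le> T"
  shows "g t - g s = (\<integral>\<tau>. indicator {s<..t} \<tau> * h \<tau> \<partial>time_measure T)"
proof (cases "s = t")
  case False
  then have "s < t" using st by simp
  define c where "c n = (t - s) / 3 * inverse (real (Suc n))" for n
  \<comment> \<open>These points are interior to \<open>[0, T]\<close>, and at each \<open>\<tau>\<close> of \<open>(0, T)\<close> the indicator of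
    \<open>(s' n, t' n]\<close> eventually equals that of \<open>(s, t]\<close>.\<close>
  define s' t' where "s' n = max s (c n)" and "t' n = min t (T - c n)" for n
  have c_pos: "0 < c n" for n using \<open>s < t\<close> by (simp add: c_def)
  have c_lim: "c \<longlonglongrightarrow> 0"
    unfolding c_def using tendsto_mult_right_zero[OF LIMSEQ_inverse_real_of_nat] by blast
  have c_le: "c n \<le> (t - s) / 3" for n
  proof -
    have "inverse (real (Suc n)) \<le> 1" by (simp add: field_simps)
    then show ?thesis using mult_left_mono[of _ 1 "(t - s) / 3"] \<open>s < t\<close> by (simp add: c_def)
  qed
  have s'_lim: "s' \<longlonglongrightarrow> s"
    using tendsto_max[OF tendsto_const[of s] c_lim] st unfolding s'_def[abs_def] by (simp add: max_def)
  have t'_lim: "t' \<longlonglongrightarrow> t"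
    using tendsto_min[OF tendsto_const[of t] tendsto_diff[OF tendsto_const[of T] c_lim]] st
    unfolding t'_def[abs_def] by (simp add: min_def)
  have st': "0 < s' n" "s' n \<le> t' n" "t' n < T" "s' n \<in> {0..T}" "t' n \<in> {0..T}" for n
    using c_pos[of n] c_le[of n] st \<open>s < t\<close> by (auto simp: s'_def t'_def)
  have "(\<lambda>n. \<integral>\<tau>. indicator {s' n<..t' n} \<tau> * h \<tau> \<partial>time_measure T) \<longlonglongrightarrow>
      (\<integral>\<tau>. indicator {s<..t} \<tau> * h \<tau> \<partial>time_measure T)"
  proof (rule integral_dominated_convergence[where w="\<lambda>\<tau>. \<bar>h \<tau>\<bar>"])
    show "(\<lambda>\<tau>. indicator {a<..b} \<tau> * h \<tau>) \<in> borel_measurable (time_measure T)" for a b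
      using indicator_integrable[OF h] by (rule borel_measurable_integrable)
    then show "(\<lambda>\<tau>. indicator {s' n<..t' n} \<tau> * h \<tau>) \<in> borel_measurable (time_measure T)" for n .
    show "integrable (time_measure T) (\<lambda>\<tau>. \<bar>h \<tau>\<bar>)" using h by simp
    show "AE \<tau> in time_measure T. norm (indicator {s' n<..t' n} \<tau> * h \<tau>) \<le> \<bar>h \<tau>\<bar>" for n
      by (intro AE_I2) (simp add: indicator_def)
    have "(\<lambda>n. indicator {s' n<..t' n} \<tau> :: real) \<longlonglongrightarrow> indicator {s<..t} \<tau>"
      if \<tau>: "\<tau> \<in> {0<..<T}" for \<tau>
    proof -
      have "\<forall>\<^sub>F n in sequentially. c n < min \<tau> (T - \<tau>)"
        using c_lim \<tau> by (intro order_tendstoD) auto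
      then have "\<forall>\<^sub>F n in sequentially. indicator {s' n<..t' n} \<tau> = (indicator {s<..t} \<tau> :: real)"
      proof eventually_elim
        case (elim n)
        then show ?case by (auto simp: s'_def t'_def indicator_def)
      qed
      then show ?thesis by (rule tendsto_eventually)
    qed
    then show "AE \<tau> in time_measure T.
        (\<lambda>n. indicator {s' n<..t' n} \<tau> * h \<tau>) \<longlonglongrightarrow> indicator {s<..t} \<tau> * h \<tau>"
      by (intro AE_I2 tendsto_mult_right) simp
  qed
  moreover have "(\<integral>\<tau>. indicator {s' n<..t' n} \<tau> * h \<tau> \<partial>time_measure T) = g (t' n) - g (s' n)" for n
    using weak_derivative_increment_interior[OF g h weak st'(1-3), of n] by simp
  moreover have "(\<lambda>n. g (t' n) - g (s' n)) \<longlonglongrightarrow> g t - g s"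
    using st st' by (intro tendsto_diff continuous_on_tendsto_compose[OF g]) (auto intro: s'_lim t'_lim)
  ultimately show ?thesis using LIMSEQ_unique by fastforce
qed simp

section \<open>Duality and integration by parts in a Gelfand triple\<close>

locale gelfand_evolution =
  fixes T :: real
    and \<iota> :: "'u::{real_inner,complete_space} \<Rightarrow>\<^sub>L 'h::{real_inner,complete_space}"
    and repU :: "'l::{real_inner,complete_space} \<Rightarrow> real \<Rightarrow> 'u"
    and repU' :: "'m::{real_inner,complete_space} \<Rightarrow> real \<Rightarrow> ('u \<Rightarrow>\<^sub>L real)"
    and emb :: "'v::{real_inner,complete_space} \<Rightarrow>\<^sub>L 'l"
    and dt :: "'v \<Rightarrow>\<^sub>L 'm"
    and ev :: "'v \<Rightarrow> real \<Rightarrow> 'h"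
  assumes T_pos: "0 < T"
    and triple: "gelfand_triple \<iota>"
    and space_U: "is_L2 T repU"
    and space_U': "is_L2 T repU'"
    and space_V: "is_solution_space T \<iota> repU repU' emb dt"
    and V_in_C: "is_continuous_embedding T \<iota> repU emb ev"
begin

abbreviation M where "M \<equiv> time_measure T"

abbreviation dual_pairing where "dual_pairing \<equiv> pairing T repU repU'"

lemmas square_integrable_repU [simp] = is_L2_square_integrable[OF space_U]

lemmas square_integrable_repU' [simp] = is_L2_square_integrable[OF space_U']

text \<open>The Riesz isomorphism between \<open>L\<^sup>2(0,T;U\<^sup>*)\<close> and \<open>L\<^sup>2(0,T;U)\<close>, in both directions. It turns the
  duality pairing into the inner product, so that the dual space never has to be treated on its
  own.\<close>

definition primal :: "'m \<Rightarrow> 'l" where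
  "primal w = L2_class T repU (\<lambda>t. I_iso (repU' w t))"

definition dual :: "'l \<Rightarrow> 'm" where
  "dual x = L2_class T repU' (\<lambda>t. D_iso (repU x t))"

lemma primal_AE: "AE t in M. repU (primal w) t = I_iso (repU' w t)"
  unfolding primal_def
  by (rule L2_class_AE[OF space_U square_integrable_bounded_linear[OF square_integrable_repU'
          I_iso_bounded_linear]])

lemma dual_AE: "AE t in M. repU' (dual x) t = D_iso (repU x t)"
  unfolding dual_def
  by (rule L2_class_AE[OF space_U' square_integrable_bounded_linear[OF square_integrable_repU
          D_iso_bounded_linear]])

lemma pairing_eq_inner: "dual_pairing w x = inner (primal w) x"
  unfolding pairing_def is_L2_inner[OF space_U]
proof (rule integral_time_cong_AE)
  show "AE t in M. repU' w t (repU x t) = inner (repU (primal w) t) (repU x t)"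
    using primal_AE[of w] by eventually_elim simp
qed

lemma norm_primal [simp]: "norm (primal w) = norm w"
proof -
  have "AE t in M. (norm (repU (primal w) t))\<^sup>2 = (norm (repU' w t))\<^sup>2"
    using primal_AE[of w] by eventually_elim simp
  then have "(norm (primal w))\<^sup>2 = (norm w)\<^sup>2"
    unfolding is_L2_norm[OF space_U] is_L2_norm[OF space_U'] by (rule integral_time_cong_AE)
  then show ?thesis by simp
qed

lemma primal_bounded_linear: "bounded_linear primal"
proof (rule bounded_linear_intro[where K=1])
  interpret I: bounded_linear "I_iso :: _ \<Rightarrow> 'u" by (rule I_iso_bounded_linear)
  show "primal (v + w) = primal v + primal w" for v w
    by (rule is_L2_eqI[OF space_U])
      (use primal_AE[of "v + w"] primal_AE[of v] primal_AE[of w] is_L2_add[OF space_U', of v w]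
        is_L2_add[OF space_U, of "primal v" "primal w"] in \<open>eventually_elim, simp add: I.add\<close>)
  show "primal (c *\<^sub>R w) = c *\<^sub>R primal w" for c w
    by (rule is_L2_eqI[OF space_U])
      (use primal_AE[of "c *\<^sub>R w"] primal_AE[of w] is_L2_scaleR[OF space_U', of c w]
        is_L2_scaleR[OF space_U, of c "primal w"] in \<open>eventually_elim, simp add: I.scaleR\<close>)
qed simp

sublocale primal: bounded_linear primal by (rule primal_bounded_linear)

lemma primal_dual [simp]: "primal (dual x) = x"
  by (rule is_L2_eqI[OF space_U])
    (use primal_AE[of "dual x"] dual_AE[of x] in \<open>eventually_elim, simp\<close>)

lemma primal_eq_iff: "primal v = primal w \<longleftrightarrow> v = w"
  by (metis norm_primal norm_eq_zero primal.diff right_minus_eq)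

lemma norm_dual [simp]: "norm (dual x) = norm x"
  by (metis norm_primal primal_dual)

lemma inner_primal: "inner (primal v) (primal w) = inner v w"
proof -
  have "inner v w = ((norm (v + w))\<^sup>2 - (norm v)\<^sup>2 - (norm w)\<^sup>2) / 2" for v w :: 'm
    by (simp add: power2_norm_eq_inner inner_simps inner_commute)
  moreover have "inner v w = ((norm (v + w))\<^sup>2 - (norm v)\<^sup>2 - (norm w)\<^sup>2) / 2" for v w :: 'l
    by (simp add: power2_norm_eq_inner inner_simps inner_commute)
  ultimately show ?thesis by (metis norm_primal primal.add)
qed

lemma pairing_le: "\<bar>dual_pairing w x\<bar> \<le> norm w * norm x"
  unfolding pairing_eq_inner using Cauchy_Schwarz_ineq2[of "primal w" x] by simp

lemma pairing_diff_left: "dual_pairing (v - w) x = dual_pairing v x - dual_pairing w x"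
  by (simp add: pairing_eq_inner primal.diff inner_simps)

lemma pairing_minus_left: "dual_pairing (- w) x = - dual_pairing w x"
  by (simp add: pairing_eq_inner primal.neg inner_simps)

lemma pairing_dual: "dual_pairing (dual v) x = inner v x"
  by (simp add: pairing_eq_inner)

text \<open>The adjoint with respect to the duality pairing exists because, read through \<open>primal\<close>, it is a Hilbert
space adjoint.\<close>

lemma pairing_dual_adjoint:
  assumes B: "bounded_linear B"
  shows "dual_pairing (dual_adjoint dual_pairing B z) x = dual_pairing (B x) z"
proof -
  have pB: "bounded_linear (\<lambda>x. primal (B x))"
    by (rule bounded_linear_compose[OF primal_bounded_linear B])
  let ?w = "dual (adjoint (\<lambda>x. primal (B x)) z)"
  have w: "\<forall>x. dual_pairing ?w x = dual_pairing (B x) z"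
    by (metis pairing_eq_inner primal_dual adjoint_inner[OF pB] inner_commute)
  have "\<forall>x. dual_pairing (dual_adjoint dual_pairing B z) x = dual_pairing (B x) z"
    unfolding dual_adjoint_def
  proof (rule theI[of _ ?w])
    fix w assume "\<forall>x. dual_pairing w x = dual_pairing (B x) z"
    with w have "\<forall>x. inner (primal w) x = inner (primal ?w) x" by (simp add: pairing_eq_inner)
    then have "primal w = primal ?w" by (metis vector_eq_rdot)
    then show "w = ?w" by (metis primal_eq_iff)
  qed (rule w)
  then show ?thesis by blast
qed

lemma weak_time_derivative_dt: "weak_time_derivative T \<iota> (repU (emb v)) (repU' (dt v))"
  using space_V unfolding is_solution_space_def by blast

lemma norm_V: "(norm v)\<^sup>2 = (norm (emb v))\<^sup>2 + (norm (dt v))\<^sup>2"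
  using space_V unfolding is_solution_space_def by blast

lemma inner_V: "inner v w = inner (emb v) (emb w) + inner (dt v) (dt w)"
proof -
  have "(norm (v + w))\<^sup>2 = (norm (emb v + emb w))\<^sup>2 + (norm (dt v + dt w))\<^sup>2"
    by (simp add: norm_V blinfun.add_right)
  then show ?thesis
    using norm_V[of v] norm_V[of w] by (simp add: power2_norm_eq_inner inner_simps inner_commute)
qed

lemma norm_emb_le: "norm (emb v) \<le> norm v"
  using norm_V[of v] by (metis le_add_same_cancel1 norm_ge_zero power2_le_imp_le zero_le_power2)

lemma ev_continuous: "continuous_on {0..T} (ev v)"
  using V_in_C unfolding is_continuous_embedding_def by blast

lemma ev_AE: "AE t in M. ev v t = \<iota> (repU (emb v) t)"
  using V_in_C unfolding is_continuous_embedding_def by blast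

text \<open>The points of \<open>(0, T)\<close> at which two continuous functions differ form an open set, and an open null set
is empty; the end points follow by closure.\<close>

lemma continuous_eq_if_AE_eq:
  fixes a b :: "real \<Rightarrow> 'h"
  assumes "continuous_on {0..T} a" "continuous_on {0..T} b" "AE t in M. a t = b t" "t \<in> {0..T}"
  shows "a t = b t"
proof -
  define C where "C = {t \<in> {0..T}. a t = b t}"
  have "closed C"
    unfolding C_def using assms(1,2) by (intro continuous_closed_preimage_constant[of _ "\<lambda>t. a t - b t" 0,
      simplified right_minus_eq]) (auto intro!: continuous_intros)
  have "AE t\<in>{0<..<T} in lebesgue. t \<in> C"
    using assms(3) by (subst (asm) AE_restrict_space_iff) (auto simp: C_def elim!: eventually_mono)
  then have "{0<..<T} \<subseteq> C"
    using mem_closed_if_AE_lebesgue_open[OF open_greaterThanLessThan \<open>closed C\<close>] by blast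
  then have "closure {0<..<T} \<subseteq> C" by (rule closure_minimal) fact
  then show ?thesis using assms(4) T_pos by (auto simp: C_def)
qed

lemma ev_add: "t \<in> {0..T} \<Longrightarrow> ev (v + w) t = ev v t + ev w t"
proof (rule continuous_eq_if_AE_eq[of "ev (v + w)" "\<lambda>t. ev v t + ev w t"])
  show "AE t in M. ev (v + w) t = ev v t + ev w t"
    using ev_AE[of "v + w"] ev_AE[of v] ev_AE[of w] is_L2_add[OF space_U, of "emb v" "emb w"]
    by eventually_elim (simp add: blinfun.add_right)
qed (intro continuous_intros ev_continuous)+

lemma ev_scaleR: "t \<in> {0..T} \<Longrightarrow> ev (c *\<^sub>R v) t = c *\<^sub>R ev v t"
proof (rule continuous_eq_if_AE_eq[of "ev (c *\<^sub>R v)" "\<lambda>t. c *\<^sub>R ev v t"])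
  show "AE t in M. ev (c *\<^sub>R v) t = c *\<^sub>R ev v t"
    using ev_AE[of "c *\<^sub>R v"] ev_AE[of v] is_L2_scaleR[OF space_U, of c "emb v"]
    by eventually_elim (simp add: blinfun.scaleR_right)
qed (intro continuous_intros ev_continuous)+

lemma ev_bounded_linear:
  assumes "t \<in> {0..T}"
  shows "bounded_linear (\<lambda>v. ev v t)"
proof -
  obtain C where C: "\<And>v t. t \<in> {0..T} \<Longrightarrow> norm (ev v t) \<le> C * norm v"
    using V_in_C unfolding is_continuous_embedding_def by blast
  show ?thesis
    by (rule bounded_linear_intro[where K=C])
      (use assms C in \<open>auto simp: ev_add ev_scaleR mult.commute\<close>)
qed

lemma integrable_repU'_repU:
  assumes "square_integrable T x"
  shows "integrable M (\<lambda>t. repU' w t (x t))"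
  by (rule square_integrable_bilinear[OF square_integrable_repU' assms bounded_bilinear_blinfun_apply])

text \<open>The identity \<open>u(t) - u(s) = \<integral>\<^sub>s\<^sup>t u'(\<tau>) d\<tau>\<close> in \<open>U\<^sup>*\<close>.\<close>

lemma ev_increment:
  assumes "0 \<le> s" "s \<le> t" "t \<le> T"
  shows "inner (ev x t - ev x s) (\<iota> v) = (\<integral>\<tau>. indicator {s<..t} \<tau> * repU' (dt x) \<tau> v \<partial>M)"
proof -
  have "inner (ev x t) (\<iota> v) - inner (ev x s) (\<iota> v) =
      (\<integral>\<tau>. indicator {s<..t} \<tau> * repU' (dt x) \<tau> v \<partial>M)"
  proof (rule weak_derivative_increment[OF _ _ _ assms])
    show "continuous_on {0..T} (\<lambda>\<tau>. inner (ev x \<tau>) (\<iota> v))"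
      by (intro continuous_intros ev_continuous)
    show "integrable M (\<lambda>\<tau>. repU' (dt x) \<tau> v)"
      by (rule integrable_repU'_repU[OF square_integrable_const])
    fix \<phi> \<phi>' assume test: "test_function T \<phi> \<phi>'"
    have "(\<integral>\<tau>. inner (ev x \<tau>) (\<iota> v) * \<phi>' \<tau> \<partial>M) =
        (\<integral>\<tau>. inner (\<iota> (repU (emb x) \<tau>)) (\<iota> v) * \<phi>' \<tau> \<partial>M)"
      by (rule integral_time_cong_AE) (use ev_AE[of x] in \<open>eventually_elim, simp\<close>)
    also have "\<dots> = - (\<integral>\<tau>. repU' (dt x) \<tau> v * \<phi> \<tau> \<partial>M)"
      using weak_time_derivative_dt test unfolding weak_time_derivative_def by blast
    finally show "(\<integral>\<tau>. inner (ev x \<tau>) (\<iota> v) * \<phi>' \<tau> \<partial>M) = - (\<integral>\<tau>. repU' (dt x) \<tau> v * \<phi> \<tau> \<partial>M)" .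
  qed
  then show ?thesis by (simp add: inner_simps)
qed

abbreviation \<iota>_adj where "\<iota>_adj \<equiv> adjoint (blinfun_apply \<iota>)"

lemma inner_\<iota>_adj: "inner u (\<iota>_adj k) = inner (\<iota> u) k"
  by (simp add: adjoint_inner[OF blinfun.bounded_linear_right])

lemma inner_\<iota>_adj_left: "inner (\<iota>_adj k) u = inner k (\<iota> u)"
  by (metis inner_\<iota>_adj inner_commute)

lemma \<iota>_adj_bounded_linear: "bounded_linear \<iota>_adj"
  by (rule adjoint_bounded_linear[OF blinfun.bounded_linear_right])

text \<open>The operator \<open>\<iota>\<^sup>* \<iota>\<close> on \<open>U\<close>. It turns information that \<open>u\<close> carries in \<open>H\<close> or in \<open>U\<^sup>*\<close> into
information in \<open>U\<close>: if \<open>b\<close> lies in the solution space, then \<open>\<iota>\<^sup>* b\<close> is a continuous function with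
values in \<open>U\<close> and has a square integrable derivative with values in \<open>U\<close>.\<close>

definition smooth :: "'u \<Rightarrow> 'u" where
  "smooth u = \<iota>_adj (\<iota> u)"

lemma smooth_bounded_linear: "bounded_linear smooth"
  unfolding smooth_def[abs_def]
  by (rule bounded_linear_compose[OF \<iota>_adj_bounded_linear blinfun.bounded_linear_right])

lemma inner_smooth: "inner (smooth u) v = inner (\<iota> u) (\<iota> v)"
  by (simp add: smooth_def inner_\<iota>_adj_left)

definition smooth_L2 :: "'l \<Rightarrow> 'l" where
  "smooth_L2 x = L2_class T repU (\<lambda>t. smooth (repU x t))"

lemma smooth_L2_AE: "AE t in M. repU (smooth_L2 x) t = smooth (repU x t)"
  unfolding smooth_L2_def
  by (rule L2_class_AE[OF space_U square_integrable_bounded_linear[OF square_integrable_repU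
          smooth_bounded_linear]])

lemma inner_smooth_L2:
  "inner (smooth_L2 x) y = (\<integral>t. inner (\<iota> (repU x t)) (\<iota> (repU y t)) \<partial>M)"
  unfolding is_L2_inner[OF space_U]
  by (rule integral_time_cong_AE) (use smooth_L2_AE[of x] in \<open>eventually_elim, simp add: inner_smooth\<close>)

lemma square_integrable_\<iota>: "square_integrable T (\<lambda>t. \<iota> (repU x t))"
  by (rule square_integrable_bounded_linear[OF square_integrable_repU blinfun.bounded_linear_right])

lemma square_integrable_ev: "square_integrable T (ev v)"
  by (rule square_integrable_cong_AE[OF square_integrable_\<iota>[of "emb v"]])
    (use ev_AE[of v] in \<open>eventually_elim, simp\<close>)

lemma inner_smooth_L2_self_nonneg: "0 \<le> inner (smooth_L2 x) x"
  unfolding inner_smooth_L2 by (rule integral_nonneg_AE) simp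

text \<open>Injectivity of the embedding of \<open>U\<close> into \<open>H\<close> makes the form positive definite.\<close>

lemma inner_smooth_L2_self_eq_0:
  assumes "inner (smooth_L2 x) x = 0"
  shows "x = 0"
proof -
  have "integrable M (\<lambda>t. inner (\<iota> (repU x t)) (\<iota> (repU x t)))"
    by (rule square_integrable_bilinear[OF square_integrable_\<iota> square_integrable_\<iota>
          bounded_bilinear_inner])
  then have "AE t in M. inner (\<iota> (repU x t)) (\<iota> (repU x t)) = 0"
    using assms integral_nonneg_eq_0_iff_AE[of M "\<lambda>t. inner (\<iota> (repU x t)) (\<iota> (repU x t))"]
    unfolding inner_smooth_L2 by simp
  then have "AE t in M. repU x t = repU 0 t"
    using is_L2_scaleR[OF space_U, of 0 0]
  proof eventually_elim
    case (elim t)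
    then have "\<iota> (repU x t) = \<iota> 0" by (simp add: blinfun.zero_right)
    then have "repU x t = 0" using triple unfolding gelfand_triple_def by (meson injD)
    with elim show ?case by simp
  qed
  then show ?thesis by (rule is_L2_eqI[OF space_U])
qed

text \<open>Smoothing acts on the solution space: the weak derivative of the smoothed function is the smoothed
derivative, as one sees by testing the weak derivative of \<open>b\<close> with \<open>smooth v\<close> in place of \<open>v\<close>.\<close>

lemma smooth_V:
  obtains y where "emb y = smooth_L2 (emb b)" "dt y = dual (smooth_L2 (primal (dt b)))"
    "\<And>t. t \<in> {0..T} \<Longrightarrow> ev y t = \<iota> (\<iota>_adj (ev b t))"
proof -
  let ?w = "primal (dt b)"
  have "weak_time_derivative T \<iota> (repU (smooth_L2 (emb b))) (repU' (dual (smooth_L2 ?w)))"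
    unfolding weak_time_derivative_def
  proof (intro allI impI)
    fix \<phi> \<phi>' v assume test: "test_function T \<phi> \<phi>'"
    have "(\<integral>t. inner (\<iota> (repU (smooth_L2 (emb b)) t)) (\<iota> v) * \<phi>' t \<partial>M) =
        (\<integral>t. inner (\<iota> (repU (emb b) t)) (\<iota> (smooth v)) * \<phi>' t \<partial>M)"
      by (rule integral_time_cong_AE)
        (use smooth_L2_AE[of "emb b"] in \<open>eventually_elim, simp add: smooth_def inner_\<iota>_adj[symmetric]
          inner_\<iota>_adj_left\<close>)
    also have "\<dots> = - (\<integral>t. repU' (dt b) t (smooth v) * \<phi> t \<partial>M)"
      using weak_time_derivative_dt test unfolding weak_time_derivative_def by blast
    also have "(\<integral>t. repU' (dt b) t (smooth v) * \<phi> t \<partial>M) =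
        (\<integral>t. repU' (dual (smooth_L2 ?w)) t v * \<phi> t \<partial>M)"
    proof (rule integral_time_cong_AE)
      show "AE t in M. repU' (dt b) t (smooth v) * \<phi> t = repU' (dual (smooth_L2 ?w)) t v * \<phi> t"
        using primal_AE[of "dt b"] smooth_L2_AE[of ?w] dual_AE[of "smooth_L2 ?w"]
      proof eventually_elim
        case (elim t)
        have "repU' (dt b) t (smooth v) = inner (smooth v) (I_iso (repU' (dt b) t))"
          by (metis inner_I_iso inner_commute)
        with elim show ?case by (simp add: inner_smooth inner_commute[of "\<iota> v"])
      qed
    qed
    finally show "(\<integral>t. inner (\<iota> (repU (smooth_L2 (emb b)) t)) (\<iota> v) * \<phi>' t \<partial>M) =
      - (\<integral>t. repU' (dual (smooth_L2 ?w)) t v * \<phi> t \<partial>M)" .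
  qed
  then obtain y where y: "emb y = smooth_L2 (emb b)" "dt y = dual (smooth_L2 ?w)"
    using space_V unfolding is_solution_space_def by blast
  have "ev y t = \<iota> (\<iota>_adj (ev b t))" if "t \<in> {0..T}" for t
  proof (rule continuous_eq_if_AE_eq[OF ev_continuous _ _ that])
    show "continuous_on {0..T} (\<lambda>t. \<iota> (\<iota>_adj (ev b t)))"
      by (intro blinfun.continuous_on continuous_on_const
          bounded_linear.continuous_on[OF \<iota>_adj_bounded_linear] ev_continuous)
    show "AE t in M. ev y t = \<iota> (\<iota>_adj (ev b t))"
      using ev_AE[of y] ev_AE[of b] smooth_L2_AE[of "emb b"]
      by eventually_elim (simp add: y smooth_def)
  qed
  with y show thesis by (rule that)
qed

text \<open>Integration by parts against a smoothed function. On a short interval around \<open>z\<close> the increment of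
\<open>(x, \<iota> \<eta>)\<close> with \<open>\<eta> = \<iota>\<^sup>* b\<close> splits into an increment of \<open>x\<close> against a fixed vector of \<open>U\<close> and an
increment of \<open>\<eta>\<close> against a fixed vector of \<open>H\<close>; each is an integral of a derivative. Replacing the
fixed vectors by the moving ones costs at most \<open>e\<close> times the integral of the norms of the
derivatives, by continuity of \<open>\<eta>\<close> in \<open>U\<close> and of \<open>x\<close> in \<open>H\<close> at \<open>z\<close>. The error bound is additive over
adjacent intervals, so it holds on the whole of \<open>[0, T]\<close>, for every \<open>e > 0\<close>.\<close>

lemma integration_by_parts_smooth:
  "inner (ev x T) (\<iota> (\<iota>_adj (ev b T))) - inner (ev x 0) (\<iota> (\<iota>_adj (ev b 0))) =
    (\<integral>t. repU' (dt x) t (\<iota>_adj (ev b t)) + inner (\<iota> (repU (primal (dt b)) t)) (ev x t) \<partial>M)"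
proof -
  define \<eta> where "\<eta> t = \<iota>_adj (ev b t)" for t
  define w where "w = primal (dt b)"
  define q where "q t = repU' (dt x) t (\<eta> t) + inner (\<iota> (repU w t)) (ev x t)" for t
  define m where "m t = norm (repU' (dt x) t) + norm (\<iota> (repU w t))" for t
  let ?I = "\<lambda>(f :: real \<Rightarrow> real) a c. \<integral>\<tau>. indicator {a<..c} \<tau> * f \<tau> \<partial>M"
  define \<Phi> where "\<Phi> t = inner (ev x t) (\<iota> (\<eta> t))" for t
  have \<eta>_L2: "square_integrable T \<eta>"
    unfolding \<eta>_def by (rule square_integrable_bounded_linear[OF square_integrable_ev \<iota>_adj_bounded_linear])
  have q1: "integrable M (\<lambda>t. repU' (dt x) t (\<eta> t))"
    by (rule integrable_repU'_repU[OF \<eta>_L2])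
  have q2: "integrable M (\<lambda>t. inner (\<iota> (repU w t)) (ev x t))"
    by (rule square_integrable_bilinear[OF square_integrable_\<iota> square_integrable_ev bounded_bilinear_inner])
  have q: "integrable M q" unfolding q_def using q1 q2 by simp
  have m: "integrable M m"
    unfolding m_def by (intro Bochner_Integration.integrable_add square_integrable_norm_integrable
        square_integrable_repU' square_integrable_\<iota>)
  have \<eta>_cont: "continuous_on {0..T} \<eta>"
    unfolding \<eta>_def by (rule bounded_linear.continuous_on[OF \<iota>_adj_bounded_linear ev_continuous])
  have additive: "?I f a d = ?I f a c + ?I f c d"
    if f: "integrable M f" and "a \<le> c" "c \<le> d" for f a c d
  proof -
    have "?I f a d = (\<integral>\<tau>. indicator {a<..c} \<tau> * f \<tau> + indicator {c<..d} \<tau> * f \<tau> \<partial>M)"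
      using that by (intro Bochner_Integration.integral_cong) (auto simp: indicator_def)
    also have "\<dots> = ?I f a c + ?I f c d"
      by (intro Bochner_Integration.integral_add indicator_integrable f)
    finally show ?thesis .
  qed
  have increment: "\<Phi> t - \<Phi> s - ?I q s t =
      (\<integral>\<tau>. indicator {s<..t} \<tau> *
        (repU' (dt x) \<tau> (\<eta> s - \<eta> \<tau>) + inner (\<iota> (repU w \<tau>)) (ev x t - ev x \<tau>)) \<partial>M)"
    if st: "0 \<le> s" "s \<le> t" "t \<le> T" for s t
  proof -
    have c1: "integrable M (\<lambda>\<tau>. repU' (dt x) \<tau> (\<eta> s))"
      by (rule integrable_repU'_repU[OF square_integrable_const])
    have c2: "integrable M (\<lambda>\<tau>. inner (\<iota> (repU w \<tau>)) (ev x t))"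
      by (rule square_integrable_bilinear[OF square_integrable_\<iota> square_integrable_const
            bounded_bilinear_inner])
    have "inner (ev b t - ev b s) (\<iota> (\<iota>_adj (ev x t))) =
        ?I (\<lambda>\<tau>. repU' (dt b) \<tau> (\<iota>_adj (ev x t))) s t"
      by (rule ev_increment[OF st])
    also have "\<dots> = ?I (\<lambda>\<tau>. inner (\<iota> (repU w \<tau>)) (ev x t)) s t"
    proof (rule integral_time_cong_AE)
      show "AE \<tau> in M. indicator {s<..t} \<tau> * repU' (dt b) \<tau> (\<iota>_adj (ev x t)) =
          indicator {s<..t} \<tau> * inner (\<iota> (repU w \<tau>)) (ev x t)"
        using primal_AE[of "dt b"]
        by eventually_elim (simp add: w_def inner_\<iota>_adj[symmetric])
    qed
    finally have 2: "inner (ev x t) (\<iota> (\<eta> t) - \<iota> (\<eta> s)) = ?I (\<lambda>\<tau>. inner (\<iota> (repU w \<tau>)) (ev x t)) s t"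
      using linear_diff[OF bounded_linear.linear[OF \<iota>_adj_bounded_linear], of "ev b t" "ev b s"]
      by (simp add: \<eta>_def blinfun.diff_right[symmetric] inner_\<iota>_adj_left[symmetric])
        (simp add: inner_\<iota>_adj inner_\<iota>_adj_left inner_commute)
    have "\<Phi> t - \<Phi> s = inner (ev x t - ev x s) (\<iota> (\<eta> s)) + inner (ev x t) (\<iota> (\<eta> t) - \<iota> (\<eta> s))"
      by (simp add: \<Phi>_def inner_simps)
    also have "\<dots> = ?I (\<lambda>\<tau>. repU' (dt x) \<tau> (\<eta> s)) s t + ?I (\<lambda>\<tau>. inner (\<iota> (repU w \<tau>)) (ev x t)) s t"
      unfolding ev_increment[OF st] 2 ..
    finally have "\<Phi> t - \<Phi> s - ?I q s t =
        ?I (\<lambda>\<tau>. repU' (dt x) \<tau> (\<eta> s)) s t + ?I (\<lambda>\<tau>. inner (\<iota> (repU w \<tau>)) (ev x t)) s t - ?I q s t"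
      by simp
    also have "\<dots> = (\<integral>\<tau>. indicator {s<..t} \<tau> * repU' (dt x) \<tau> (\<eta> s) +
        indicator {s<..t} \<tau> * inner (\<iota> (repU w \<tau>)) (ev x t) - indicator {s<..t} \<tau> * q \<tau> \<partial>M)"
      using indicator_integrable[OF c1] indicator_integrable[OF c2] indicator_integrable[OF q] by simp
    also have "\<dots> = (\<integral>\<tau>. indicator {s<..t} \<tau> *
        (repU' (dt x) \<tau> (\<eta> s - \<eta> \<tau>) + inner (\<iota> (repU w \<tau>)) (ev x t - ev x \<tau>)) \<partial>M)"
      by (intro Bochner_Integration.integral_cong)
        (simp_all add: q_def blinfun.diff_right inner_simps algebra_simps)
    finally show ?thesis .
  qed
  have bound: "\<bar>\<Phi> T - \<Phi> 0 - ?I q 0 T\<bar> \<le> e * ?I m 0 T" if "0 < e" for e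
  proof -
    \<comment> \<open>The guard confines the claim to \<open>[0, T]\<close>; bisection also asks about intervals around its end
      points that stick out.\<close>
    define P where "P a c \<longleftrightarrow> (0 \<le> a \<and> a \<le> c \<and> c \<le> T \<longrightarrow> \<bar>\<Phi> c - \<Phi> a - ?I q a c\<bar> \<le> e * ?I m a c)" for a c
    have "0 \<le> T" using T_pos by simp
    then have "P 0 T"
    proof (induction rule: Bolzano)
      case (trans a c d)
      show ?case unfolding P_def
      proof
        assume ad: "0 \<le> a \<and> a \<le> d \<and> d \<le> T"
        then have "\<bar>\<Phi> c - \<Phi> a - ?I q a c\<bar> \<le> e * ?I m a c" "\<bar>\<Phi> d - \<Phi> c - ?I q c d\<bar> \<le> e * ?I m c d"
          using trans unfolding P_def by simp_all
        moreover have "?I q a d = ?I q a c + ?I q c d" "?I m a d = ?I m a c + ?I m c d"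
          by (rule additive[OF q trans(3,4)], rule additive[OF m trans(3,4)])
        ultimately show "\<bar>\<Phi> d - \<Phi> a - ?I q a d\<bar> \<le> e * ?I m a d"
          by (simp add: distrib_left)
      qed
    next
      case (local z)
      then have z: "z \<in> {0..T}" by simp
      have e2: "0 < e / 2" using \<open>0 < e\<close> by simp
      obtain d1 where d1: "0 < d1" "\<And>\<tau>. \<tau> \<in> {0..T} \<Longrightarrow> dist \<tau> z < d1 \<Longrightarrow> dist (\<eta> \<tau>) (\<eta> z) < e / 2"
        using \<eta>_cont z e2 unfolding continuous_on_iff by metis
      obtain d2 where d2: "0 < d2" "\<And>\<tau>. \<tau> \<in> {0..T} \<Longrightarrow> dist \<tau> z < d2 \<Longrightarrow> dist (ev x \<tau>) (ev x z) < e / 2"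
        using ev_continuous[of x] z e2 unfolding continuous_on_iff by metis
      have "P a c" if ac: "a \<le> z" "z \<le> c" "c - a < min d1 d2" for a c
        unfolding P_def
      proof
        assume in_T: "0 \<le> a \<and> a \<le> c \<and> c \<le> T"
        have near: "norm (\<eta> a - \<eta> \<tau>) \<le> e" "norm (ev x c - ev x \<tau>) \<le> e" if "\<tau> \<in> {a<..c}" for \<tau>
        proof -
          have "dist (\<eta> a) (\<eta> z) < e / 2"
            by (rule d1(2)) (use that ac in_T in \<open>auto simp: dist_real_def\<close>)
          moreover have "dist (\<eta> \<tau>) (\<eta> z) < e / 2"
            by (rule d1(2)) (use that ac in_T in \<open>auto simp: dist_real_def\<close>)
          ultimately show "norm (\<eta> a - \<eta> \<tau>) \<le> e"
            using dist_triangle_half_l[of "\<eta> a" "\<eta> z" e "\<eta> \<tau>"] by (simp add: dist_norm dist_commute)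
          have "dist (ev x c) (ev x z) < e / 2"
            by (rule d2(2)) (use that ac in_T in \<open>auto simp: dist_real_def\<close>)
          moreover have "dist (ev x \<tau>) (ev x z) < e / 2"
            by (rule d2(2)) (use that ac in_T in \<open>auto simp: dist_real_def\<close>)
          ultimately show "norm (ev x c - ev x \<tau>) \<le> e"
            using dist_triangle_half_l[of "ev x c" "ev x z" e "ev x \<tau>"]
            by (simp add: dist_norm dist_commute)
        qed
        let ?g = "\<lambda>\<tau>. repU' (dt x) \<tau> (\<eta> a - \<eta> \<tau>) + inner (\<iota> (repU w \<tau>)) (ev x c - ev x \<tau>)"
        have "norm (?I ?g a c) \<le> (\<integral>\<tau>. indicator {a<..c} \<tau> * (e * m \<tau>) \<partial>M)"
        proof (rule Bochner_Integration.integral_norm_bound_integral)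
          have "integrable M (\<lambda>\<tau>. repU' (dt x) \<tau> (\<eta> a) - repU' (dt x) \<tau> (\<eta> \<tau>) +
              (inner (\<iota> (repU w \<tau>)) (ev x c) - inner (\<iota> (repU w \<tau>)) (ev x \<tau>)))"
            by (intro Bochner_Integration.integrable_add Bochner_Integration.integrable_diff q1 q2
                integrable_repU'_repU[OF square_integrable_const]
                square_integrable_bilinear[OF square_integrable_\<iota> square_integrable_const
                  bounded_bilinear_inner])
          then show "integrable M (\<lambda>\<tau>. indicator {a<..c} \<tau> * ?g \<tau>)"
            by (intro indicator_integrable) (simp add: blinfun.diff_right inner_diff_right)
          show "integrable M (\<lambda>\<tau>. indicator {a<..c} \<tau> * (e * m \<tau>))"
            using m by (intro indicator_integrable) simp
          show "norm (indicator {a<..c} \<tau> * ?g \<tau>) \<le> indicator {a<..c} \<tau> * (e * m \<tau>)" for \<tau>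
          proof (cases "\<tau> \<in> {a<..c}")
            case True
            have "\<bar>repU' (dt x) \<tau> (\<eta> a - \<eta> \<tau>)\<bar> \<le> norm (repU' (dt x) \<tau>) * e"
              using norm_blinfun[of "repU' (dt x) \<tau>" "\<eta> a - \<eta> \<tau>"] near(1)[OF True]
              by (simp add: mult_left_mono order_trans[OF _ mult_left_mono])
            moreover have "\<bar>inner (\<iota> (repU w \<tau>)) (ev x c - ev x \<tau>)\<bar> \<le> norm (\<iota> (repU w \<tau>)) * e"
              using Cauchy_Schwarz_ineq2[of "\<iota> (repU w \<tau>)" "ev x c - ev x \<tau>"] near(2)[OF True]
              by (simp add: order_trans[OF _ mult_left_mono])
            ultimately show ?thesis using True by (simp add: m_def algebra_simps)
          qed simp
        qed
        also have "\<dots> = e * ?I m a c"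
          by (simp add: mult.left_commute)
        finally show "\<bar>\<Phi> c - \<Phi> a - ?I q a c\<bar> \<le> e * ?I m a c"
          using increment[of a c] in_T by simp
      qed
      then show ?case using d1(1) d2(1) by (intro exI[of _ "min d1 d2"]) auto
    qed
    then show ?thesis using T_pos unfolding P_def by simp
  qed
  \<comment> \<open>Let \<open>e \<rightarrow> 0\<close>.\<close>
  have "\<Phi> T - \<Phi> 0 - ?I q 0 T = 0"
  proof (rule ccontr)
    assume nz: "\<Phi> T - \<Phi> 0 - ?I q 0 T \<noteq> 0"
    define D where "D = \<bar>\<Phi> T - \<Phi> 0 - ?I q 0 T\<bar>"
    have "0 \<le> ?I m 0 T" by (rule integral_nonneg_AE) (simp add: m_def)
    then have "D / (2 * (?I m 0 T + 1)) * ?I m 0 T < D" "0 < D / (2 * (?I m 0 T + 1))"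
      using nz by (auto simp: D_def field_simps add_pos_nonneg)
    then show False using bound unfolding D_def by fastforce
  qed
  moreover have "?I q 0 T = (\<integral>t. q t \<partial>M)"
    by (intro Bochner_Integration.integral_cong) (auto simp: indicator_def)
  ultimately show ?thesis by (simp add: \<Phi>_def q_def \<eta>_def w_def)
qed

text \<open>The usual proof approximates by smooth functions. Instead, the defect \<open>B\<close> of the formula is a bounded
functional of \<open>y\<close>, hence the inner product with some \<open>b\<close> in the solution space. It vanishes at the
smoothed \<open>b\<close>, but the inner product of \<open>b\<close> with its own smoothing is \<open>\<integral> \<parallel>\<iota> b\<parallel>\<^sup>2 + \<parallel>\<iota> w\<parallel>\<^sup>2\<close> with \<open>w\<close> the
Riesz representative of the derivative of \<open>b\<close>. So \<open>b = 0\<close>, and the defect vanishes identically.\<close>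

lemma integration_by_parts:
  "dual_pairing (dt x) (emb y) + dual_pairing (dt y) (emb x) =
    inner (ev x T) (ev y T) - inner (ev x 0) (ev y 0)"
proof -
  define B where "B y = dual_pairing (dt x) (emb y) + dual_pairing (dt y) (emb x) -
    (inner (ev x T) (ev y T) - inner (ev x 0) (ev y 0))" for y
  have "bounded_linear B"
    unfolding B_def pairing_eq_inner using T_pos
    by (intro bounded_linear_sub bounded_linear_add
        bounded_linear_compose[OF bounded_linear_inner_right]
        bounded_linear_compose[OF bounded_linear_inner_left]
        bounded_linear_compose[OF primal_bounded_linear]
        ev_bounded_linear blinfun.bounded_linear_right) auto
  then obtain b where b: "\<And>y. inner b y = B y" by (rule riesz_representation) blast
  obtain y where y: "emb y = smooth_L2 (emb b)" "dt y = dual (smooth_L2 (primal (dt b)))"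
    "\<And>t. t \<in> {0..T} \<Longrightarrow> ev y t = \<iota> (\<iota>_adj (ev b t))" by (rule smooth_V[of b]) blast
  have 1: "dual_pairing (dt x) (emb y) = (\<integral>t. repU' (dt x) t (\<iota>_adj (ev b t)) \<partial>M)"
    unfolding pairing_def
    by (rule integral_time_cong_AE) (use ev_AE[of b] smooth_L2_AE[of "emb b"] in \<open>eventually_elim,
        simp add: y smooth_def\<close>)
  have 2: "dual_pairing (dt y) (emb x) = (\<integral>t. inner (\<iota> (repU (primal (dt b)) t)) (ev x t) \<partial>M)"
    unfolding y pairing_dual inner_smooth_L2
    by (rule integral_time_cong_AE) (use ev_AE[of x] in \<open>eventually_elim, simp\<close>)
  have "integrable M (\<lambda>t. repU' (dt x) t (\<iota>_adj (ev b t)))"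
    by (rule integrable_repU'_repU[OF square_integrable_bounded_linear[OF square_integrable_ev \<iota>_adj_bounded_linear]])
  moreover have "integrable M (\<lambda>t. inner (\<iota> (repU (primal (dt b)) t)) (ev x t))"
    by (rule square_integrable_bilinear[OF square_integrable_\<iota> square_integrable_ev bounded_bilinear_inner])
  ultimately have "B y = 0"
    unfolding B_def 1 2 using integration_by_parts_smooth[of x b] T_pos by (simp add: y)
  then have "0 = inner b y" by (simp add: b)
  also have "\<dots> = inner (smooth_L2 (emb b)) (emb b) + inner (smooth_L2 (primal (dt b))) (primal (dt b))"
    unfolding inner_V inner_primal[symmetric] y by (simp add: inner_commute)
  finally have "emb b = 0" "primal (dt b) = 0"
    using inner_smooth_L2_self_nonneg[of "emb b"] inner_smooth_L2_self_nonneg[of "primal (dt b)"]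
    by (auto intro!: inner_smooth_L2_self_eq_0)
  then have "b = 0" using norm_V[of b] norm_primal[of "dt b"] by simp
  then show ?thesis using b[of y for y] unfolding B_def by simp
qed

end

section \<open>The linearised state equation and the error of the approximate adjoint\<close>

text \<open>The nonlinearity is differentiable in each argument separately, and its partial derivative in the
parameter is controlled only on the ball. This is enough to differentiate the state equation along a
segment from \<open>\<theta>\<close> to another point of the ball, from one side because \<open>\<theta>\<close> may lie on the sphere. The
resulting identity is linear in the direction, and differences of such directions exhaust the space.\<close>

lemma linearised_state_equation:
  fixes N :: "'x::real_inner \<Rightarrow> 'v::real_normed_vector \<Rightarrow> 'm::real_normed_vector"
    and dt :: "'v \<Rightarrow>\<^sub>L 'm" and emb :: "'v \<Rightarrow>\<^sub>L 'l::real_normed_vector"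
    and f\<theta> :: "'x \<Rightarrow> 'v \<Rightarrow> ('x \<Rightarrow>\<^sub>L 'm)"
  assumes N_\<theta>: "\<And>\<theta> u. ((\<lambda>\<theta>. N \<theta> u) has_derivative f\<theta> \<theta> u) (at \<theta>)"
    and N_u: "(N \<theta> has_derivative Nu) (at (S \<theta>))"
    and S: "(S has_derivative S') (at \<theta>)"
    and solves: "\<And>\<theta>. dt (S \<theta>) + N \<theta> (S \<theta>) = 0"
    and \<theta>: "\<theta> \<in> cball c R" and R: "0 < R" and K: "0 \<le> K"
    and lip: "\<And>\<theta>1 \<theta>2. \<theta>1 \<in> cball c R \<Longrightarrow> \<theta>2 \<in> cball c R \<Longrightarrow>
      norm (f\<theta> \<theta>1 (S \<theta>2) - f\<theta> \<theta> (S \<theta>)) \<le> K * (norm (\<theta>1 - \<theta>) + norm (emb (S \<theta>2) - emb (S \<theta>)))"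
  shows "dt (S' \<xi>) + f\<theta> \<theta> (S \<theta>) \<xi> + Nu (S' \<xi>) = 0"
proof -
  define D where "D \<xi> = dt (S' \<xi>) + f\<theta> \<theta> (S \<theta>) \<xi> + Nu (S' \<xi>)" for \<xi>
  have "bounded_linear D"
    unfolding D_def
    by (intro bounded_linear_add blinfun.bounded_linear_right
        bounded_linear_compose[OF blinfun.bounded_linear_right]
        bounded_linear_compose[OF has_derivative_bounded_linear[OF N_u]]
        has_derivative_bounded_linear[OF S])
  then interpret D: bounded_linear D .
  have inward: "D (\<theta>1 - \<theta>) = 0" if \<theta>1: "\<theta>1 \<in> cball c R" for \<theta>1
  proof -
    define \<xi> where "\<xi> = \<theta>1 - \<theta>"
    define \<gamma> where "\<gamma> s = \<theta> + s *\<^sub>R \<xi>" for s :: real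
    \<comment> \<open>Only the state varies in \<open>d\<close>, so the chain rule gives one expression for its derivative at \<open>0\<close>.
      The state equation shows that \<open>d\<close> also equals minus the effect of varying the parameter alone,
      which gives a second one.\<close>
    define d where "d s = dt (S (\<gamma> s)) + N \<theta> (S (\<gamma> s))" for s
    have \<gamma>_ball: "\<gamma> s \<in> cball c R" if "s \<in> {0..1}" for s
    proof -
      have "(1 - s) *\<^sub>R \<theta> + s *\<^sub>R \<theta>1 \<in> cball c R"
        using convexD[OF convex_cball \<theta> \<theta>1, of "1 - s" s] that by simp
      then show ?thesis by (simp add: \<gamma>_def \<xi>_def algebra_simps)
    qed
    have \<gamma>_der: "(\<gamma> has_derivative (\<lambda>s. s *\<^sub>R \<xi>)) (at 0 within {0..1})"
      unfolding \<gamma>_def by (auto intro!: derivative_eq_intros)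
    have \<gamma>0: "\<gamma> 0 = \<theta>" by (simp add: \<gamma>_def)
    have S\<gamma>: "((\<lambda>s. S (\<gamma> s)) has_derivative (\<lambda>s. S' (s *\<^sub>R \<xi>))) (at 0 within {0..1})"
      by (rule has_derivative_compose[OF \<gamma>_der]) (simp add: \<gamma>0 S)
    have d1: "(d has_derivative (\<lambda>s. dt (S' (s *\<^sub>R \<xi>)) + Nu (S' (s *\<^sub>R \<xi>)))) (at 0 within {0..1})"
      unfolding d_def
      by (intro has_derivative_add bounded_linear.has_derivative[OF blinfun.bounded_linear_right] S\<gamma>
          has_derivative_compose[OF S\<gamma>]) (simp add: \<gamma>0 N_u)
    have S\<gamma>_lim: "((\<lambda>s. emb (S (\<gamma> s)) - emb (S \<theta>)) \<longlongrightarrow> 0) (at 0 within {0..1})"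
    proof -
      have "((\<lambda>s. emb (S (\<gamma> s))) \<longlongrightarrow> emb (S (\<gamma> 0))) (at 0 within {0..1})"
        using has_derivative_continuous[OF S\<gamma>]
        by (intro bounded_linear.tendsto[OF blinfun.bounded_linear_right]) (simp add: continuous_within)
      then show ?thesis using LIM_zero by (fastforce simp: \<gamma>0)
    qed
    have d2: "(d has_derivative (\<lambda>s. s *\<^sub>R - f\<theta> \<theta> (S \<theta>) \<xi>)) (at 0 within {0..1})"
      unfolding has_derivative_iff_norm
    proof
      show "bounded_linear (\<lambda>s. s *\<^sub>R - f\<theta> \<theta> (S \<theta>) \<xi>)" by (rule bounded_linear_scaleR_left)
      let ?b = "\<lambda>s. norm \<xi> * (K * (s * norm \<xi> + norm (emb (S (\<gamma> s)) - emb (S \<theta>))))"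
      have "norm (d s - d 0 - s *\<^sub>R - f\<theta> \<theta> (S \<theta>) \<xi>) \<le> s * ?b s" if s: "s \<in> {0..1}" for s
      proof -
        let ?u = "S (\<gamma> s)" and ?B = "K * (s * norm \<xi> + norm (emb (S (\<gamma> s)) - emb (S \<theta>)))"
        let ?g = "\<lambda>\<theta>'. N \<theta>' ?u - f\<theta> \<theta> (S \<theta>) \<theta>'"
        have "norm (?g (\<gamma> s) - ?g \<theta>) \<le> ?B * norm (\<gamma> s - \<theta>)"
        proof (rule differentiable_bound)
          show "convex (closed_segment \<theta> (\<gamma> s))" by simp
          show "(?g has_derivative (f\<theta> \<theta>' ?u - f\<theta> \<theta> (S \<theta>))) (at \<theta>' within closed_segment \<theta> (\<gamma> s))" for \<theta>'
            unfolding minus_blinfun.rep_eq fun_diff_def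
            by (rule has_derivative_diff[OF has_derivative_at_withinI[OF N_\<theta>]
                  bounded_linear_imp_has_derivative[OF blinfun.bounded_linear_right]])
          fix \<theta>' assume \<theta>': "\<theta>' \<in> closed_segment \<theta> (\<gamma> s)"
          have "\<theta>' \<in> cball c R"
            using \<theta>' closed_segment_subset[OF \<theta> \<gamma>_ball[OF s] convex_cball] by blast
          then have "norm (f\<theta> \<theta>' ?u - f\<theta> \<theta> (S \<theta>)) \<le> K * (norm (\<theta>' - \<theta>) + norm (emb ?u - emb (S \<theta>)))"
            by (rule lip) (rule \<gamma>_ball[OF s])
          also have "norm (\<theta>' - \<theta>) \<le> norm (\<gamma> s - \<theta>)" by (rule segment_bound(1)[OF \<theta>'])
          also have "norm (\<gamma> s - \<theta>) = s * norm \<xi>" using s by (simp add: \<gamma>_def)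
          finally show "onorm (f\<theta> \<theta>' ?u - f\<theta> \<theta> (S \<theta>)) \<le> ?B"
            using K by (simp add: norm_blinfun.rep_eq mult_left_mono)
        qed simp_all
        moreover have "d s - d 0 - s *\<^sub>R - f\<theta> \<theta> (S \<theta>) \<xi> = - (?g (\<gamma> s) - ?g \<theta>)"
          using solves[of "\<gamma> s"] solves[of \<theta>]
          by (simp add: d_def \<gamma>0 \<gamma>_def blinfun.add_right blinfun.scaleR_right add_eq_0_iff)
        ultimately show ?thesis
          using s by (simp add: \<gamma>_def norm_minus_commute mult_ac)
      qed
      then have "norm (norm (d s - d 0 - (s - 0) *\<^sub>R - f\<theta> \<theta> (S \<theta>) \<xi>) / norm (s - 0)) \<le> ?b s"
        if "s \<in> {0..1}" "s \<noteq> 0" for s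
        using that by (simp add: pos_divide_le_eq mult.commute)
      then have small: "\<forall>\<^sub>F s in at 0 within {0..1}.
          norm (norm (d s - d 0 - (s - 0) *\<^sub>R - f\<theta> \<theta> (S \<theta>) \<xi>) / norm (s - 0)) \<le> ?b s"
        unfolding eventually_at by (intro exI[of _ 1]) auto
      have "(?b \<longlongrightarrow> norm \<xi> * (K * (0 * norm \<xi> + norm (0 :: 'l)))) (at 0 within {0..1})"
        by (intro tendsto_intros S\<gamma>_lim)
      then have "(?b \<longlongrightarrow> 0) (at 0 within {0..1})" by simp
      with small show "((\<lambda>s. norm (d s - d 0 - (s - 0) *\<^sub>R - f\<theta> \<theta> (S \<theta>) \<xi>) / norm (s - 0)) \<longlongrightarrow> 0)
          (at 0 within {0..1})"
        by (rule Lim_null_comparison)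
    qed
    have "(\<lambda>s. dt (S' (s *\<^sub>R \<xi>)) + Nu (S' (s *\<^sub>R \<xi>))) = (\<lambda>s. s *\<^sub>R (dt (S' \<xi>) + Nu (S' \<xi>)))"
      using linear_scale[OF has_derivative_linear[OF N_u]] linear_scale[OF has_derivative_linear[OF S]]
      by (simp add: blinfun.scaleR_right scaleR_add_right)
    then have "(d has_vector_derivative (dt (S' \<xi>) + Nu (S' \<xi>))) (at 0 within {0..1})"
      using d1 by (simp add: has_vector_derivative_def)
    moreover have "(d has_vector_derivative - f\<theta> \<theta> (S \<theta>) \<xi>) (at 0 within {0..1})"
      using d2 by (simp add: has_vector_derivative_def)
    ultimately have "dt (S' \<xi>) + Nu (S' \<xi>) = - f\<theta> \<theta> (S \<theta>) \<xi>"
      by (intro vector_derivative_unique_within[of 0 "{0..1::real}"]) (auto simp: at_within_Icc_at_right trivial_limit_at_right_real)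
    then have "dt (S' \<xi>) + Nu (S' \<xi>) + f\<theta> \<theta> (S \<theta>) \<xi> = 0" by simp
    then show ?thesis by (simp only: D_def \<xi>_def add_ac)
  qed
  have "D \<xi> = 0"
  proof (cases "\<xi> = 0")
    case False
    \<comment> \<open>The scaled direction is the difference of the two inward directions towards the centre and towards
      a point of the sphere.\<close>
    define t where "t = R / norm \<xi>"
    have t: "t \<noteq> 0" using False R by (simp add: t_def)
    have "c + t *\<^sub>R \<xi> \<in> cball c R" "c \<in> cball c R" using False R by (auto simp: t_def dist_norm)
    then have "D ((c + t *\<^sub>R \<xi> - \<theta>) - (c - \<theta>)) = 0" using inward by (simp only: D.diff) simp
    then show ?thesis using t by (simp add: D.scaleR)
  qed (simp add: D.zero)
  then show ?thesis by (simp add: D_def)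
qed

text \<open>The map is an isometry; the nonzero vector excludes the zero space, on which the operator norm is \<open>0\<close>.\<close>

lemma one_le_onorm_D_iso:
  assumes "(u :: 'u::{real_inner,complete_space}) \<noteq> 0"
  shows "1 \<le> onorm (D_iso :: 'u \<Rightarrow> ('u \<Rightarrow>\<^sub>L real))"
proof -
  have "norm u \<le> onorm (D_iso :: 'u \<Rightarrow> ('u \<Rightarrow>\<^sub>L real)) * norm u"
    using onorm[OF D_iso_bounded_linear, of u] by simp
  then show ?thesis using assms by simp
qed

lemma one_le_onorm_I_iso:
  assumes "(x :: 'x::{real_inner,complete_space}) \<noteq> 0"
  shows "1 \<le> onorm (I_iso :: ('x \<Rightarrow>\<^sub>L real) \<Rightarrow> 'x)"
proof -
  have "norm x \<le> onorm (I_iso :: ('x \<Rightarrow>\<^sub>L real) \<Rightarrow> 'x) * norm x"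
    using onorm[OF I_iso_bounded_linear, of "D_iso x"] by simp
  then show ?thesis using assms by simp
qed

lemma inner_I_iso_adjoint_to_dual:
  fixes B :: "'x::{real_inner,complete_space} \<Rightarrow>\<^sub>L ('u::real_normed_vector \<Rightarrow>\<^sub>L real)"
  shows "inner (I_iso (adjoint_to_dual B z)) \<xi> = B \<xi> z"
proof -
  have "bounded_linear (\<lambda>\<xi>. B \<xi> z)"
    by (rule bounded_linear_compose[OF blinfun.bounded_linear_left blinfun.bounded_linear_right])
  then show ?thesis by (simp add: adjoint_to_dual_def bounded_linear_Blinfun_apply)
qed

lemma inner_I_iso_adjoint_from_pivot:
  fixes A :: "'x::{real_inner,complete_space} \<Rightarrow>\<^sub>L 'h::real_inner"
  shows "inner (I_iso (adjoint_from_pivot A k)) \<xi> = inner k (A \<xi>)"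
  by (simp add: adjoint_from_pivot_def)

context gelfand_evolution
begin

lemma U_nontrivial:
  fixes x :: 'l
  assumes "x \<noteq> 0"
  obtains u :: 'u where "u \<noteq> 0"
proof -
  have "\<exists>u :: 'u. u \<noteq> 0"
  proof (rule ccontr)
    assume "\<nexists>u :: 'u. u \<noteq> 0"
    then have "repU x t = repU 0 t" for t by metis
    then have "x = 0" by (intro is_L2_eqI[OF space_U]) simp
    with assms show False by contradiction
  qed
  with that show thesis by blast
qed

text \<open>The integrand need not be Bochner integrable, but its weak integral exists: the integrals against a
fixed \<open>\<xi>\<close> form the bounded functional on the right-hand side, which has a Riesz representative.\<close>

lemma inner_weak_integral_adjoint:
  fixes B :: "'x::{real_inner,complete_space} \<Rightarrow>\<^sub>L 'm"
    and B_at :: "real \<Rightarrow> ('x \<Rightarrow>\<^sub>L ('u \<Rightarrow>\<^sub>L real))"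
  assumes B_at: "\<And>\<xi>. AE t in M. repU' (B \<xi>) t = B_at t \<xi>"
  shows "inner (weak_integral M (\<lambda>t. I_iso (adjoint_to_dual (B_at t) (repU x t)))) \<xi> =
    dual_pairing (B \<xi>) x"
proof -
  let ?g = "\<lambda>t. I_iso (adjoint_to_dual (B_at t) (repU x t))"
  have AE: "AE t in M. repU' (B \<xi>) t (repU x t) = inner (?g t) \<xi>" for \<xi>
    using B_at[of \<xi>] by eventually_elim (simp add: inner_I_iso_adjoint_to_dual del: inner_I_iso)
  have int: "integrable M (\<lambda>t. inner (?g t) \<xi>)" for \<xi>
    using integrable_time_cong_AE[OF integrable_repU'_repU[OF square_integrable_repU] AE] .
  have eq: "(\<integral>t. inner (?g t) \<xi> \<partial>M) = dual_pairing (B \<xi>) x" for \<xi>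
    unfolding pairing_def by (rule integral_time_cong_AE[symmetric]) (rule AE)
  have "bounded_linear (\<lambda>\<xi>. dual_pairing (B \<xi>) x)"
    unfolding pairing_eq_inner
    by (intro bounded_linear_compose[OF bounded_linear_inner_left]
        bounded_linear_compose[OF primal_bounded_linear] blinfun.bounded_linear_right)
  then obtain x0 where x0: "\<And>\<xi>. inner x0 \<xi> = dual_pairing (B \<xi>) x"
    by (rule riesz_representation) blast
  have "\<forall>\<xi>. integrable M (\<lambda>t. inner (?g t) \<xi>) \<and>
      inner (weak_integral M ?g) \<xi> = (\<integral>t. inner (?g t) \<xi> \<partial>M)"
    unfolding weak_integral_def
  proof (rule theI[of _ x0])
    show "\<forall>\<xi>. integrable M (\<lambda>t. inner (?g t) \<xi>) \<and> inner x0 \<xi> = (\<integral>t. inner (?g t) \<xi> \<partial>M)"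
      using int eq x0 by simp
    fix z assume "\<forall>\<xi>. integrable M (\<lambda>t. inner (?g t) \<xi>) \<and> inner z \<xi> = (\<integral>t. inner (?g t) \<xi> \<partial>M)"
    then have "\<forall>\<xi>. inner z \<xi> = inner x0 \<xi>" using eq x0 by simp
    then show "z = x0" by (simp add: vector_eq_rdot)
  qed
  then show ?thesis using eq by simp
qed

text \<open>Test the adjoint equation with a solution \<open>p\<close> of the linearised equation and integrate by parts. The
operators \<open>fu1\<close> and \<open>fu\<close> may differ, which is where the error of the approximate adjoint comes from.\<close>

lemma duality_of_linearised_and_adjoint_state:
  fixes fu fu1 :: "'l \<Rightarrow>\<^sub>L 'm"
  assumes state: "dt p + w + fu (emb p) = 0"
    and adj: "- dt z + dual_adjoint dual_pairing fu1 (emb z) = dual v" "ev z T = 0"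
  shows "inner v (emb p) =
    inner (ev z 0) (ev p 0) - dual_pairing w (emb z) + dual_pairing ((fu1 - fu) (emb p)) (emb z)"
proof -
  have "inner v (emb p) = dual_pairing (dual v) (emb p)" by (simp add: pairing_dual)
  also have "\<dots> = - dual_pairing (dt z) (emb p) + dual_pairing (fu1 (emb p)) (emb z)"
    unfolding adj(1)[symmetric]
    by (simp add: pairing_diff_left pairing_dual_adjoint[OF blinfun.bounded_linear_right])
  also have "- dual_pairing (dt z) (emb p) = dual_pairing (dt p) (emb z) + inner (ev z 0) (ev p 0)"
    using integration_by_parts[of z p] adj(2) by simp
  also have "dt p = - w - fu (emb p)"
    using state by (simp add: eq_neg_iff_add_eq_0 algebra_simps)
  finally show ?thesis
    by (simp add: pairing_diff_left pairing_minus_left blinfun.diff_left)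
qed

text \<open>In the difference of \<open>(v, p)\<close> and \<open>(g, \<xi>)\<close>, where \<open>p = S' \<xi>\<close>, only differences of the partial
derivatives at the two states survive, paired with the computed adjoint state \<open>z\<close>. The stability
estimate bounds \<open>z\<close> by \<open>C \<parallel>v\<parallel>\<close>. The same estimate, used for the adjoint equation with right-hand
side \<open>p\<close>, bounds \<open>p\<close> by duality; this yields the factor \<open>(\<Lambda> + \<parallel>A\<parallel>) C\<close>.\<close>

lemma approximate_adjoint_error:
  fixes A :: "'x::{real_inner,complete_space} \<Rightarrow>\<^sub>L 'h"
    and fu fu1 :: "'l \<Rightarrow>\<^sub>L 'm" and f\<theta> f\<theta>1 :: "'x \<Rightarrow>\<^sub>L 'm"
    and f\<theta>_at :: "real \<Rightarrow> ('x \<Rightarrow>\<^sub>L ('u \<Rightarrow>\<^sub>L real))"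
  assumes state: "\<And>\<xi>. dt (S' \<xi>) + f\<theta> \<xi> + fu (emb (S' \<xi>)) = 0" "\<And>\<xi>. ev (S' \<xi>) 0 = A \<xi>"
    and stable: "\<And>h. \<exists>z. - dt z + dual_adjoint dual_pairing fu (emb z) = h \<and> ev z T = 0 \<and>
      norm (emb z) + norm (ev z 0) \<le> C * norm h"
    and f\<theta>_at: "\<And>\<xi>. AE t in M. repU' (f\<theta>1 \<xi>) t = f\<theta>_at t \<xi>"
    and adj: "- dt z + dual_adjoint dual_pairing fu1 (emb z) = dual v" "ev z T = 0"
      "norm (emb z) + norm (ev z 0) \<le> C * norm v"
    and g: "g = - weak_integral M (\<lambda>t. I_iso (adjoint_to_dual (f\<theta>_at t) (repU (emb z) t)))
      + I_iso (adjoint_from_pivot A (ev z 0))"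
    and close: "norm (f\<theta>1 - f\<theta>) + norm (fu1 - fu) \<le> \<delta>"
    and \<Lambda>: "norm f\<theta> \<le> \<Lambda>" and C: "0 \<le> C"
  shows "\<bar>inner v (emb (S' \<xi>)) - inner g \<xi>\<bar> \<le>
    \<delta> * C * onorm (I_iso :: ('x \<Rightarrow>\<^sub>L real) \<Rightarrow> 'x) * onorm (D_iso :: 'u \<Rightarrow> ('u \<Rightarrow>\<^sub>L real)) *
      (\<Lambda> * C + 1 + norm A * C) * norm v * norm \<xi>"
proof -
  let ?p = "emb (S' \<xi>)" and ?K = "(\<Lambda> + norm A) * C"
  have \<Lambda>0: "0 \<le> \<Lambda>" using \<Lambda> norm_ge_zero order_trans by blast
  have K0: "0 \<le> ?K" using \<Lambda>0 C by simp
  \<comment> \<open>Duality with the adjoint state for the right-hand side \<open>?p\<close>.\<close>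
  have p_le: "norm ?p \<le> ?K * norm \<xi>"
  proof (cases "?p = 0")
    case False
    obtain z' where z': "- dt z' + dual_adjoint dual_pairing fu (emb z') = dual ?p" "ev z' T = 0"
      "norm (emb z') + norm (ev z' 0) \<le> C * norm ?p"
      using stable[of "dual ?p"] by auto
    have z'_le: "norm (emb z') \<le> C * norm ?p" "norm (ev z' 0) \<le> C * norm ?p"
      using z'(3) norm_ge_zero[of "emb z'"] norm_ge_zero[of "ev z' 0"] by linarith+
    have "norm ?p * norm ?p = inner ?p ?p" by (simp add: dot_square_norm power2_eq_square)
    also have "\<dots> = inner (ev z' 0) (A \<xi>) - dual_pairing (f\<theta> \<xi>) (emb z')"
      using duality_of_linearised_and_adjoint_state[OF state(1) z'(1,2), of \<xi>]
      by (simp add: state(2) pairing_eq_inner)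
    also have "\<dots> \<le> norm (ev z' 0) * norm (A \<xi>) + norm (f\<theta> \<xi>) * norm (emb z')"
      using norm_cauchy_schwarz[of "ev z' 0" "A \<xi>"] pairing_le[of "f\<theta> \<xi>" "emb z'"] by linarith
    also have "\<dots> \<le> (C * norm ?p) * (norm A * norm \<xi>) + (\<Lambda> * norm \<xi>) * (C * norm ?p)"
    proof (intro add_mono mult_mono z'_le norm_blinfun)
      show "norm (f\<theta> \<xi>) \<le> \<Lambda> * norm \<xi>"
        using norm_blinfun[of f\<theta> \<xi>] mult_right_mono[OF \<Lambda>, of "norm \<xi>"] by simp
    qed (use C \<Lambda>0 in auto)
    also have "\<dots> = (?K * norm \<xi>) * norm ?p" by (simp add: algebra_simps)
    finally show ?thesis using False by simp
  qed (use K0 in simp)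
  have z_le: "norm (emb z) \<le> C * norm v"
    using adj(3) norm_ge_zero[of "ev z 0"] by linarith
  have \<delta>0: "norm (f\<theta>1 - f\<theta>) \<le> \<delta>" "norm (fu1 - fu) \<le> \<delta>" "0 \<le> \<delta>"
    using close norm_ge_zero[of "f\<theta>1 - f\<theta>"] norm_ge_zero[of "fu1 - fu"] by linarith+
  have g_eq: "inner g \<xi> = - dual_pairing (f\<theta>1 \<xi>) (emb z) + inner (ev z 0) (A \<xi>)"
    unfolding g
    by (simp add: inner_diff_left inner_weak_integral_adjoint[OF f\<theta>_at] inner_I_iso_adjoint_from_pivot
        del: inner_I_iso)
  have "inner v ?p - inner g \<xi> =
      dual_pairing ((f\<theta>1 - f\<theta>) \<xi>) (emb z) + dual_pairing ((fu1 - fu) ?p) (emb z)"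
    unfolding duality_of_linearised_and_adjoint_state[OF state(1) adj(1,2)] g_eq state(2)
    by (simp add: blinfun.diff_left pairing_diff_left)
  also have "\<bar>\<dots>\<bar> \<le> norm ((f\<theta>1 - f\<theta>) \<xi>) * norm (emb z) + norm ((fu1 - fu) ?p) * norm (emb z)"
    by (intro order_trans[OF abs_triangle_ineq] add_mono pairing_le)
  also have "\<dots> \<le> (\<delta> * norm \<xi>) * (C * norm v) + (\<delta> * (?K * norm \<xi>)) * (C * norm v)"
  proof (intro add_mono mult_mono z_le)
    show "norm ((f\<theta>1 - f\<theta>) \<xi>) \<le> \<delta> * norm \<xi>"
      using norm_blinfun[of "f\<theta>1 - f\<theta>" \<xi>] mult_right_mono[OF \<delta>0(1), of "norm \<xi>"] by simp
    have "norm ((fu1 - fu) ?p) \<le> norm (fu1 - fu) * norm ?p" by (rule norm_blinfun)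
    also have "\<dots> \<le> \<delta> * (?K * norm \<xi>)" using \<delta>0 p_le by (intro mult_mono) auto
    finally show "norm ((fu1 - fu) ?p) \<le> \<delta> * (?K * norm \<xi>)" .
  qed (use C K0 \<delta>0 in auto)
  also have "\<dots> = \<delta> * C * (\<Lambda> * C + 1 + norm A * C) * norm v * norm \<xi>"
    by (simp add: algebra_simps)
  finally have bound: "\<bar>inner v ?p - inner g \<xi>\<bar> \<le> \<delta> * C * (\<Lambda> * C + 1 + norm A * C) * norm v * norm \<xi>" .
  show ?thesis
  proof (cases "v = 0 \<or> \<xi> = 0")
    case True
    then show ?thesis using bound by auto
  next
    case False
    then obtain u :: 'u where "u \<noteq> 0" using U_nontrivial by blast
    then have "1 * 1 \<le> onorm (I_iso :: ('x \<Rightarrow>\<^sub>L real) \<Rightarrow> 'x) * onorm (D_iso :: 'u \<Rightarrow> ('u \<Rightarrow>\<^sub>L real))"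
      using False by (intro mult_mono one_le_onorm_I_iso[of \<xi>] one_le_onorm_D_iso[of u]
          onorm_pos_le I_iso_bounded_linear) auto
    moreover have "0 \<le> \<delta> * C * (\<Lambda> * C + 1 + norm A * C) * norm v * norm \<xi>"
      using C \<Lambda>0 \<delta>0 by simp
    ultimately have "1 * (\<delta> * C * (\<Lambda> * C + 1 + norm A * C) * norm v * norm \<xi>) \<le>
        (onorm (I_iso :: ('x \<Rightarrow>\<^sub>L real) \<Rightarrow> 'x) * onorm (D_iso :: 'u \<Rightarrow> ('u \<Rightarrow>\<^sub>L real))) *
        (\<delta> * C * (\<Lambda> * C + 1 + norm A * C) * norm v * norm \<xi>)"
      by (intro mult_right_mono) simp_all
    with bound show ?thesis by (simp add: mult_ac)
  qed
qed

end

section \<open>Lower-level Landweber iteration\<close>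

text \<open>One step decreases the squared error by at least \<open>\<mu>\<close> times the squared residual, hence by the fraction
\<open>\<mu> / C\<^sup>2\<close> of the current squared error, which is at least that fraction of the final one. Summing the
\<open>K\<close> decrements gives the estimate. It serves twice: for large \<open>K\<close> it bounds the number of steps
by the squared initial error, and for \<open>K \<ge> 1\<close> it gives a contraction factor below \<open>1\<close>.\<close>

lemma landweber_state_error:
  fixes \<Phi> :: "'v::{real_inner,complete_space} \<Rightarrow> 'w::real_inner"
  assumes run: "landweber \<Phi> u K"
    and diff: "\<And>k. k < K \<Longrightarrow> \<Phi> differentiable (at (u k))"
    and M: "\<And>k. k < K \<Longrightarrow> onorm (frechet_derivative \<Phi> (at (u k))) \<le> M"
    and cone: "\<And>k. k < K \<Longrightarrow>
      2 * inner (\<Phi> (u k)) (frechet_derivative \<Phi> (at (u k)) (u k - us)) \<ge> (M\<^sup>2 + \<mu>) * (norm (\<Phi> (u k)))\<^sup>2"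
    and coercive: "\<And>k. k < K \<Longrightarrow> C * norm (\<Phi> (u k)) \<ge> norm (u k - us)"
    and pos: "0 < C" "0 < \<mu>"
  shows "(1 + real K * (\<mu> / C\<^sup>2)) * (norm (u K - us))\<^sup>2 \<le> (norm (u 0 - us))\<^sup>2"
proof -
  define c where "c = \<mu> / C\<^sup>2"
  define a where "a k = (norm (u k - us))\<^sup>2" for k
  have c: "0 < c" using pos by (simp add: c_def)
  have step: "a (Suc k) \<le> a k - c * a k" if k: "k < K" for k
  proof -
    let ?D = "frechet_derivative \<Phi> (at (u k))"
    let ?g = "adjoint ?D (\<Phi> (u k))"
    have D: "bounded_linear ?D"
      using diff[OF k] frechet_derivative_works has_derivative_bounded_linear by blast
    have "u (Suc k) - us = (u k - us) - ?g"
      using run k by (simp add: landweber_def)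
    then have "a (Suc k) = a k - 2 * inner (u k - us) ?g + (norm ?g)\<^sup>2"
      by (simp add: a_def power2_norm_eq_inner inner_simps inner_commute)
    also have "inner (u k - us) ?g = inner (\<Phi> (u k)) (?D (u k - us))"
      by (metis adjoint_inner[OF D] inner_commute)
    also have "(norm ?g)\<^sup>2 \<le> (M * norm (\<Phi> (u k)))\<^sup>2"
      by (intro power_mono norm_adjoint_le D M k) simp
    finally have "a (Suc k) \<le> a k - \<mu> * (norm (\<Phi> (u k)))\<^sup>2"
      using cone[OF k] by (simp add: power_mult_distrib algebra_simps)
    moreover have "a k \<le> C\<^sup>2 * (norm (\<Phi> (u k)))\<^sup>2"
      using power_mono[OF coercive[OF k], of 2] by (simp add: a_def power_mult_distrib)
    then have "c * a k \<le> \<mu> * (norm (\<Phi> (u k)))\<^sup>2"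
      using mult_left_mono[of "a k" "C\<^sup>2 * (norm (\<Phi> (u k)))\<^sup>2" c] c pos by (simp add: c_def)
    ultimately show ?thesis by simp
  qed
  have a0: "0 \<le> a k" for k by (simp add: a_def)
  have mono: "a K \<le> a k" if "k \<le> K" for k
    using that
  proof (induction rule: inc_induct)
    case (step n)
    have "0 \<le> c * a n" using c a0 by simp
    then show ?case using \<open>a K \<le> a (Suc n)\<close> \<open>\<And>k. k < K \<Longrightarrow> a (Suc k) \<le> a k - c * a k\<close>[of n] step by linarith
  qed simp
  have "a k + real k * (c * a K) \<le> a 0" if "k \<le> K" for k
    using that
  proof (induction k)
    case (Suc k)
    have "c * a K \<le> c * a k" using mono[of k] Suc.prems c by (intro mult_left_mono) auto
    then show ?case using step[of k] Suc by (simp add: distrib_right)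
  qed simp
  from this[of K] show ?thesis by (simp add: a_def c_def algebra_simps)
qed

section \<open>Warm starts\<close>

text \<open>In the sequential algorithm \<open>b j\<close> is the final error in the \<open>j\<close>-th lower level and \<open>\<delta> j\<close> the shift of the
target between two levels.\<close>

lemma contraction_with_vanishing_perturbation:
  fixes b \<delta> :: "nat \<Rightarrow> real"
  assumes step: "\<And>j. b (Suc j) \<le> q * (b j + \<delta> j)" and q: "0 \<le> q" "q < 1"
    and \<delta>: "\<delta> \<longlonglongrightarrow> 0" and b: "\<And>j. 0 \<le> b j"
  shows "b \<longlonglongrightarrow> 0"
proof (rule LIMSEQ_I)
  fix e :: real assume "0 < e"
  \<comment> \<open>Perturbations below \<open>d\<close> accumulate to at most \<open>q d / (1 - q) \<le> e / 2\<close>.\<close>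
  define d where "d = e * (1 - q) / 2"
  have d: "0 < d" using \<open>0 < e\<close> q by (simp add: d_def)
  obtain n where n: "\<And>j. n \<le> j \<Longrightarrow> norm (\<delta> j - 0) < d" using LIMSEQ_D[OF \<delta> d] by blast
  have bound: "b (n + m) \<le> q ^ m * b n + e / 2" for m
  proof (induction m)
    case (Suc m)
    have "b (n + Suc m) \<le> q * (b (n + m) + \<delta> (n + m))" using step[of "n + m"] by simp
    also have "\<dots> \<le> q * ((q ^ m * b n + e / 2) + d)"
      using Suc n[of "n + m"] q by (intro mult_left_mono add_mono) auto
    also have "\<dots> = q ^ Suc m * b n + q * (e / 2 + d)" by (simp add: algebra_simps)
    also have "q * (e / 2 + d) \<le> e / 2"
    proof -
      have "q * d \<le> d" using d q by (simp add: mult_left_le_one_le)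
      then show ?thesis by (simp add: d_def algebra_simps)
    qed
    finally show ?case by simp
  qed (use \<open>0 < e\<close> in simp)
  have "(\<lambda>m. q ^ m * b n) \<longlonglongrightarrow> 0"
    using LIMSEQ_power_zero[of q] q by (intro tendsto_mult_left_zero) simp
  then obtain k where k: "\<And>m. k \<le> m \<Longrightarrow> norm (q ^ m * b n - 0) < e / 2"
    using LIMSEQ_D[of _ 0 "e / 2"] \<open>0 < e\<close> by (metis half_gt_zero)
  have "norm (b j - 0) < e" if "n + k \<le> j" for j
  proof -
    have "k \<le> j - n" "n + (j - n) = j" using that by simp_all
    then have "b j < e" using bound[of "j - n"] k[of "j - n"] by simp
    then show ?thesis using b[of j] by simp
  qed
  then show "\<exists>n0. \<forall>j\<ge>n0. norm (b j - 0) < e" by blast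
qed

section \<open>Upper-level iteration with an inexact adjoint\<close>

text \<open>Here \<open>r\<close> is the residual \<open>G \<theta> - y\<close> of the exact reduced model, \<open>d\<close> the contribution of the state error,
\<open>q\<close> the derivative of \<open>G\<close> in the direction \<open>e = \<theta> - \<theta>\<^sup>\<dagger>\<close>, and \<open>g\<close> the inexact gradient. The tangential cone
condition turns \<open>(r, q)\<close> into a negative multiple of \<open>\<parallel>r\<parallel>\<^sup>2\<close>. All other terms carry a factor
\<open>l \<epsilon>\<close>, except \<open>\<parallel>g\<parallel>\<^sup>2\<close>; Young's inequality with weights \<open>\<eta>\<close> and \<open>\<mu> - \<sigma>\<close> separates the residual from
the state error.\<close>

lemma inexact_adjoint_step:
  fixes e g :: "'x::real_inner" and r d q :: "'y::real_inner"
  assumes adj: "\<bar>inner (r + d) q - inner g e\<bar> \<le> C * \<epsilon> * l * norm (r + d) * R"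
    and g: "norm g \<le> Mt * norm (r + d)"
    and cone: "(MR\<^sup>2 + \<mu>) * (norm r)\<^sup>2 \<le> 2 * inner r q"
    and q: "norm q \<le> K * norm r"
    and d: "norm d \<le> l * \<epsilon>"
    and pos: "0 \<le> C" "0 \<le> R" "0 \<le> l" "0 \<le> \<epsilon>" "0 \<le> K" "0 < \<eta>" "\<sigma> < \<mu>"
  shows "(norm (e - g))\<^sup>2 \<le> (norm e)\<^sup>2 - (\<sigma> / 2 + (MR\<^sup>2 + \<mu> / 2 - (1 + \<eta>) * Mt\<^sup>2)) * (norm r)\<^sup>2 +
    l\<^sup>2 * (2 * (K + C * R)\<^sup>2 / (\<mu> - \<sigma>) + (1 + 1 / \<eta>) * Mt\<^sup>2 + 2 * C * R) * \<epsilon>\<^sup>2"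
proof -
  define \<rho> where "\<rho> = norm r"
  define \<zeta> where "\<zeta> = l * \<epsilon>"
  define P where "P = K + C * R"
  have \<rho>0: "0 \<le> \<rho>" and \<zeta>0: "0 \<le> \<zeta>" and P0: "0 \<le> P" using pos by (simp_all add: \<rho>_def \<zeta>_def P_def)
  have rd: "norm (r + d) \<le> \<rho> + \<zeta>"
    using norm_triangle_ineq[of r d] d by (simp add: \<rho>_def \<zeta>_def)
  have expand: "(norm (e - g))\<^sup>2 = (norm e)\<^sup>2 - 2 * inner g e + (norm g)\<^sup>2"
    by (simp add: power2_norm_eq_inner inner_simps inner_commute)
  have dq: "\<bar>inner d q\<bar> \<le> \<zeta> * (K * \<rho>)"
    using Cauchy_Schwarz_ineq2[of d q] mult_mono[OF d q] pos by (simp add: \<zeta>_def \<rho>_def)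
  have "C * \<epsilon> * l * norm (r + d) * R \<le> C * \<epsilon> * l * (\<rho> + \<zeta>) * R"
    using rd pos by (intro mult_right_mono mult_left_mono) auto
  then have ge: "inner r q + inner d q - C * R * \<zeta> * (\<rho> + \<zeta>) \<le> inner g e"
    using adj by (simp add: inner_add_left abs_le_iff \<zeta>_def mult_ac)
  have "(norm g)\<^sup>2 \<le> (Mt * norm (r + d))\<^sup>2" by (rule power_mono[OF g]) simp
  also have "\<dots> = Mt\<^sup>2 * (norm (r + d))\<^sup>2" by (simp add: power_mult_distrib)
  also have "\<dots> \<le> Mt\<^sup>2 * (\<rho> + \<zeta>)\<^sup>2" using rd by (intro mult_left_mono power_mono) auto
  also have "\<dots> \<le> Mt\<^sup>2 * ((1 + \<eta>) * \<rho>\<^sup>2 + (1 + 1 / \<eta>) * \<zeta>\<^sup>2)"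
  proof (intro mult_left_mono)
    have "0 \<le> (\<eta> * \<rho> - \<zeta>)\<^sup>2 / \<eta>" using pos by simp
    also have "\<dots> = \<eta> * \<rho>\<^sup>2 - 2 * \<rho> * \<zeta> + \<zeta>\<^sup>2 / \<eta>"
      using pos by (simp add: power2_eq_square field_simps)
    finally show "(\<rho> + \<zeta>)\<^sup>2 \<le> (1 + \<eta>) * \<rho>\<^sup>2 + (1 + 1 / \<eta>) * \<zeta>\<^sup>2"
      by (simp add: power2_sum algebra_simps)
  qed simp
  finally have g2: "(norm g)\<^sup>2 \<le> Mt\<^sup>2 * ((1 + \<eta>) * \<rho>\<^sup>2 + (1 + 1 / \<eta>) * \<zeta>\<^sup>2)" .
  \<comment> \<open>Completing the square \<open>((\<mu> - \<sigma>) \<rho> - 2 P \<zeta>)\<^sup>2 \<ge> 0\<close>.\<close>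
  have young: "2 * P * \<zeta> * \<rho> \<le> (\<mu> - \<sigma>) / 2 * \<rho>\<^sup>2 + 2 * P\<^sup>2 / (\<mu> - \<sigma>) * \<zeta>\<^sup>2"
  proof -
    have "0 \<le> ((\<mu> - \<sigma>) * \<rho> - 2 * P * \<zeta>)\<^sup>2 / (2 * (\<mu> - \<sigma>))" using pos by simp
    also have "\<dots> = (\<mu> - \<sigma>) / 2 * \<rho>\<^sup>2 - 2 * P * \<zeta> * \<rho> + 2 * P\<^sup>2 / (\<mu> - \<sigma>) * \<zeta>\<^sup>2"
      using pos by (simp add: power2_eq_square divide_simps) (simp add: algebra_simps)
    finally show ?thesis by simp
  qed
  have "(norm (e - g))\<^sup>2 \<le> (norm e)\<^sup>2 - (MR\<^sup>2 + \<mu>) * \<rho>\<^sup>2 + 2 * (\<zeta> * (K * \<rho>)) + 2 * (C * R * \<zeta> * (\<rho> + \<zeta>))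
      + Mt\<^sup>2 * ((1 + \<eta>) * \<rho>\<^sup>2 + (1 + 1 / \<eta>) * \<zeta>\<^sup>2)"
    using expand ge g2 cone dq by (simp add: \<rho>_def abs_le_iff)
  also have "\<dots> = (norm e)\<^sup>2 - (MR\<^sup>2 + \<mu>) * \<rho>\<^sup>2 + 2 * P * \<zeta> * \<rho> + 2 * C * R * \<zeta>\<^sup>2
      + (1 + \<eta>) * Mt\<^sup>2 * \<rho>\<^sup>2 + (1 + 1 / \<eta>) * Mt\<^sup>2 * \<zeta>\<^sup>2"
    by (simp add: P_def power2_eq_square algebra_simps)
  also have "\<dots> \<le> (norm e)\<^sup>2 - (MR\<^sup>2 + \<mu>) * \<rho>\<^sup>2 + ((\<mu> - \<sigma>) / 2 * \<rho>\<^sup>2 + 2 * P\<^sup>2 / (\<mu> - \<sigma>) * \<zeta>\<^sup>2)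
      + 2 * C * R * \<zeta>\<^sup>2 + (1 + \<eta>) * Mt\<^sup>2 * \<rho>\<^sup>2 + (1 + 1 / \<eta>) * Mt\<^sup>2 * \<zeta>\<^sup>2"
    using young by simp
  also have "\<dots> = (norm e)\<^sup>2 - (\<sigma> / 2 + (MR\<^sup>2 + \<mu> / 2 - (1 + \<eta>) * Mt\<^sup>2)) * \<rho>\<^sup>2 +
      (2 * P\<^sup>2 / (\<mu> - \<sigma>) + (1 + 1 / \<eta>) * Mt\<^sup>2 + 2 * C * R) * \<zeta>\<^sup>2"
    by (simp add: field_simps)
  finally show ?thesis by (simp add: \<rho>_def \<zeta>_def P_def power_mult_distrib mult_ac)
qed

text \<open>The induction that keeps the iterates in the ball is simultaneous with the descent, which is available
only inside the ball; the accumulated perturbations never exceed the room left at the start.\<close>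

lemma perturbed_descent:
  fixes a \<rho> c :: "nat \<Rightarrow> real"
  assumes step: "\<And>j. a j \<le> B \<Longrightarrow> a (Suc j) \<le> a j - s * \<rho> j + c j"
    and start: "a 0 + (\<Sum>j. c j) \<le> B"
    and c: "summable c" "\<And>j. 0 \<le> c j"
    and pos: "0 < s" "\<And>j. 0 \<le> \<rho> j" "\<And>j. 0 \<le> a j"
  shows "a j \<le> B" "\<rho> \<longlonglongrightarrow> 0"
proof -
  have inv: "a j + s * (\<Sum>i<j. \<rho> i) \<le> a 0 + (\<Sum>i<j. c i) \<and> a j \<le> B" for j
  proof (induction j)
    case 0
    then show ?case using start suminf_nonneg[OF c] by simp
  next
    case (Suc j)
    then have 1: "a (Suc j) + s * (\<Sum>i<Suc j. \<rho> i) \<le> a 0 + (\<Sum>i<Suc j. c i)"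
      using step[of j] by (simp add: distrib_left)
    moreover have "(\<Sum>i<Suc j. c i) \<le> (\<Sum>j. c j)" using c by (intro sum_le_suminf) auto
    moreover have "0 \<le> s * (\<Sum>i<Suc j. \<rho> i)" using pos by (intro mult_nonneg_nonneg sum_nonneg) auto
    ultimately show ?case using start by linarith
  qed
  then show "a j \<le> B" by blast
  have "(\<Sum>i<j. \<rho> i) \<le> B / s" for j
  proof -
    have "(\<Sum>i<j. c i) \<le> (\<Sum>j. c j)" using c by (intro sum_le_suminf) auto
    then have "s * (\<Sum>i<j. \<rho> i) \<le> B" using inv[of j] start pos(3)[of j] by linarith
    then show ?thesis using pos by (simp add: pos_le_divide_eq mult.commute)
  qed
  then have "summable \<rho>" using pos(2) by (intro summableI_nonneg_bounded[where x="B / s"]) auto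
  then show "\<rho> \<longlonglongrightarrow> 0" by (rule summable_LIMSEQ_zero)
qed

section \<open>Iteration counts of the two algorithms\<close>

theorem theorem5:
  fixes T :: real
    and \<iota> :: "'u::{real_inner,complete_space} \<Rightarrow>\<^sub>L 'h::{real_inner,complete_space}"
    and repU :: "'l::{real_inner,complete_space} \<Rightarrow> real \<Rightarrow> 'u"
    and repU' :: "'m::{real_inner,complete_space} \<Rightarrow> real \<Rightarrow> ('u \<Rightarrow>\<^sub>L real)"
    and emb :: "'v::{real_inner,complete_space} \<Rightarrow>\<^sub>L 'l"
    and dt :: "'v \<Rightarrow>\<^sub>L 'm"
    and ev :: "'v \<Rightarrow> real \<Rightarrow> 'h"
    and A :: "'x::{real_inner,complete_space} \<Rightarrow>\<^sub>L 'h"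
    and L :: "'l \<Rightarrow>\<^sub>L 'y::{real_inner,complete_space}"
    and f :: "real \<Rightarrow> 'x \<Rightarrow> 'u \<Rightarrow> ('u \<Rightarrow>\<^sub>L real)"
    and f\<theta>_at :: "'x \<Rightarrow> 'v \<Rightarrow> real \<Rightarrow> ('x \<Rightarrow>\<^sub>L ('u \<Rightarrow>\<^sub>L real))"
    and f\<theta> :: "'x \<Rightarrow> 'v \<Rightarrow> ('x \<Rightarrow>\<^sub>L 'm)"
    and fu :: "'x \<Rightarrow> 'v \<Rightarrow> ('l \<Rightarrow>\<^sub>L 'm)"
    and S :: "'x \<Rightarrow> 'v"
    and \<theta>d :: 'x
    and R r MSbar MS Cfu Lf Ccoe Mr \<mu>r MR \<mu>R KR \<epsilon>bar \<eta> \<sigma> \<nu> :: real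
  defines "N \<equiv> \<lambda>\<theta> u. L2_class T repU' (\<lambda>t. f t \<theta> (repU (emb u) t))"
  defines "F \<equiv> \<lambda>\<theta> u. (dt u + N \<theta> u, ev u 0 - A \<theta>)"
  defines "G \<equiv> \<lambda>\<theta>. L (emb (S \<theta>))"
  defines "S' \<equiv> \<lambda>\<theta>. frechet_derivative S (at \<theta>)"
  defines "G' \<equiv> \<lambda>\<theta>. frechet_derivative G (at \<theta>)"
  defines "F' \<equiv> \<lambda>\<theta> u. frechet_derivative (F \<theta>) (at u)"
  defines "ud \<equiv> S \<theta>d"
  defines "y \<equiv> G \<theta>d"
  defines "adjoint_sol \<equiv> \<lambda>\<theta> u h z.
      - dt z + dual_adjoint (pairing T repU repU') (fu \<theta> u) (emb z) = h \<and> ev z T = 0 \<and>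
      norm (emb z) + norm (ev z 0) \<le> Cfu * norm h"
  defines "Adj \<equiv> \<lambda>\<theta> u v g. \<exists>z.
      adjoint_sol \<theta> u (L2_class T repU' (\<lambda>t. D_iso (repU v t))) z \<and>
      g = - weak_integral (time_measure T)
              (\<lambda>t. I_iso (adjoint_to_dual (f\<theta>_at \<theta> u t) (repU (emb z) t)))
          + I_iso (adjoint_from_pivot A (ev z 0))"
  defines "LRr \<equiv> Lf * (R + r * norm emb) + norm (f\<theta> \<theta>d ud) + norm (fu \<theta>d ud)"
  defines "CfA \<equiv> Lf * Cfu * onorm (I_iso :: ('x \<Rightarrow>\<^sub>L real) \<Rightarrow> 'x) *
      onorm (D_iso :: 'u \<Rightarrow> ('u \<Rightarrow>\<^sub>L real)) * (LRr * Cfu + 1 + norm A * Cfu)"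
  defines "MRtilde \<equiv> (MS + CfA * \<epsilon>bar) * norm L"
  defines "Cpri \<equiv> (norm L)\<^sup>2 *
      (2 * (KR + CfA * R)\<^sup>2 / (\<mu>R - \<sigma>) + (1 + 1 / \<eta>) * MRtilde\<^sup>2 + 2 * CfA * R)"
  defines "Cpos \<equiv> sqrt (Cpri / (\<sigma> / 2 - \<nu>))"
  defines "\<epsilon> \<equiv> state_error S emb"
  defines "rule_a \<equiv> \<lambda>\<theta> u \<kappa>. 0 \<le> \<sigma> \<and> \<sigma> < \<mu>R \<and>
      (\<exists>R0. norm (\<theta> 0 - \<theta>d) \<le> R0 \<and> R0 < R \<and>
            summable (\<lambda>j. (\<epsilon> \<theta> u \<kappa> j)\<^sup>2) \<and> Cpri * (\<Sum>j. (\<epsilon> \<theta> u \<kappa> j)\<^sup>2) \<le> R\<^sup>2 - R0\<^sup>2)"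
  defines "rule_b \<equiv> \<lambda>\<theta> u \<kappa>. 0 < \<nu> \<and> \<nu> < \<sigma> / 2 \<and> \<sigma> < \<mu>R \<and>
      (\<forall>j. Cpos * \<epsilon> \<theta> u \<kappa> j \<le> norm (G (\<theta> j) - y))"
  defines "admissible \<equiv> \<lambda>\<theta> u \<kappa>. \<theta> 0 \<in> cball \<theta>d R \<and>
      (\<forall>j k. k \<le> \<kappa> j \<longrightarrow> \<theta> j \<in> cball \<theta>d R \<longrightarrow> u j k \<in> cball ud r) \<and>
      (\<forall>j. \<epsilon> \<theta> u \<kappa> j \<le> \<epsilon>bar) \<and>
      (rule_a \<theta> u \<kappa> \<or> rule_b \<theta> u \<kappa>)"
  assumes T_pos: "0 < T"
    and triple: "gelfand_triple \<iota>"
    and space_U: "is_L2 T repU"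
    and space_U': "is_L2 T repU'"
    and space_V: "is_solution_space T \<iota> repU repU' emb dt"
    and V_in_C: "is_continuous_embedding T \<iota> repU emb ev"
    and f_car: "caratheodory T f"
    and f_induces: "\<And>\<theta> u. square_integrable T (\<lambda>t. f t \<theta> (repU (emb u) t))"
    and f\<theta>_deriv: "\<And>\<theta> u. ((\<lambda>\<theta>. N \<theta> u) has_derivative f\<theta> \<theta> u) (at \<theta>)"
    and f\<theta>_at: "\<And>\<theta> u \<xi>. AE t in time_measure T. repU' (f\<theta> \<theta> u \<xi>) t = f\<theta>_at \<theta> u t \<xi>"
    and fu_deriv: "\<And>\<theta> u. (N \<theta> has_derivative (\<lambda>v. fu \<theta> u (emb v))) (at u)"
    and S_solves: "\<And>\<theta>. F \<theta> (S \<theta>) = 0"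
    and S_diff: "\<And>\<theta>. S differentiable (at \<theta>)"
    and S_ball: "\<And>\<theta>. \<theta> \<in> cball \<theta>d R \<Longrightarrow> S \<theta> \<in> cball ud r"
    and radii: "0 < R" "0 < r"
    and positive: "0 < MSbar" "0 < MS" "0 < Cfu" "0 < Lf" "0 < Ccoe" "0 < Mr" "0 < \<mu>r"
      "0 < MR" "0 < \<mu>R" "0 < KR"
    and Mr_\<mu>r: "Mr\<^sup>2 + \<mu>r < 2"
    and MR_\<mu>R: "MR\<^sup>2 + \<mu>R < 2"
    and A1: "\<And>\<theta>. \<theta> \<in> cball \<theta>d R \<Longrightarrow>
        onorm (S' \<theta>) \<le> MSbar \<and> onorm (\<lambda>\<xi>. emb (S' \<theta> \<xi>)) \<le> MS \<and> onorm (G' \<theta>) \<le> MR"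
    and A2: "\<And>\<theta> u h. \<theta> \<in> cball \<theta>d R \<Longrightarrow> u \<in> cball ud r \<Longrightarrow> \<exists>z. adjoint_sol \<theta> u h z"
    and A3: "\<And>\<theta> \<theta>1 u u1. \<theta> \<in> cball \<theta>d R \<Longrightarrow> \<theta>1 \<in> cball \<theta>d R \<Longrightarrow> u \<in> cball ud r \<Longrightarrow> u1 \<in> cball ud r \<Longrightarrow>
        norm (f\<theta> \<theta> u - f\<theta> \<theta>1 u1) + norm (fu \<theta> u - fu \<theta>1 u1)
          \<le> Lf * (norm (\<theta> - \<theta>1) + norm (emb u - emb u1))"
    and A4: "\<And>\<theta> u. \<theta> \<in> cball \<theta>d R \<Longrightarrow> u \<in> cball ud r \<Longrightarrow> onorm (F' \<theta> u) \<le> Mr"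
    and A5: "\<And>\<theta> u u1. \<theta> \<in> cball \<theta>d R \<Longrightarrow> u \<in> cball ud r \<Longrightarrow> u1 \<in> cball ud r \<Longrightarrow>
        2 * inner (F \<theta> u - F \<theta> u1) (F' \<theta> u (u - u1)) \<ge> (Mr\<^sup>2 + \<mu>r) * (norm (F \<theta> u - F \<theta> u1))\<^sup>2"
    and A6: "\<And>\<theta> u. \<theta> \<in> cball \<theta>d R \<Longrightarrow> u \<in> cball ud r \<Longrightarrow>
        Ccoe * norm (F \<theta> u - F \<theta> (S \<theta>)) \<ge> norm (u - S \<theta>)"
    and A7: "\<And>\<theta> \<theta>1. \<theta> \<in> cball \<theta>d R \<Longrightarrow> \<theta>1 \<in> cball \<theta>d R \<Longrightarrow>
        2 * inner (G \<theta> - G \<theta>1) (G' \<theta> (\<theta> - \<theta>1)) \<ge> (MR\<^sup>2 + \<mu>R) * (norm (G \<theta> - G \<theta>1))\<^sup>2 \<and>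
        norm (G' \<theta> (\<theta> - \<theta>1)) \<le> KR * norm (G \<theta> - G \<theta>1)"
    and \<eta>: "0 < \<eta>" "(1 + \<eta>) * MRtilde\<^sup>2 < MR\<^sup>2 + \<mu>R / 2"
  shows "(\<forall>\<theta> u \<kappa>. sequential_bilevel_run F S Adj L emb y r \<theta> u \<kappa> \<and> admissible \<theta> u \<kappa> \<longrightarrow>
           (\<lambda>j. real (\<kappa> j)) \<in> o[sequentially_nonzero (\<epsilon> \<theta> u \<kappa>)](\<lambda>j. 1 / (\<epsilon> \<theta> u \<kappa> j)\<^sup>2)) \<and>
         (\<forall>\<theta> u K. bilevel_run F S Adj L emb y r \<theta> u K \<and> admissible \<theta> u K \<longrightarrow>
           (\<lambda>j. real (K j)) \<in> O[sequentially_nonzero (\<epsilon> \<theta> u K)](\<lambda>j. 1 / (\<epsilon> \<theta> u K j)\<^sup>2))"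
proof -
  interpret gelfand_evolution T \<iota> repU repU' emb dt ev
    by unfold_locales fact+
  have ev0: "bounded_linear (\<lambda>v. ev v 0)" using T_pos by (intro ev_bounded_linear) simp
  have S_deriv: "(S has_derivative S' \<theta>) (at \<theta>)" for \<theta>
    unfolding S'_def using S_diff frechet_derivative_works by blast
  have embS_deriv: "((\<lambda>\<theta>. emb (S \<theta>)) has_derivative (\<lambda>\<xi>. emb (S' \<theta> \<xi>))) (at \<theta>)" for \<theta>
    by (rule bounded_linear.has_derivative[OF blinfun.bounded_linear_right S_deriv])
  have G'_eq: "G' \<theta> = (\<lambda>\<xi>. L (emb (S' \<theta> \<xi>)))" for \<theta>
    unfolding G'_def G_def
    by (rule frechet_derivative_at[symmetric])
      (rule bounded_linear.has_derivative[OF blinfun.bounded_linear_right embS_deriv])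
  have F_diff: "F \<theta> differentiable (at u)" for \<theta> u
  proof -
    have "(F \<theta> has_derivative (\<lambda>v. (dt v + fu \<theta> u (emb v), ev v 0 - 0))) (at u)"
      unfolding F_def
      by (rule has_derivative_Pair[OF has_derivative_add[OF
              bounded_linear_imp_has_derivative[OF blinfun.bounded_linear_right] fu_deriv]
            has_derivative_diff[OF bounded_linear_imp_has_derivative[OF ev0] has_derivative_const]])
    then show ?thesis unfolding differentiable_def by blast
  qed
  have state: "dt (S \<theta>) + N \<theta> (S \<theta>) = 0" "ev (S \<theta>) 0 = A \<theta>" for \<theta>
    using S_solves[of \<theta>] by (auto simp: F_def zero_prod_def)
  have center: "\<theta>d \<in> cball \<theta>d R" "ud \<in> cball ud r" using radii by auto
  have state_lin: "dt (S' \<theta> \<xi>) + f\<theta> \<theta> (S \<theta>) \<xi> + fu \<theta> (S \<theta>) (emb (S' \<theta> \<xi>)) = 0"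
    if \<theta>: "\<theta> \<in> cball \<theta>d R" for \<theta> \<xi>
  proof (rule linearised_state_equation[OF f\<theta>_deriv fu_deriv S_deriv state(1) \<theta> \<open>0 < R\<close>])
    show "0 \<le> Lf" using positive by simp
    fix \<theta>1 \<theta>2 assume "\<theta>1 \<in> cball \<theta>d R" "\<theta>2 \<in> cball \<theta>d R"
    from A3[OF this(1) \<theta> S_ball[OF this(2)] S_ball[OF \<theta>]] norm_ge_zero[of "fu \<theta>1 (S \<theta>2) - fu \<theta> (S \<theta>)"]
    show "norm (f\<theta> \<theta>1 (S \<theta>2) - f\<theta> \<theta> (S \<theta>)) \<le> Lf * (norm (\<theta>1 - \<theta>) + norm (emb (S \<theta>2) - emb (S \<theta>)))"
      by linarith
  qed
  have state_lin0: "ev (S' \<theta> \<xi>) 0 = A \<xi>" for \<theta> \<xi>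
  proof -
    have "((\<lambda>\<theta>. ev (S \<theta>) 0) has_derivative (\<lambda>\<xi>. ev (S' \<theta> \<xi>) 0)) (at \<theta>)"
      by (rule bounded_linear.has_derivative[OF ev0 S_deriv])
    moreover have "((\<lambda>\<theta>. ev (S \<theta>) 0) has_derivative A) (at \<theta>)"
      unfolding state(2) by (rule bounded_linear_imp_has_derivative[OF blinfun.bounded_linear_right])
    ultimately have "(\<lambda>\<xi>. ev (S' \<theta> \<xi>) 0) = A" by (rule has_derivative_unique)
    then show ?thesis by metis
  qed
  have f\<theta>_bound: "norm (f\<theta> \<theta> (S \<theta>)) \<le> LRr" if \<theta>: "\<theta> \<in> cball \<theta>d R" for \<theta>
  proof -
    have "norm (emb (S \<theta>) - emb ud) \<le> norm emb * norm (S \<theta> - ud)"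
      by (metis blinfun.diff_right norm_blinfun)
    also have "\<dots> \<le> norm emb * r"
      using S_ball[OF \<theta>] by (intro mult_left_mono) (auto simp: dist_norm norm_minus_commute)
    finally have "norm (\<theta> - \<theta>d) + norm (emb (S \<theta>) - emb ud) \<le> R + r * norm emb"
      using \<theta> by (simp add: dist_norm norm_minus_commute mult.commute)
    then have "Lf * (norm (\<theta> - \<theta>d) + norm (emb (S \<theta>) - emb ud)) \<le> Lf * (R + r * norm emb)"
      using positive by (intro mult_left_mono) auto
    moreover have "norm (f\<theta> \<theta> (S \<theta>)) \<le> norm (f\<theta> \<theta> (S \<theta>) - f\<theta> \<theta>d ud) + norm (f\<theta> \<theta>d ud)"
      by (metis diff_add_cancel norm_triangle_ineq)
    ultimately show ?thesis
      using A3[OF \<theta> center(1) S_ball[OF \<theta>] center(2)] norm_ge_zero[of "fu \<theta> (S \<theta>) - fu \<theta>d ud"]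
        norm_ge_zero[of "fu \<theta>d ud"]
      unfolding LRr_def by linarith
  qed
  have LRr0: "0 \<le> LRr" using f\<theta>_bound[OF center(1)] norm_ge_zero order_trans by blast
  have CfA0: "0 \<le> CfA"
    unfolding CfA_def using positive LRr0
    by (intro mult_nonneg_nonneg add_nonneg_nonneg onorm_pos_le I_iso_bounded_linear D_iso_bounded_linear) auto
  have adjoint_error: "\<bar>inner v (emb (S' \<theta> \<xi>)) - inner g \<xi>\<bar> \<le>
      CfA * norm (emb u - emb (S \<theta>)) * norm v * norm \<xi>"
    if \<theta>: "\<theta> \<in> cball \<theta>d R" and u: "u \<in> cball ud r" and Adj: "Adj \<theta> u v g" for \<theta> u v g \<xi>
  proof -
    have dual: "L2_class T repU' (\<lambda>t. D_iso (repU v t)) = dual v" by (simp add: dual_def)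
    obtain z where z: "adjoint_sol \<theta> u (dual v) z"
      and g: "g = - weak_integral M (\<lambda>t. I_iso (adjoint_to_dual (f\<theta>_at \<theta> u t) (repU (emb z) t)))
          + I_iso (adjoint_from_pivot A (ev z 0))"
      using Adj unfolding Adj_def dual by blast
    have "\<bar>inner v (emb (S' \<theta> \<xi>)) - inner g \<xi>\<bar> \<le> (Lf * norm (emb u - emb (S \<theta>))) * Cfu *
        onorm (I_iso :: ('x \<Rightarrow>\<^sub>L real) \<Rightarrow> 'x) * onorm (D_iso :: 'u \<Rightarrow> ('u \<Rightarrow>\<^sub>L real)) *
        (LRr * Cfu + 1 + norm A * Cfu) * norm v * norm \<xi>"
    proof (rule approximate_adjoint_error[OF state_lin[OF \<theta>] state_lin0 _ f\<theta>_at _ _ _ g])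
      show "\<exists>z. - dt z + dual_adjoint dual_pairing (fu \<theta> (S \<theta>)) (emb z) = h \<and> ev z T = 0 \<and>
          norm (emb z) + norm (ev z 0) \<le> Cfu * norm h" for h
        using A2[OF \<theta> S_ball[OF \<theta>]] unfolding adjoint_sol_def .
      show "- dt z + dual_adjoint dual_pairing (fu \<theta> u) (emb z) = dual v" "ev z T = 0"
        "norm (emb z) + norm (ev z 0) \<le> Cfu * norm v"
        using z unfolding adjoint_sol_def by auto
      show "norm (f\<theta> \<theta> u - f\<theta> \<theta> (S \<theta>)) + norm (fu \<theta> u - fu \<theta> (S \<theta>)) \<le> Lf * norm (emb u - emb (S \<theta>))"
        using A3[OF \<theta> \<theta> u S_ball[OF \<theta>]] by simp
    qed (use f\<theta>_bound[OF \<theta>] positive in auto)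
    then show ?thesis by (simp add: CfA_def mult_ac)
  qed
  have L_adj: "inner (adjoint L w) v = inner w (L v)" "norm (adjoint L w) \<le> norm L * norm w" for w v
  proof -
    show "inner (adjoint L w) v = inner w (L v)"
      by (metis adjoint_inner[OF blinfun.bounded_linear_right] inner_commute)
    show "norm (adjoint L w) \<le> norm L * norm w"
      by (rule norm_adjoint_le[OF blinfun.bounded_linear_right]) (simp add: norm_blinfun.rep_eq)
  qed
  define c where "c = \<mu>r / Ccoe\<^sup>2"
  \<comment> \<open>The slack in the choice of \<open>\<eta>\<close>. It makes the residuals square summable even under rule (a) with
    \<open>\<sigma> = 0\<close>.\<close>
  define s where "s = MR\<^sup>2 + \<mu>R / 2 - (1 + \<eta>) * MRtilde\<^sup>2"
  have c: "0 < c" and s: "0 < s" using positive \<eta> by (simp_all add: c_def s_def)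

  \<comment> \<open>Common to both algorithms: the parameters stay in the ball, so that the assumptions apply at every
    level; each lower level reduces the state error; and consecutive parameters approach each other.\<close>
  have run_facts: "\<theta> j \<in> cball \<theta>d R"
      "(1 + real (\<kappa> j) * c) * (norm (u j (\<kappa> j) - S (\<theta> j)))\<^sup>2 \<le> (norm (u j 0 - S (\<theta> j)))\<^sup>2"
      "(\<lambda>j. norm (\<theta> (Suc j) - \<theta> j)) \<longlonglongrightarrow> 0"
    if run: "bilevel_run F S Adj L emb y r \<theta> u \<kappa>" and adm: "admissible \<theta> u \<kappa>" for \<theta> u \<kappa> j
  proof -
    let ?\<epsilon> = "\<epsilon> \<theta> u \<kappa>"
    define a where "a j = (norm (\<theta> j - \<theta>d))\<^sup>2" for j
    define \<rho> where "\<rho> j = norm (G (\<theta> j) - y)" for j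
    define g where "g j = \<theta> j - \<theta> (Suc j)" for j
    define w where "w j = L (emb (u j (\<kappa> j))) - y" for j
    define d where "d j = L (emb (u j (\<kappa> j)) - emb (S (\<theta> j)))" for j
    have a0: "0 \<le> a j" for j by (simp add: a_def)
    have ball: "\<theta> j \<in> cball \<theta>d R \<longleftrightarrow> a j \<le> R\<^sup>2" for j
      using radii abs_le_square_iff[of "norm (\<theta> j - \<theta>d)" R]
      by (simp add: a_def dist_norm norm_minus_commute)
    have u_ball: "u j k \<in> cball ud r" if "k \<le> \<kappa> j" "\<theta> j \<in> cball \<theta>d R" for j k
      using adm that unfolding admissible_def by blast
    have \<epsilon>_eq: "?\<epsilon> j = norm (emb (u j (\<kappa> j)) - emb (S (\<theta> j)))" for j
      by (simp add: \<epsilon>_def state_error_def)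
    have \<epsilon>0: "0 \<le> ?\<epsilon> j" for j by (simp add: \<epsilon>_eq)
    have \<epsilon>_le: "?\<epsilon> j \<le> \<epsilon>bar" for j using adm unfolding admissible_def by blast
    have w_eq: "w j = (G (\<theta> j) - y) + d j" for j
      by (simp add: w_def d_def G_def blinfun.diff_right)
    have d_le: "norm (d j) \<le> norm L * ?\<epsilon> j" for j
      unfolding d_def \<epsilon>_eq by (rule norm_blinfun)
    have w_le: "norm (w j) \<le> \<rho> j + norm L * ?\<epsilon> j" for j
      using norm_triangle_ineq[of "G (\<theta> j) - y" "d j"] d_le[of j] by (simp add: w_eq \<rho>_def)
    have Adj_g: "Adj (\<theta> j) (u j (\<kappa> j)) (adjoint L (w j)) (g j)" for j
    proof -
      obtain g' where "Adj (\<theta> j) (u j (\<kappa> j)) (adjoint L (w j)) g'" "\<theta> (Suc j) = \<theta> j - g'"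
        using run unfolding bilevel_run_def w_def by blast
      then show ?thesis by (simp add: g_def)
    qed
    have g_error: "\<bar>inner (w j) (G' (\<theta> j) \<xi>) - inner (g j) \<xi>\<bar> \<le> CfA * ?\<epsilon> j * norm L * norm (w j) * norm \<xi>"
      if \<theta>: "\<theta> j \<in> cball \<theta>d R" for j \<xi>
    proof -
      have "\<bar>inner (w j) (G' (\<theta> j) \<xi>) - inner (g j) \<xi>\<bar> \<le> CfA * ?\<epsilon> j * norm (adjoint L (w j)) * norm \<xi>"
        using adjoint_error[OF \<theta> u_ball[OF order_refl \<theta>] Adj_g, of \<xi>] by (simp add: L_adj G'_eq \<epsilon>_eq)
      also have "\<dots> \<le> CfA * ?\<epsilon> j * (norm L * norm (w j)) * norm \<xi>"
        using CfA0 \<epsilon>0 L_adj(2) by (intro mult_right_mono mult_left_mono) auto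
      finally show ?thesis by (simp add: mult_ac)
    qed
    have \<epsilon>bar0: "0 \<le> \<epsilon>bar" using \<epsilon>0 \<epsilon>_le order_trans by blast
    have MRt0: "0 \<le> MRtilde"
      unfolding MRtilde_def using positive CfA0 \<epsilon>bar0 by simp
    \<comment> \<open>The exact adjoint has norm at most \<open>MS \<parallel>L\<parallel>\<close>; the error of the approximate one is bounded
      through \<open>\<epsilon>bar\<close>.\<close>
    have g_le: "norm (g j) \<le> MRtilde * norm (w j)" if \<theta>: "\<theta> j \<in> cball \<theta>d R" for j
    proof (rule norm_le_if_inner_le)
      fix \<xi>
      have "norm (emb (S' (\<theta> j) \<xi>)) \<le> MS * norm \<xi>"
        using onorm[OF has_derivative_bounded_linear[OF embS_deriv], of "\<theta> j" \<xi>] A1[OF \<theta>]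
        by (meson mult_right_mono norm_ge_zero order_trans)
      then have "norm (G' (\<theta> j) \<xi>) \<le> norm L * (MS * norm \<xi>)"
        unfolding G'_eq by (meson mult_left_mono norm_blinfun norm_ge_zero order_trans)
      then have "inner (w j) (G' (\<theta> j) \<xi>) \<le> norm (w j) * (norm L * (MS * norm \<xi>))"
        by (meson mult_left_mono norm_cauchy_schwarz norm_ge_zero order_trans)
      moreover have "CfA * ?\<epsilon> j * norm L * norm (w j) * norm \<xi> \<le> CfA * \<epsilon>bar * norm L * norm (w j) * norm \<xi>"
        using CfA0 \<epsilon>_le by (intro mult_right_mono mult_left_mono) auto
      ultimately have "inner (g j) \<xi> \<le> norm (w j) * (norm L * (MS * norm \<xi>)) +
          CfA * \<epsilon>bar * norm L * norm (w j) * norm \<xi>"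
        using g_error[OF \<theta>, of \<xi>] by linarith
      then show "inner (g j) \<xi> \<le> MRtilde * norm (w j) * norm \<xi>"
        by (simp add: MRtilde_def algebra_simps)
    qed (use MRt0 in simp)
    have "\<sigma> < \<mu>R" using adm unfolding admissible_def rule_a_def rule_b_def by blast
    have step: "a (Suc j) \<le> a j - (\<sigma> / 2 + s) * (\<rho> j)\<^sup>2 + Cpri * (?\<epsilon> j)\<^sup>2"
      if "a j \<le> R\<^sup>2" for j
    proof -
      have \<theta>: "\<theta> j \<in> cball \<theta>d R" using that ball by simp
      let ?e = "\<theta> j - \<theta>d"
      have e: "norm ?e \<le> R" using \<theta> by (simp add: dist_norm norm_minus_commute)
      have y: "y = G \<theta>d" by (simp add: y_def)
      have "\<theta> (Suc j) - \<theta>d = ?e - g j" by (simp add: g_def)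
      moreover have "(norm (?e - g j))\<^sup>2 \<le> (norm ?e)\<^sup>2 -
          (\<sigma> / 2 + (MR\<^sup>2 + \<mu>R / 2 - (1 + \<eta>) * MRtilde\<^sup>2)) * (norm (G (\<theta> j) - y))\<^sup>2 + (norm L)\<^sup>2 *
          (2 * (KR + CfA * R)\<^sup>2 / (\<mu>R - \<sigma>) + (1 + 1 / \<eta>) * MRtilde\<^sup>2 + 2 * CfA * R) * (?\<epsilon> j)\<^sup>2"
      proof (rule inexact_adjoint_step[where q="G' (\<theta> j) ?e" and d="d j"])
        have "CfA * ?\<epsilon> j * norm L * norm (w j) * norm ?e \<le> CfA * ?\<epsilon> j * norm L * norm (w j) * R"
          using CfA0 \<epsilon>0 e by (intro mult_left_mono) auto
        with g_error[OF \<theta>, of ?e]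
        show "\<bar>inner (G (\<theta> j) - y + d j) (G' (\<theta> j) ?e) - inner (g j) ?e\<bar> \<le>
            CfA * ?\<epsilon> j * norm L * norm (G (\<theta> j) - y + d j) * R"
          unfolding w_eq by linarith
        show "norm (g j) \<le> MRtilde * norm (G (\<theta> j) - y + d j)" using g_le[OF \<theta>] unfolding w_eq .
        show "(MR\<^sup>2 + \<mu>R) * (norm (G (\<theta> j) - y))\<^sup>2 \<le> 2 * inner (G (\<theta> j) - y) (G' (\<theta> j) ?e)"
          "norm (G' (\<theta> j) ?e) \<le> KR * norm (G (\<theta> j) - y)"
          using A7[OF \<theta> center(1)] unfolding y by auto
      qed (use d_le CfA0 radii \<epsilon>0 positive \<eta> \<open>\<sigma> < \<mu>R\<close> in auto)
      ultimately show ?thesis by (simp only: a_def s_def \<rho>_def Cpri_def)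
    qed
    \<comment> \<open>Since \<open>\<parallel>L\<parallel>\<^sup>2\<close> times this positive number is at most \<open>Cpri\<close>, a bound on \<open>Cpri \<epsilon>\<^sub>j\<^sup>2\<close> bounds
      \<open>(\<parallel>L\<parallel> \<epsilon>\<^sub>j)\<^sup>2\<close>, even when \<open>L = 0\<close>.\<close>
    have k: "0 < 2 * (KR + CfA * R)\<^sup>2 / (\<mu>R - \<sigma>)"
    proof -
      have "0 < KR + CfA * R" using positive CfA0 radii by (simp add: add_pos_nonneg)
      then show ?thesis using \<open>\<sigma> < \<mu>R\<close> by simp
    qed
    have Cpri_ge: "(norm L)\<^sup>2 * (2 * (KR + CfA * R)\<^sup>2 / (\<mu>R - \<sigma>)) \<le> Cpri"
      unfolding Cpri_def using CfA0 radii \<eta> by (intro mult_left_mono) auto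
    have Cpri0: "0 \<le> Cpri" using Cpri_ge k by (meson mult_nonneg_nonneg order_trans less_imp_le zero_le_power2)

    \<comment> \<open>Under rule (b) nothing forces \<open>\<epsilon>\<^sub>j \<rightarrow> 0\<close> if \<open>L = 0\<close>; the quantity that enters the update is
      \<open>\<parallel>L\<parallel> \<epsilon>\<^sub>j\<close>, and that always vanishes.\<close>
    have outer: "(\<forall>j. a j \<le> R\<^sup>2) \<and> \<rho> \<longlonglongrightarrow> 0 \<and> (\<lambda>j. norm L * ?\<epsilon> j) \<longlonglongrightarrow> 0"
    proof (cases "rule_a \<theta> u \<kappa>")
      case True
      then obtain R0 where \<sigma>: "0 \<le> \<sigma>" and R0: "norm (\<theta> 0 - \<theta>d) \<le> R0"
        and sum: "summable (\<lambda>j. (?\<epsilon> j)\<^sup>2)" "Cpri * (\<Sum>j. (?\<epsilon> j)\<^sup>2) \<le> R\<^sup>2 - R0\<^sup>2"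
        unfolding rule_a_def by blast
      have descent: "a (Suc j) \<le> a j - s * (\<rho> j)\<^sup>2 + Cpri * (?\<epsilon> j)\<^sup>2" if "a j \<le> R\<^sup>2" for j
        using step[OF that] mult_nonneg_nonneg[OF \<sigma> zero_le_power2[of "\<rho> j"]]
        by (simp add: distrib_right)
      have start: "a 0 + (\<Sum>j. Cpri * (?\<epsilon> j)\<^sup>2) \<le> R\<^sup>2"
        using power_mono[OF R0, of 2] sum by (simp add: a_def suminf_mult)
      have nonneg: "0 \<le> Cpri * (?\<epsilon> j)\<^sup>2" for j using Cpri0 by simp
      note conv = perturbed_descent[where a=a and B="R\<^sup>2" and s=s and \<rho>="\<lambda>j. (\<rho> j)\<^sup>2"
          and c="\<lambda>j. Cpri * (?\<epsilon> j)\<^sup>2",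
          OF descent start summable_mult[OF sum(1)] nonneg s zero_le_power2 a0]
      have "a j \<le> R\<^sup>2" for j by (rule conv(1))
      moreover have "(\<lambda>j. (\<rho> j)\<^sup>2) \<longlonglongrightarrow> 0" by (rule conv(2))
      moreover have "(\<lambda>j. norm L * ?\<epsilon> j) \<longlonglongrightarrow> 0"
        using summable_LIMSEQ_zero[OF sum(1)] by (intro tendsto_mult_right_zero) simp
      ultimately show ?thesis by simp
    next
      case False
      then have b: "0 < \<nu>" "\<nu> < \<sigma> / 2" and pos: "\<And>j. Cpos * ?\<epsilon> j \<le> \<rho> j"
        using adm unfolding admissible_def rule_b_def \<rho>_def by blast+
      have Cpri_le: "Cpri * (?\<epsilon> j)\<^sup>2 \<le> (\<sigma> / 2 - \<nu>) * (\<rho> j)\<^sup>2" for j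
      proof -
        have "0 \<le> Cpos" unfolding Cpos_def using Cpri0 b by simp
        then have "(Cpos * ?\<epsilon> j)\<^sup>2 \<le> (\<rho> j)\<^sup>2" using pos \<epsilon>0 by (intro power_mono) auto
        moreover have "Cpos\<^sup>2 = Cpri / (\<sigma> / 2 - \<nu>)" unfolding Cpos_def using Cpri0 b by simp
        ultimately show ?thesis using b by (simp add: power_mult_distrib pos_divide_le_eq mult.commute)
      qed
      have descent: "a (Suc j) \<le> a j - s * (\<rho> j)\<^sup>2 + 0" if "a j \<le> R\<^sup>2" for j
        using step[OF that] Cpri_le[of j] mult_nonneg_nonneg[OF less_imp_le[OF b(1)] zero_le_power2[of "\<rho> j"]]
        by (simp add: algebra_simps)
      have start: "a 0 + (\<Sum>j. 0) \<le> R\<^sup>2"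
        using adm ball[of 0] unfolding admissible_def by simp
      note conv = perturbed_descent[where a=a and B="R\<^sup>2" and s=s and \<rho>="\<lambda>j. (\<rho> j)\<^sup>2"
          and c="\<lambda>j. 0", OF descent start summable_zero order_refl s zero_le_power2 a0]
      have "a j \<le> R\<^sup>2" for j by (rule conv(1))
      moreover have \<rho>: "(\<lambda>j. (\<rho> j)\<^sup>2) \<longlonglongrightarrow> 0" by (rule conv(2))
      moreover have "(\<lambda>j. (norm L * ?\<epsilon> j)\<^sup>2) \<longlonglongrightarrow> 0"
      proof (rule Lim_null_comparison)
        let ?k = "2 * (KR + CfA * R)\<^sup>2 / (\<mu>R - \<sigma>)"
        have "?k * (norm L * ?\<epsilon> j)\<^sup>2 \<le> (\<sigma> / 2 - \<nu>) * (\<rho> j)\<^sup>2" for j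
          using mult_right_mono[OF Cpri_ge, of "(?\<epsilon> j)\<^sup>2"] Cpri_le[of j]
          by (simp add: power_mult_distrib mult_ac)
        then have "(norm L * ?\<epsilon> j)\<^sup>2 \<le> (\<sigma> / 2 - \<nu>) * (\<rho> j)\<^sup>2 / ?k" for j
          using k by (subst pos_le_divide_eq) (simp_all only: mult.commute)
        then show "\<forall>\<^sub>F j in sequentially. norm ((norm L * ?\<epsilon> j)\<^sup>2) \<le> (\<sigma> / 2 - \<nu>) * (\<rho> j)\<^sup>2 / ?k"
          by (simp only: real_norm_def abs_power2) simp
        show "(\<lambda>j. (\<sigma> / 2 - \<nu>) * (\<rho> j)\<^sup>2 / ?k) \<longlonglongrightarrow> 0"
          by (intro tendsto_divide_zero tendsto_mult_right_zero \<rho>)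
      qed
      ultimately show ?thesis by simp
    qed
    then have \<theta>_ball: "\<theta> j \<in> cball \<theta>d R" for j using ball by blast
    show "\<theta> j \<in> cball \<theta>d R" by (rule \<theta>_ball)

    have F_S: "F \<theta>' (S \<theta>') = 0" for \<theta>' by (rule S_solves)
    show "(1 + real (\<kappa> j) * c) * (norm (u j (\<kappa> j) - S (\<theta> j)))\<^sup>2 \<le> (norm (u j 0 - S (\<theta> j)))\<^sup>2"
      unfolding c_def
    proof (rule landweber_state_error[where \<Phi>="F (\<theta> j)" and M=Mr])
      show "landweber (F (\<theta> j)) (u j) (\<kappa> j)" using run unfolding bilevel_run_def by blast
      fix k assume k: "k < \<kappa> j"
      then have uk: "u j k \<in> cball ud r" using u_ball \<theta>_ball by simp
      show "F (\<theta> j) differentiable (at (u j k))" by (rule F_diff)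
      show "onorm (frechet_derivative (F (\<theta> j)) (at (u j k))) \<le> Mr"
        using A4[OF \<theta>_ball[of j] uk] unfolding F'_def .
      show "(Mr\<^sup>2 + \<mu>r) * (norm (F (\<theta> j) (u j k)))\<^sup>2 \<le>
          2 * inner (F (\<theta> j) (u j k)) (frechet_derivative (F (\<theta> j)) (at (u j k)) (u j k - S (\<theta> j)))"
        using A5[OF \<theta>_ball[of j] uk S_ball[OF \<theta>_ball[of j]]] unfolding F'_def F_S by simp
      show "norm (u j k - S (\<theta> j)) \<le> Ccoe * norm (F (\<theta> j) (u j k))"
        using A6[OF \<theta>_ball[of j] uk] unfolding F_S by simp
    qed (use positive in auto)

    show "(\<lambda>j. norm (\<theta> (Suc j) - \<theta> j)) \<longlonglongrightarrow> 0"
    proof (rule Lim_null_comparison)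
      have "norm (\<theta> (Suc j) - \<theta> j) \<le> MRtilde * (\<rho> j + norm L * ?\<epsilon> j)" for j
        using g_le[OF \<theta>_ball, of j] mult_left_mono[OF w_le MRt0, of j]
        by (simp add: g_def norm_minus_commute)
      then show "\<forall>\<^sub>F j in sequentially. norm (norm (\<theta> (Suc j) - \<theta> j)) \<le> MRtilde * (\<rho> j + norm L * ?\<epsilon> j)"
        by simp
      show "(\<lambda>j. MRtilde * (\<rho> j + norm L * ?\<epsilon> j)) \<longlonglongrightarrow> 0"
        using tendsto_add[of \<rho> 0 sequentially "\<lambda>j. norm L * ?\<epsilon> j" 0] outer
        by (intro tendsto_mult_right_zero) simp
    qed
  qed

  \<comment> \<open>The number of lower-level steps is governed by the initial error of that level.\<close>
  have count: "real (\<kappa> j) * (\<epsilon> \<theta> u \<kappa> j)\<^sup>2 \<le> (norm (u j 0 - S (\<theta> j)))\<^sup>2 / c"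
    if run: "bilevel_run F S Adj L emb y r \<theta> u \<kappa>" and adm: "admissible \<theta> u \<kappa>" for \<theta> u \<kappa> j
  proof -
    have "\<epsilon> \<theta> u \<kappa> j \<le> norm (u j (\<kappa> j) - S (\<theta> j))"
      unfolding \<epsilon>_def state_error_def using norm_emb_le by (metis blinfun.diff_right)
    then have "(\<epsilon> \<theta> u \<kappa> j)\<^sup>2 \<le> (norm (u j (\<kappa> j) - S (\<theta> j)))\<^sup>2"
      by (rule power_mono) (simp add: \<epsilon>_def state_error_def)
    then have "real (\<kappa> j) * c * (\<epsilon> \<theta> u \<kappa> j)\<^sup>2 \<le> real (\<kappa> j) * c * (norm (u j (\<kappa> j) - S (\<theta> j)))\<^sup>2"
      using c by (intro mult_left_mono) auto
    also have "\<dots> \<le> (1 + real (\<kappa> j) * c) * (norm (u j (\<kappa> j) - S (\<theta> j)))\<^sup>2"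
      by (intro mult_right_mono) auto
    also have "\<dots> \<le> (norm (u j 0 - S (\<theta> j)))\<^sup>2" by (rule run_facts(2)[OF run adm])
    finally show ?thesis using c by (simp add: pos_le_divide_eq mult_ac)
  qed

  show ?thesis
  proof (intro conjI allI impI; elim conjE)
    fix \<theta> u K assume run: "bilevel_run F S Adj L emb y r \<theta> u K" and adm: "admissible \<theta> u K"
    let ?\<epsilon> = "\<epsilon> \<theta> u K"
    show "(\<lambda>j. real (K j)) \<in> O[sequentially_nonzero ?\<epsilon>](\<lambda>j. 1 / (?\<epsilon> j)\<^sup>2)"
    proof (rule bigoI[where c="(r / 2)\<^sup>2 / c"])
      have "norm (real (K j)) \<le> (r / 2)\<^sup>2 / c * norm (1 / (?\<epsilon> j)\<^sup>2)" if "?\<epsilon> j \<noteq> 0" for j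
      proof -
        have "u j 0 \<in> cball (S (\<theta> j)) (r / 2)" using run unfolding bilevel_run_def by blast
        then have "(norm (u j 0 - S (\<theta> j)))\<^sup>2 \<le> (r / 2)\<^sup>2"
          by (intro power_mono) (simp_all add: dist_norm norm_minus_commute)
        then have "real (K j) * (?\<epsilon> j)\<^sup>2 \<le> (r / 2)\<^sup>2 / c"
          using count[OF run adm, of j] c by (meson divide_right_mono less_imp_le order_trans)
        then have "real (K j) \<le> (r / 2)\<^sup>2 / c / (?\<epsilon> j)\<^sup>2"
          using that by (subst pos_le_divide_eq) auto
        then show ?thesis by simp
      qed
      then show "\<forall>\<^sub>F j in sequentially_nonzero ?\<epsilon>.
          norm (real (K j)) \<le> (r / 2)\<^sup>2 / c * norm (1 / (?\<epsilon> j)\<^sup>2)"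
        unfolding sequentially_nonzero_def eventually_inf_principal by (intro always_eventually) auto
    qed
  next
    fix \<theta> u \<kappa> assume seq: "sequential_bilevel_run F S Adj L emb y r \<theta> u \<kappa>" and adm: "admissible \<theta> u \<kappa>"
    let ?\<epsilon> = "\<epsilon> \<theta> u \<kappa>"
    have run: "bilevel_run F S Adj L emb y r \<theta> u \<kappa>" and warm: "\<And>j. u (Suc j) 0 = u j (\<kappa> j)"
      using seq unfolding sequential_bilevel_run_def by auto
    note \<theta>_ball = run_facts(1)[OF run adm]
    define b where "b j = norm (u j (\<kappa> j) - S (\<theta> j))" for j
    define \<delta> where "\<delta> j = norm (S (\<theta> j) - S (\<theta> (Suc j)))" for j
    have S_lip: "norm (S \<theta>1 - S \<theta>2) \<le> MSbar * norm (\<theta>1 - \<theta>2)"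
      if "\<theta>1 \<in> cball \<theta>d R" "\<theta>2 \<in> cball \<theta>d R" for \<theta>1 \<theta>2
      by (rule differentiable_bound[OF convex_cball has_derivative_at_withinI[OF S_deriv] _ that])
        (use A1 in blast)
    have \<delta>: "\<delta> \<longlonglongrightarrow> 0"
    proof (rule Lim_null_comparison)
      show "\<forall>\<^sub>F j in sequentially. norm (\<delta> j) \<le> MSbar * norm (\<theta> (Suc j) - \<theta> j)"
        using S_lip[OF \<theta>_ball \<theta>_ball] by (intro always_eventually) (simp add: \<delta>_def norm_minus_commute)
      show "(\<lambda>j. MSbar * norm (\<theta> (Suc j) - \<theta> j)) \<longlonglongrightarrow> 0"
        by (rule tendsto_mult_right_zero[OF run_facts(3)[OF run adm]])
    qed
    \<comment> \<open>The warm start: the initial error is the previous final error plus the distance between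
      consecutive states, and both tend to \<open>0\<close>.\<close>
    have start: "norm (u (Suc j) 0 - S (\<theta> (Suc j))) \<le> b j + \<delta> j" for j
      using norm_triangle_ineq[of "u j (\<kappa> j) - S (\<theta> j)" "S (\<theta> j) - S (\<theta> (Suc j))"]
      by (simp add: warm b_def \<delta>_def)
    define q where "q = 1 / sqrt (1 + c)"
    have q: "0 \<le> q" "q < 1" using c by (simp_all add: q_def)
    have contract: "b (Suc j) \<le> q * (b j + \<delta> j)" for j
    proof -
      \<comment> \<open>At least one step is made, so every level contracts by \<open>q\<close>.\<close>
      have "1 \<le> \<kappa> (Suc j)" using run unfolding bilevel_run_def by blast
      then have "1 + c \<le> 1 + real (\<kappa> (Suc j)) * c" using c by simp
      then have "(1 + c) * (b (Suc j))\<^sup>2 \<le> (norm (u (Suc j) 0 - S (\<theta> (Suc j))))\<^sup>2"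
        using run_facts(2)[OF run adm, of "Suc j"]
        by (simp only: b_def) (meson mult_right_mono order_trans zero_le_power2)
      also have "\<dots> \<le> (b j + \<delta> j)\<^sup>2" by (rule power_mono[OF start]) simp
      finally have "(sqrt (1 + c) * b (Suc j))\<^sup>2 \<le> (b j + \<delta> j)\<^sup>2"
        using c by (simp add: power_mult_distrib)
      then have "sqrt (1 + c) * b (Suc j) \<le> b j + \<delta> j"
        by (rule power2_le_imp_le) (simp add: b_def \<delta>_def)
      then show ?thesis using c by (simp add: q_def pos_le_divide_eq mult.commute)
    qed
    have b_lim: "b \<longlonglongrightarrow> 0"
      by (rule contraction_with_vanishing_perturbation[OF contract q \<delta>]) (simp add: b_def)
    have lim: "(\<lambda>j. (b j + \<delta> j)\<^sup>2 / c) \<longlonglongrightarrow> 0"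
      using tendsto_divide[OF tendsto_power[OF tendsto_add[OF b_lim \<delta>], of 2] tendsto_const, of c] c by simp
    show "(\<lambda>j. real (\<kappa> j)) \<in> o[sequentially_nonzero ?\<epsilon>](\<lambda>j. 1 / (?\<epsilon> j)\<^sup>2)"
    proof (rule landau_o.smallI)
      fix e :: real assume "0 < e"
      have "\<forall>\<^sub>F j in sequentially. (b j + \<delta> j)\<^sup>2 / c < e"
        by (rule order_tendstoD(2)[OF lim \<open>0 < e\<close>])
      then have "\<forall>\<^sub>F j in sequentially. real (\<kappa> (Suc j)) * (?\<epsilon> (Suc j))\<^sup>2 \<le> e"
      proof eventually_elim
        case (elim j)
        have "(norm (u (Suc j) 0 - S (\<theta> (Suc j))))\<^sup>2 / c \<le> (b j + \<delta> j)\<^sup>2 / c"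
          using c by (intro divide_right_mono power_mono start) auto
        then show ?case using count[OF run adm, of "Suc j"] elim by linarith
      qed
      then have "\<forall>\<^sub>F j in sequentially. real (\<kappa> j) * (?\<epsilon> j)\<^sup>2 \<le> e"
        by (rule eventually_sequentially_Suc[THEN iffD1])
      then show "\<forall>\<^sub>F j in sequentially_nonzero ?\<epsilon>. norm (real (\<kappa> j)) \<le> e * norm (1 / (?\<epsilon> j)\<^sup>2)"
        unfolding sequentially_nonzero_def eventually_inf_principal
        by eventually_elim (simp add: pos_le_divide_eq)
    qed
  qed
qed

end
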